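(* Let $A$ be a finite dimensional algebra over a field $K$ such that $\operatorname{Hom}_A(DA,A)=0$. Then for every $m\ge 1$ the $m$-th SGC extension $A^{[m]}$ is Morita equivalent to the $m$-th replicated algebra $A^{(m)}$.
   Context: Modules are finite dimensional right modules; $D=\operatorname{Hom}_K(-,K)$, and $DA$ is regarded as an $A$-bimodule. SGC extensions: $A^{[0]}:=A$ and $A^{[m+1]}:=\operatorname{End}_{A^{[m]}}(A^{[m]}\oplus DA^{[m]})$. Replicated algebra: $A^{(m)}$ is the algebra of $(m+1)\times(m+1)$ matrices (rows and columns indexed by $0,\dots,m$) with diagonal entries $(i,i)$ in $A$, sub-diagonal entries $(i,i-1)$ in $DA$ for $1\le i\le m$, and all other entries zero; multiplication is matrix multiplication using the multiplication of $A$, the $A$-bimodule structure of $DA$, and the zero map $DA\otimes_A DA\to 0$. *)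

theory Defs
  imports "HOL-Algebra.Module" "HOL-Library.FuncSet"
begin

text \<open>
  The ground field is a structure \<open>K\<close> with \<open>field K\<close>. Vector spaces and algebras over \<open>K\<close> are
  records of the library type \<open>module\<close>; the ring part of such a record is irrelevant when only
  the vector space structure matters. (The locale \<open>algebra\<close> of the library is restricted to
  commutative algebras.) Maps between structures are extensional functions on the carriers, so that
  Hom-spaces are honest sets.
\<close>

section \<open>Finite dimensional algebras and modules\<close>

definition lincomb :: "('k, 'v, 'e) module_scheme \<Rightarrow> nat \<Rightarrow> (nat \<Rightarrow> 'v) \<Rightarrow> (nat \<Rightarrow> 'k) \<Rightarrow> 'v" where
  "lincomb V n b c = (\<Oplus>\<^bsub>V\<^esub>i\<in>{..<n}. c i \<odot>\<^bsub>V\<^esub> b i)"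

definition is_basis ::
    "('k, 'z) ring_scheme \<Rightarrow> ('k, 'v, 'e) module_scheme \<Rightarrow> nat \<Rightarrow> (nat \<Rightarrow> 'v) \<Rightarrow> bool" where
  "is_basis K V n b \<longleftrightarrow> b \<in> {..<n} \<rightarrow> carrier V \<and>
     bij_betw (lincomb V n b) ({..<n} \<rightarrow>\<^sub>E carrier K) (carrier V)"

definition finite_dimensional :: "('k, 'z) ring_scheme \<Rightarrow> ('k, 'v, 'e) module_scheme \<Rightarrow> bool" where
  "finite_dimensional K V \<longleftrightarrow> (\<exists>n b. is_basis K V n b)"

locale fd_algebra = module K A + ring A for K (structure) and A (structure) +
  assumes smult_mult_left:
      "\<lbrakk>k \<in> carrier K; x \<in> carrier A; y \<in> carrier A\<rbrakk> \<Longrightarrow>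
         (k \<odot>\<^bsub>A\<^esub> x) \<otimes>\<^bsub>A\<^esub> y = k \<odot>\<^bsub>A\<^esub> (x \<otimes>\<^bsub>A\<^esub> y)"
    and smult_mult_right:
      "\<lbrakk>k \<in> carrier K; x \<in> carrier A; y \<in> carrier A\<rbrakk> \<Longrightarrow>
         x \<otimes>\<^bsub>A\<^esub> (k \<odot>\<^bsub>A\<^esub> y) = k \<odot>\<^bsub>A\<^esub> (x \<otimes>\<^bsub>A\<^esub> y)"
    and finite_dim: "finite_dimensional K A"

record ('k, 'a, 'm) right_module = "('k, 'm) module" +
  act :: "'m \<Rightarrow> 'a \<Rightarrow> 'm" (infixl \<open>\<triangleleft>\<index>\<close> 70)

locale fd_right_module = module K M
  for K (structure) and A :: "('k, 'a, 'e) module_scheme" (structure) and M (structure) +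
  assumes act_closed:
      "\<lbrakk>x \<in> carrier M; a \<in> carrier A\<rbrakk> \<Longrightarrow> x \<triangleleft>\<^bsub>M\<^esub> a \<in> carrier M"
    and act_l_distr:
      "\<lbrakk>x \<in> carrier M; y \<in> carrier M; a \<in> carrier A\<rbrakk> \<Longrightarrow>
         (x \<oplus>\<^bsub>M\<^esub> y) \<triangleleft>\<^bsub>M\<^esub> a = x \<triangleleft>\<^bsub>M\<^esub> a \<oplus>\<^bsub>M\<^esub> y \<triangleleft>\<^bsub>M\<^esub> a"
    and act_r_distr:
      "\<lbrakk>x \<in> carrier M; a \<in> carrier A; b \<in> carrier A\<rbrakk> \<Longrightarrow>
         x \<triangleleft>\<^bsub>M\<^esub> (a \<oplus>\<^bsub>A\<^esub> b) = x \<triangleleft>\<^bsub>M\<^esub> a \<oplus>\<^bsub>M\<^esub> x \<triangleleft>\<^bsub>M\<^esub> b"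
    and act_assoc:
      "\<lbrakk>x \<in> carrier M; a \<in> carrier A; b \<in> carrier A\<rbrakk> \<Longrightarrow>
         x \<triangleleft>\<^bsub>M\<^esub> (a \<otimes>\<^bsub>A\<^esub> b) = (x \<triangleleft>\<^bsub>M\<^esub> a) \<triangleleft>\<^bsub>M\<^esub> b"
    and act_one: "x \<in> carrier M \<Longrightarrow> x \<triangleleft>\<^bsub>M\<^esub> \<one>\<^bsub>A\<^esub> = x"
    and act_smult_left:
      "\<lbrakk>k \<in> carrier K; x \<in> carrier M; a \<in> carrier A\<rbrakk> \<Longrightarrow>
         (k \<odot>\<^bsub>M\<^esub> x) \<triangleleft>\<^bsub>M\<^esub> a = k \<odot>\<^bsub>M\<^esub> (x \<triangleleft>\<^bsub>M\<^esub> a)"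
    and act_smult_right:
      "\<lbrakk>k \<in> carrier K; x \<in> carrier M; a \<in> carrier A\<rbrakk> \<Longrightarrow>
         x \<triangleleft>\<^bsub>M\<^esub> (k \<odot>\<^bsub>A\<^esub> a) = k \<odot>\<^bsub>M\<^esub> (x \<triangleleft>\<^bsub>M\<^esub> a)"
    and finite_dim: "finite_dimensional K M"


section \<open>Hom-spaces, duals, direct sums, endomorphism algebras\<close>

definition linear_hom ::
    "('k, 'z) ring_scheme \<Rightarrow> ('k, 'v, 'e) module_scheme \<Rightarrow> ('k, 'w, 'f) module_scheme
      \<Rightarrow> ('k, 'v \<Rightarrow> 'w) module" where
  "linear_hom K V W =
     \<lparr>carrier = {f \<in> carrier V \<rightarrow>\<^sub>E carrier W.
        (\<forall>x\<in>carrier V. \<forall>y\<in>carrier V. f (x \<oplus>\<^bsub>V\<^esub> y) = f x \<oplus>\<^bsub>W\<^esub> f y) \<and>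
        (\<forall>k\<in>carrier K. \<forall>x\<in>carrier V. f (k \<odot>\<^bsub>V\<^esub> x) = k \<odot>\<^bsub>W\<^esub> f x)},
      mult = undefined, one = undefined,
      zero = (\<lambda>x\<in>carrier V. \<zero>\<^bsub>W\<^esub>),
      add = (\<lambda>f g. \<lambda>x\<in>carrier V. f x \<oplus>\<^bsub>W\<^esub> g x),
      smult = (\<lambda>k f. \<lambda>x\<in>carrier V. k \<odot>\<^bsub>W\<^esub> f x)\<rparr>"

definition module_hom ::
    "('k, 'z) ring_scheme \<Rightarrow> ('k, 'a, 'e) module_scheme
      \<Rightarrow> ('k, 'a, 'm) right_module \<Rightarrow> ('k, 'a, 'n) right_module \<Rightarrow> ('k, 'm \<Rightarrow> 'n) module" where
  "module_hom K A M N = (linear_hom K M N)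
     \<lparr>carrier := {f \<in> carrier (linear_hom K M N).
        \<forall>x\<in>carrier M. \<forall>a\<in>carrier A. f (x \<triangleleft>\<^bsub>M\<^esub> a) = f x \<triangleleft>\<^bsub>N\<^esub> a}\<rparr>"

text \<open>Endomorphisms of right modules act from the left: the product of \<open>f\<close> and \<open>g\<close> is
  \<open>x \<mapsto> f (g x)\<close>.\<close>

definition End_algebra ::
    "('k, 'z) ring_scheme \<Rightarrow> ('k, 'a, 'e) module_scheme \<Rightarrow> ('k, 'a, 'm) right_module
      \<Rightarrow> ('k, 'm \<Rightarrow> 'm) module" where
  "End_algebra K A M = (module_hom K A M M)
     \<lparr>mult := compose (carrier M), one := (\<lambda>x\<in>carrier M. x)\<rparr>"

definition regular_module :: "('k, 'a, 'e) module_scheme \<Rightarrow> ('k, 'a, 'a) right_module" where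
  "regular_module A =
     \<lparr>carrier = carrier A, mult = undefined, one = undefined, zero = \<zero>\<^bsub>A\<^esub>, add = add A,
      smult = smult A, act = mult A\<rparr>"

definition ground_space :: "('k, 'z) ring_scheme \<Rightarrow> ('k, 'k) module" where
  "ground_space K =
     \<lparr>carrier = carrier K, mult = mult K, one = \<one>\<^bsub>K\<^esub>, zero = \<zero>\<^bsub>K\<^esub>, add = add K,
      smult = mult K\<rparr>"

text \<open>The bimodule \<open>DA = Hom\<^sub>K(A, K)\<close> with \<open>(a \<cdot> \<phi> \<cdot> b) x = \<phi> (b x a)\<close>: its right module structure
  is part of \<open>dual_module\<close>, its left action is \<open>dual_left_act\<close>.\<close>

definition dual_module ::
    "('k, 'z) ring_scheme \<Rightarrow> ('k, 'a, 'e) module_scheme \<Rightarrow> ('k, 'a, 'a \<Rightarrow> 'k) right_module" where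
  "dual_module K A = (let H = linear_hom K A (ground_space K) in
     \<lparr>carrier = carrier H, mult = undefined, one = undefined, zero = zero H, add = add H,
      smult = smult H, act = (\<lambda>\<phi> a. \<lambda>x\<in>carrier A. \<phi> (a \<otimes>\<^bsub>A\<^esub> x))\<rparr>)"

definition dual_left_act :: "('k, 'a, 'e) module_scheme \<Rightarrow> 'a \<Rightarrow> ('a \<Rightarrow> 'k) \<Rightarrow> 'a \<Rightarrow> 'k" where
  "dual_left_act A a \<phi> = (\<lambda>x\<in>carrier A. \<phi> (x \<otimes>\<^bsub>A\<^esub> a))"

definition direct_sum ::
    "('k, 'a, 'm) right_module \<Rightarrow> ('k, 'a, 'n) right_module \<Rightarrow> ('k, 'a, 'm \<times> 'n) right_module" where
  "direct_sum M N =
     \<lparr>carrier = carrier M \<times> carrier N, mult = undefined, one = undefined,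
      zero = (\<zero>\<^bsub>M\<^esub>, \<zero>\<^bsub>N\<^esub>),
      add = (\<lambda>(x, y) (x', y'). (x \<oplus>\<^bsub>M\<^esub> x', y \<oplus>\<^bsub>N\<^esub> y')),
      smult = (\<lambda>k (x, y). (k \<odot>\<^bsub>M\<^esub> x, k \<odot>\<^bsub>N\<^esub> y)),
      act = (\<lambda>(x, y) a. (x \<triangleleft>\<^bsub>M\<^esub> a, y \<triangleleft>\<^bsub>N\<^esub> a))\<rparr>"


section \<open>SGC extensions\<close>

text \<open>
  Literally, the underlying sets of the iterated algebras \<open>A\<^bsup>[m]\<^esup>\<close> live in different types for
  different \<open>m\<close>. To define them by recursion on \<open>m\<close>, every algebra is replaced by an isomorphic
  copy with underlying set \<open>K\<^sup>n\<close>, obtained by transport of structure along the coordinate map of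
  some basis (see \<open>coordinate_copy_iso\<close> below). Hence \<open>SGC K A m\<close> is \<open>A\<^bsup>[m]\<^esup>\<close> up to isomorphism
  of \<open>K\<close>-algebras.
\<close>

definition chosen_basis ::
    "('k, 'z) ring_scheme \<Rightarrow> ('k, 'v, 'e) module_scheme \<Rightarrow> nat \<times> (nat \<Rightarrow> 'v)" where
  "chosen_basis K V = (SOME (n, b). is_basis K V n b)"

definition from_coords ::
    "('k, 'z) ring_scheme \<Rightarrow> ('k, 'v, 'e) module_scheme \<Rightarrow> (nat \<Rightarrow> 'k) \<Rightarrow> 'v" where
  "from_coords K V = lincomb V (fst (chosen_basis K V)) (snd (chosen_basis K V))"

definition coord_space :: "('k, 'z) ring_scheme \<Rightarrow> ('k, 'v, 'e) module_scheme \<Rightarrow> (nat \<Rightarrow> 'k) set" where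
  "coord_space K V = {..<fst (chosen_basis K V)} \<rightarrow>\<^sub>E carrier K"

definition to_coords ::
    "('k, 'z) ring_scheme \<Rightarrow> ('k, 'v, 'e) module_scheme \<Rightarrow> 'v \<Rightarrow> (nat \<Rightarrow> 'k)" where
  "to_coords K V = the_inv_into (coord_space K V) (from_coords K V)"

definition coordinate_copy ::
    "('k, 'z) ring_scheme \<Rightarrow> ('k, 'a, 'e) module_scheme \<Rightarrow> ('k, nat \<Rightarrow> 'k) module" where
  "coordinate_copy K A =
     \<lparr>carrier = coord_space K A,
      mult = (\<lambda>x y. to_coords K A (from_coords K A x \<otimes>\<^bsub>A\<^esub> from_coords K A y)),
      one = to_coords K A \<one>\<^bsub>A\<^esub>,
      zero = to_coords K A \<zero>\<^bsub>A\<^esub>,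
      add = (\<lambda>x y. to_coords K A (from_coords K A x \<oplus>\<^bsub>A\<^esub> from_coords K A y)),
      smult = (\<lambda>k x. to_coords K A (k \<odot>\<^bsub>A\<^esub> from_coords K A x))\<rparr>"

lemma coordinate_copy_iso:
  assumes "fd_algebra K A"
  defines "f \<equiv> from_coords K A" and "C \<equiv> coordinate_copy K A"
  shows "bij_betw f (carrier C) (carrier A)"
    and "f \<one>\<^bsub>C\<^esub> = \<one>\<^bsub>A\<^esub>" and "f \<zero>\<^bsub>C\<^esub> = \<zero>\<^bsub>A\<^esub>"
    and "\<And>x y. \<lbrakk>x \<in> carrier C; y \<in> carrier C\<rbrakk> \<Longrightarrow> f (x \<otimes>\<^bsub>C\<^esub> y) = f x \<otimes>\<^bsub>A\<^esub> f y"
    and "\<And>x y. \<lbrakk>x \<in> carrier C; y \<in> carrier C\<rbrakk> \<Longrightarrow> f (x \<oplus>\<^bsub>C\<^esub> y) = f x \<oplus>\<^bsub>A\<^esub> f y"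
    and "\<And>k x. \<lbrakk>k \<in> carrier K; x \<in> carrier C\<rbrakk> \<Longrightarrow> f (k \<odot>\<^bsub>C\<^esub> x) = k \<odot>\<^bsub>A\<^esub> f x"
proof -
  interpret fd_algebra K A by fact
  have "\<exists>p. (case p of (n, b) \<Rightarrow> is_basis K A n b)"
    using finite_dim by (auto simp: finite_dimensional_def)
  then have "case chosen_basis K A of (n, b) \<Rightarrow> is_basis K A n b"
    unfolding chosen_basis_def by (rule someI_ex)
  then have bij: "bij_betw f (coord_space K A) (carrier A)"
    by (auto simp: is_basis_def f_def from_coords_def[abs_def] coord_space_def split: prod.splits)
  then show "bij_betw f (carrier C) (carrier A)"
    by (simp add: C_def coordinate_copy_def)
  have inv: "f (to_coords K A y) = y" if "y \<in> carrier A" for y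
    using that bij unfolding to_coords_def f_def by (rule f_the_inv_into_f_bij_betw[rotated])
  have closed: "f x \<in> carrier A" if "x \<in> carrier C" for x
    using that bij_betwE[OF bij] by (auto simp: C_def coordinate_copy_def)
  show "f \<one>\<^bsub>C\<^esub> = \<one>\<^bsub>A\<^esub>" "f \<zero>\<^bsub>C\<^esub> = \<zero>\<^bsub>A\<^esub>"
    by (simp_all add: C_def coordinate_copy_def inv)
  show "f (x \<otimes>\<^bsub>C\<^esub> y) = f x \<otimes>\<^bsub>A\<^esub> f y" if "x \<in> carrier C" "y \<in> carrier C" for x y
    using closed[OF that(1)] closed[OF that(2)]
    by (simp add: C_def coordinate_copy_def inv flip: f_def)
  show "f (x \<oplus>\<^bsub>C\<^esub> y) = f x \<oplus>\<^bsub>A\<^esub> f y" if "x \<in> carrier C" "y \<in> carrier C" for x y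
    using closed[OF that(1)] closed[OF that(2)]
    by (simp add: C_def coordinate_copy_def inv flip: f_def)
  show "f (k \<odot>\<^bsub>C\<^esub> x) = k \<odot>\<^bsub>A\<^esub> f x" if "k \<in> carrier K" "x \<in> carrier C" for k x
    using that(1) closed[OF that(2)]
    by (simp add: C_def coordinate_copy_def inv flip: f_def)
qed

primrec SGC ::
    "('k, 'z) ring_scheme \<Rightarrow> ('k, 'a, 'e) module_scheme \<Rightarrow> nat \<Rightarrow> ('k, nat \<Rightarrow> 'k) module" where
  "SGC K A 0 = coordinate_copy K A"
| "SGC K A (Suc m) = coordinate_copy K
     (End_algebra K (SGC K A m) (direct_sum (regular_module (SGC K A m)) (dual_module K (SGC K A m))))"


section \<open>Replicated algebras\<close>

text \<open>
  The multiplication of \<open>A\<close>, the bimodule structure of \<open>DA\<close> and the zero map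
  \<open>DA \<otimes>\<^sub>A DA \<rightarrow> 0\<close> are together the multiplication of the algebra \<open>A \<oplus> DA\<close> below. Entries of
  matrices are taken there: an entry in \<open>A\<close> is a pair \<open>(a, 0)\<close>, one in \<open>DA\<close> is a pair \<open>(0, \<phi>)\<close>.
\<close>

definition entry_algebra ::
    "('k, 'z) ring_scheme \<Rightarrow> ('k, 'a, 'e) module_scheme \<Rightarrow> ('k, 'a \<times> ('a \<Rightarrow> 'k)) module" where
  "entry_algebra K A = (let D = dual_module K A in
     \<lparr>carrier = carrier A \<times> carrier D,
      mult = (\<lambda>(a, \<phi>) (b, \<psi>). (a \<otimes>\<^bsub>A\<^esub> b, dual_left_act A a \<psi> \<oplus>\<^bsub>D\<^esub> \<phi> \<triangleleft>\<^bsub>D\<^esub> b)),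
      one = (\<one>\<^bsub>A\<^esub>, \<zero>\<^bsub>D\<^esub>),
      zero = (\<zero>\<^bsub>A\<^esub>, \<zero>\<^bsub>D\<^esub>),
      add = (\<lambda>(a, \<phi>) (b, \<psi>). (a \<oplus>\<^bsub>A\<^esub> b, \<phi> \<oplus>\<^bsub>D\<^esub> \<psi>)),
      smult = (\<lambda>k (a, \<phi>). (k \<odot>\<^bsub>A\<^esub> a, k \<odot>\<^bsub>D\<^esub> \<phi>))\<rparr>)"

definition entry_set ::
    "('k, 'z) ring_scheme \<Rightarrow> ('k, 'a, 'e) module_scheme \<Rightarrow> nat \<times> nat \<Rightarrow> ('a \<times> ('a \<Rightarrow> 'k)) set" where
  "entry_set K A = (\<lambda>(i, j).
     if i = j then carrier A \<times> {\<zero>\<^bsub>dual_module K A\<^esub>}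
     else if i = Suc j then {\<zero>\<^bsub>A\<^esub>} \<times> carrier (dual_module K A)
     else {(\<zero>\<^bsub>A\<^esub>, \<zero>\<^bsub>dual_module K A\<^esub>)})"

definition replicated_algebra ::
    "('k, 'z) ring_scheme \<Rightarrow> ('k, 'a, 'e) module_scheme \<Rightarrow> nat
      \<Rightarrow> ('k, nat \<times> nat \<Rightarrow> 'a \<times> ('a \<Rightarrow> 'k)) module" where
  "replicated_algebra K A m = (let E = entry_algebra K A; I = {..m} \<times> {..m} in
     \<lparr>carrier = (\<Pi>\<^sub>E p\<in>I. entry_set K A p),
      mult = (\<lambda>X Y. \<lambda>(i, j)\<in>I. \<Oplus>\<^bsub>E\<^esub>l\<in>{..m}. X (i, l) \<otimes>\<^bsub>E\<^esub> Y (l, j)),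
      one = (\<lambda>(i, j)\<in>I. if i = j then \<one>\<^bsub>E\<^esub> else \<zero>\<^bsub>E\<^esub>),
      zero = (\<lambda>p\<in>I. \<zero>\<^bsub>E\<^esub>),
      add = (\<lambda>X Y. \<lambda>p\<in>I. X p \<oplus>\<^bsub>E\<^esub> Y p),
      smult = (\<lambda>k X. \<lambda>p\<in>I. k \<odot>\<^bsub>E\<^esub> X p)\<rparr>)"


section \<open>Linear categories and Morita equivalence\<close>

text \<open>In \<open>Comp C X Y Z g f\<close> the morphisms are \<open>f : X \<rightarrow> Y\<close> and \<open>g : Y \<rightarrow> Z\<close>.\<close>

record ('k, 'o, 'h) linear_category =
  Obj :: "'o set"
  Hom :: "'o \<Rightarrow> 'o \<Rightarrow> ('k, 'h) module"
  Id :: "'o \<Rightarrow> 'h"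
  Comp :: "'o \<Rightarrow> 'o \<Rightarrow> 'o \<Rightarrow> 'h \<Rightarrow> 'h \<Rightarrow> 'h"

record ('o, 'h, 'p, 'i) linear_functor =
  obj_map :: "'o \<Rightarrow> 'p"
  hom_map :: "'o \<Rightarrow> 'o \<Rightarrow> 'h \<Rightarrow> 'i"

definition is_linear_functor ::
    "('k, 'z) ring_scheme \<Rightarrow> ('k, 'o, 'h) linear_category \<Rightarrow> ('k, 'p, 'i) linear_category
      \<Rightarrow> ('o, 'h, 'p, 'i) linear_functor \<Rightarrow> bool" where
  "is_linear_functor K C D F \<longleftrightarrow>
     (\<forall>X\<in>Obj C. obj_map F X \<in> Obj D) \<and>
     (\<forall>X\<in>Obj C. \<forall>Y\<in>Obj C.
        hom_map F X Y \<in> carrier (Hom C X Y) \<rightarrow> carrier (Hom D (obj_map F X) (obj_map F Y)) \<and>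
        (\<forall>f\<in>carrier (Hom C X Y). \<forall>g\<in>carrier (Hom C X Y).
           hom_map F X Y (f \<oplus>\<^bsub>Hom C X Y\<^esub> g) =
             hom_map F X Y f \<oplus>\<^bsub>Hom D (obj_map F X) (obj_map F Y)\<^esub> hom_map F X Y g) \<and>
        (\<forall>k\<in>carrier K. \<forall>f\<in>carrier (Hom C X Y).
           hom_map F X Y (k \<odot>\<^bsub>Hom C X Y\<^esub> f) =
             k \<odot>\<^bsub>Hom D (obj_map F X) (obj_map F Y)\<^esub> hom_map F X Y f)) \<and>
     (\<forall>X\<in>Obj C. hom_map F X X (Id C X) = Id D (obj_map F X)) \<and>
     (\<forall>X\<in>Obj C. \<forall>Y\<in>Obj C. \<forall>Z\<in>Obj C. \<forall>f\<in>carrier (Hom C X Y). \<forall>g\<in>carrier (Hom C Y Z).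
        hom_map F X Z (Comp C X Y Z g f) =
          Comp D (obj_map F X) (obj_map F Y) (obj_map F Z) (hom_map F Y Z g) (hom_map F X Y f))"

definition id_functor :: "('o, 'h, 'o, 'h) linear_functor" where
  "id_functor = \<lparr>obj_map = (\<lambda>X. X), hom_map = (\<lambda>X Y f. f)\<rparr>"

definition comp_functor ::
    "('p, 'i, 'q, 'j) linear_functor \<Rightarrow> ('o, 'h, 'p, 'i) linear_functor
      \<Rightarrow> ('o, 'h, 'q, 'j) linear_functor" where
  "comp_functor G F =
     \<lparr>obj_map = (\<lambda>X. obj_map G (obj_map F X)),
      hom_map = (\<lambda>X Y f. hom_map G (obj_map F X) (obj_map F Y) (hom_map F X Y f))\<rparr>"

definition is_iso_in :: "('k, 'o, 'h) linear_category \<Rightarrow> 'o \<Rightarrow> 'o \<Rightarrow> 'h \<Rightarrow> bool" where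
  "is_iso_in C X Y f \<longleftrightarrow> f \<in> carrier (Hom C X Y) \<and>
     (\<exists>g\<in>carrier (Hom C Y X). Comp C X Y X g f = Id C X \<and> Comp C Y X Y f g = Id C Y)"

definition naturally_isomorphic ::
    "('k, 'o, 'h) linear_category \<Rightarrow> ('k, 'p, 'i) linear_category
      \<Rightarrow> ('o, 'h, 'p, 'i) linear_functor \<Rightarrow> ('o, 'h, 'p, 'i) linear_functor \<Rightarrow> bool" where
  "naturally_isomorphic C D F G \<longleftrightarrow> (\<exists>\<eta>.
     (\<forall>X\<in>Obj C. is_iso_in D (obj_map F X) (obj_map G X) (\<eta> X)) \<and>
     (\<forall>X\<in>Obj C. \<forall>Y\<in>Obj C. \<forall>f\<in>carrier (Hom C X Y).
        Comp D (obj_map F X) (obj_map F Y) (obj_map G Y) (\<eta> Y) (hom_map F X Y f) =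
        Comp D (obj_map F X) (obj_map G X) (obj_map G Y) (hom_map G X Y f) (\<eta> X)))"

definition equivalent_categories ::
    "('k, 'z) ring_scheme \<Rightarrow> ('k, 'o, 'h) linear_category \<Rightarrow> ('k, 'p, 'i) linear_category
      \<Rightarrow> bool" where
  "equivalent_categories K C D \<longleftrightarrow> (\<exists>F G.
     is_linear_functor K C D F \<and> is_linear_functor K D C G \<and>
     naturally_isomorphic C C (comp_functor G F) id_functor \<and>
     naturally_isomorphic D D (comp_functor F G) id_functor)"

text \<open>
  The category of finite dimensional right \<open>A\<close>-modules. Elements of modules are taken from
  \<open>nat \<Rightarrow> 'k\<close>; carriers and operations are otherwise arbitrary. As this type contains a copy of
  \<open>K\<^sup>n\<close> for every \<open>n\<close>, every finite dimensional module is isomorphic to an object of \<open>mod_cat K A\<close>.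
\<close>

definition mod_cat ::
    "('k, 'z) ring_scheme \<Rightarrow> ('k, 'a, 'e) module_scheme
      \<Rightarrow> ('k, ('k, 'a, nat \<Rightarrow> 'k) right_module, (nat \<Rightarrow> 'k) \<Rightarrow> (nat \<Rightarrow> 'k)) linear_category" where
  "mod_cat K A =
     \<lparr>Obj = {M. fd_right_module K A M},
      Hom = module_hom K A,
      Id = (\<lambda>M. \<lambda>x\<in>carrier M. x),
      Comp = (\<lambda>L M N g f. compose (carrier L) g f)\<rparr>"

text \<open>Morita equivalence of \<open>K\<close>-algebras: the equivalence of the module categories is \<open>K\<close>-linear.\<close>

definition Morita_equivalent ::
    "('k, 'z) ring_scheme \<Rightarrow> ('k, 'a, 'e) module_scheme \<Rightarrow> ('k, 'b, 'f) module_scheme \<Rightarrow> bool" where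
  "Morita_equivalent K A B \<longleftrightarrow> equivalent_categories K (mod_cat K A) (mod_cat K B)"

end

theory Submission
  imports Defs
begin

text \<open>
  Allow every level \<open>0, \<dots>, m\<close> of the replicated algebra to be repeated: for \<open>l : {0, \<dots>, n - 1} \<rightarrow> {0, \<dots>, m}\<close>
  onto, consider the \<open>n \<times> n\<close> matrices whose \<open>(p, q)\<close> entry lies in \<open>A\<close> if \<open>l p = l q\<close>, in \<open>DA\<close> if
  \<open>l p = l q + 1\<close>, and is \<open>0\<close> otherwise. By induction on \<open>m\<close>, \<open>A\<^bsup>[m]\<^esup>\<close> is isomorphic to such an algebra \<open>B\<close>.
  In the induction step the rows of \<open>DB\<close> are, by the trace form of the symmetric algebra \<open>A \<oplus> DA\<close>, matrix rows
  with levels raised by one, so \<open>B \<oplus> DB\<close> consists of matrices with \<open>2n\<close> rows and \<open>n\<close> columns. Every right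
  \<open>B\<close>-linear endomorphism of this space is left multiplication by a unique \<open>2n \<times> 2n\<close> matrix of the
  same kind with levels up to \<open>m + 1\<close>; rows of the new level \<open>m + 1\<close> have their only nonzero entries, in
  \<open>DA\<close>, in columns of level \<open>m\<close>, and there \<open>Hom\<^sub>A(DA, A) = 0\<close> is needed. Finally \<open>A\<^bsup>(m)\<^esup>\<close> is the corner
  \<open>eBe\<close> of the full idempotent \<open>e\<close> that selects one index of each level, and \<open>M \<mapsto> Me\<close> is an equivalence.
\<close>

text \<open>Levels have to be allowed to repeat because passing from \<open>B\<close> to the
  endomorphisms of \<open>B \<oplus> DB\<close> doubles the index set: one index of level 0 for
  \<open>A\<close>, then levels 0, 1, then 0, 1, 1, 2. From the second extension on, the matrices
  are larger than those of the replicated algebra, and isomorphism has to give way to Morita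
  equivalence. An induction on Morita classes would have to move duals and endomorphism algebras
  through an equivalence in every step; explicit matrices leave a single Morita argument for the
  end. The obstacle in the induction step is the new top level. A row of level i \<le> m is
  generated by the entry 1 in a column of its own level, so a linear map on it is determined by one
  value. A row of level m + 1 has no such column. It is a copy of \<open>DA\<close> in each column
  of level m: its maps to rows of level m + 1 come from \<open>A\<close> by duality, while its maps
  to rows of level m are maps from \<open>DA\<close> to \<open>A\<close>, for which the larger
  matrices have no entries.\<close>

section \<open>Linear maps and finite dimensionality\<close>

text \<open>Negatives are supplied by the scalar \<open>-1\<close>.\<close>

lemma moduleI_smult:
  fixes K (structure) and V (structure)
  assumes K: "cring K"
    and add_closed: "\<And>x y. \<lbrakk>x \<in> carrier V; y \<in> carrier V\<rbrakk> \<Longrightarrow> x \<oplus>\<^bsub>V\<^esub> y \<in> carrier V"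
    and zero_closed: "\<zero>\<^bsub>V\<^esub> \<in> carrier V"
    and assoc: "\<And>x y z. \<lbrakk>x \<in> carrier V; y \<in> carrier V; z \<in> carrier V\<rbrakk> \<Longrightarrow>
      (x \<oplus>\<^bsub>V\<^esub> y) \<oplus>\<^bsub>V\<^esub> z = x \<oplus>\<^bsub>V\<^esub> (y \<oplus>\<^bsub>V\<^esub> z)"
    and comm: "\<And>x y. \<lbrakk>x \<in> carrier V; y \<in> carrier V\<rbrakk> \<Longrightarrow> x \<oplus>\<^bsub>V\<^esub> y = y \<oplus>\<^bsub>V\<^esub> x"
    and l_zero: "\<And>x. x \<in> carrier V \<Longrightarrow> \<zero>\<^bsub>V\<^esub> \<oplus>\<^bsub>V\<^esub> x = x"
    and smult_closed: "\<And>k x. \<lbrakk>k \<in> carrier K; x \<in> carrier V\<rbrakk> \<Longrightarrow> k \<odot>\<^bsub>V\<^esub> x \<in> carrier V"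
    and l_distr: "\<And>k l x. \<lbrakk>k \<in> carrier K; l \<in> carrier K; x \<in> carrier V\<rbrakk> \<Longrightarrow>
      (k \<oplus> l) \<odot>\<^bsub>V\<^esub> x = k \<odot>\<^bsub>V\<^esub> x \<oplus>\<^bsub>V\<^esub> l \<odot>\<^bsub>V\<^esub> x"
    and r_distr: "\<And>k x y. \<lbrakk>k \<in> carrier K; x \<in> carrier V; y \<in> carrier V\<rbrakk> \<Longrightarrow>
      k \<odot>\<^bsub>V\<^esub> (x \<oplus>\<^bsub>V\<^esub> y) = k \<odot>\<^bsub>V\<^esub> x \<oplus>\<^bsub>V\<^esub> k \<odot>\<^bsub>V\<^esub> y"
    and smult_assoc: "\<And>k l x. \<lbrakk>k \<in> carrier K; l \<in> carrier K; x \<in> carrier V\<rbrakk> \<Longrightarrow>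
      (k \<otimes> l) \<odot>\<^bsub>V\<^esub> x = k \<odot>\<^bsub>V\<^esub> (l \<odot>\<^bsub>V\<^esub> x)"
    and one: "\<And>x. x \<in> carrier V \<Longrightarrow> \<one> \<odot>\<^bsub>V\<^esub> x = x"
    and zero: "\<And>x. x \<in> carrier V \<Longrightarrow> \<zero> \<odot>\<^bsub>V\<^esub> x = \<zero>\<^bsub>V\<^esub>"
  shows "module K V"
proof -
  interpret K: cring K by fact
  have inv: "\<exists>y\<in>carrier V. y \<oplus>\<^bsub>V\<^esub> x = \<zero>\<^bsub>V\<^esub>" if "x \<in> carrier V" for x
  proof
    have "\<zero>\<^bsub>V\<^esub> = (\<ominus> \<one> \<oplus> \<one>) \<odot>\<^bsub>V\<^esub> x"
      using that zero by (simp add: K.l_neg)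
    also have "\<dots> = (\<ominus> \<one>) \<odot>\<^bsub>V\<^esub> x \<oplus>\<^bsub>V\<^esub> x"
      using that l_distr[of "\<ominus> \<one>" \<one> x] one by simp
    finally show "(\<ominus> \<one>) \<odot>\<^bsub>V\<^esub> x \<oplus>\<^bsub>V\<^esub> x = \<zero>\<^bsub>V\<^esub>" ..
  qed (simp add: smult_closed that)
  have "abelian_group V"
    by (rule abelian_groupI) (fact add_closed zero_closed assoc comm l_zero inv)+
  then show ?thesis
    by (rule moduleI[OF K]) (fact smult_closed l_distr r_distr smult_assoc one)+
qed

text \<open>Extensionality is left out, in contrast to the carrier of \<open>linear_hom\<close>, so
  that lambda terms and compositions qualify as they stand.\<close>

definition linear_map ::
    "('k, 'z) ring_scheme \<Rightarrow> ('k, 'v, 'e) module_scheme \<Rightarrow> ('k, 'w, 'f) module_scheme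
      \<Rightarrow> ('v \<Rightarrow> 'w) \<Rightarrow> bool" where
  "linear_map K V W f \<longleftrightarrow> f \<in> carrier V \<rightarrow> carrier W \<and>
     (\<forall>x\<in>carrier V. \<forall>y\<in>carrier V. f (x \<oplus>\<^bsub>V\<^esub> y) = f x \<oplus>\<^bsub>W\<^esub> f y) \<and>
     (\<forall>k\<in>carrier K. \<forall>x\<in>carrier V. f (k \<odot>\<^bsub>V\<^esub> x) = k \<odot>\<^bsub>W\<^esub> f x)"

lemma linear_mapI:
  assumes "\<And>x. x \<in> carrier V \<Longrightarrow> f x \<in> carrier W"
    and "\<And>x y. \<lbrakk>x \<in> carrier V; y \<in> carrier V\<rbrakk> \<Longrightarrow> f (x \<oplus>\<^bsub>V\<^esub> y) = f x \<oplus>\<^bsub>W\<^esub> f y"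
    and "\<And>k x. \<lbrakk>k \<in> carrier K; x \<in> carrier V\<rbrakk> \<Longrightarrow> f (k \<odot>\<^bsub>V\<^esub> x) = k \<odot>\<^bsub>W\<^esub> f x"
  shows "linear_map K V W f"
  using assms by (auto simp: linear_map_def)

lemma
  assumes "linear_map K V W f"
  shows linear_map_closed: "x \<in> carrier V \<Longrightarrow> f x \<in> carrier W"
    and linear_map_add: "\<lbrakk>x \<in> carrier V; y \<in> carrier V\<rbrakk> \<Longrightarrow> f (x \<oplus>\<^bsub>V\<^esub> y) = f x \<oplus>\<^bsub>W\<^esub> f y"
    and linear_map_smult: "\<lbrakk>k \<in> carrier K; x \<in> carrier V\<rbrakk> \<Longrightarrow> f (k \<odot>\<^bsub>V\<^esub> x) = k \<odot>\<^bsub>W\<^esub> f x"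
  using assms by (auto simp: linear_map_def)

lemma linear_map_zero:
  assumes "module K V" "module K W" "linear_map K V W f"
  shows "f \<zero>\<^bsub>V\<^esub> = \<zero>\<^bsub>W\<^esub>"
proof -
  interpret V: module K V by fact
  interpret W: module K W by fact
  have "f \<zero>\<^bsub>V\<^esub> = f (\<zero>\<^bsub>K\<^esub> \<odot>\<^bsub>V\<^esub> \<zero>\<^bsub>V\<^esub>)"
    by simp
  also have "\<dots> = \<zero>\<^bsub>W\<^esub>"
    using assms(3) by (simp add: linear_map_smult linear_map_closed del: V.smult_l_null V.smult_r_null)
  finally show ?thesis .
qed

lemma linear_map_compose:
  "\<lbrakk>linear_map K V W f; linear_map K U V g\<rbrakk> \<Longrightarrow> linear_map K U W (\<lambda>x. f (g x))"
  by (auto simp: linear_map_def Pi_iff)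

lemma ground_space_simps [simp]:
  "carrier (ground_space K) = carrier K" "\<zero>\<^bsub>ground_space K\<^esub> = \<zero>\<^bsub>K\<^esub>"
  "x \<oplus>\<^bsub>ground_space K\<^esub> y = x \<oplus>\<^bsub>K\<^esub> y" "k \<odot>\<^bsub>ground_space K\<^esub> x = k \<otimes>\<^bsub>K\<^esub> x"
  by (simp_all add: ground_space_def)

lemma module_ground_space:
  assumes "cring K"
  shows "module K (ground_space K)"
proof -
  interpret cring K by fact
  show ?thesis
    by (rule moduleI_smult[OF assms])
      (simp_all add: a_ac l_distr r_distr m_assoc)
qed

lemma lincomb_0 [simp]: "module K V \<Longrightarrow> lincomb V 0 b c = \<zero>\<^bsub>V\<^esub>"
proof -
  assume "module K V"
  then interpret module K V .
  show ?thesis by (simp add: lincomb_def M.finsum_empty)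
qed

lemma lincomb_Suc:
  assumes "module K V" "b \<in> {..<Suc n} \<rightarrow> carrier V" "c \<in> {..<Suc n} \<rightarrow> carrier K"
  shows "lincomb V (Suc n) b c = c n \<odot>\<^bsub>V\<^esub> b n \<oplus>\<^bsub>V\<^esub> lincomb V n b c"
proof -
  interpret module K V by fact
  have "(\<lambda>i. c i \<odot>\<^bsub>V\<^esub> b i) \<in> {..<n} \<rightarrow> carrier V" "c n \<odot>\<^bsub>V\<^esub> b n \<in> carrier V"
    using assms by (auto simp: Pi_iff)
  then show ?thesis
    unfolding lincomb_def lessThan_Suc by (intro M.finsum_insert) auto
qed

lemma lincomb_closed:
  assumes "module K V" "b \<in> {..<n} \<rightarrow> carrier V" "c \<in> {..<n} \<rightarrow> carrier K"
  shows "lincomb V n b c \<in> carrier V"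
proof -
  interpret module K V by fact
  show ?thesis
    unfolding lincomb_def using assms by (intro M.finsum_closed) (auto simp: Pi_iff)
qed

lemma lincomb_cong:
  assumes "module K V" "b \<in> {..<n} \<rightarrow> carrier V" "c \<in> {..<n} \<rightarrow> carrier K"
    and "\<And>i. i < n \<Longrightarrow> b i = b' i" "\<And>i. i < n \<Longrightarrow> c i = c' i"
  shows "lincomb V n b c = lincomb V n b' c'"
proof -
  interpret module K V by fact
  show ?thesis
    unfolding lincomb_def using assms by (intro M.finsum_cong') (auto simp: Pi_iff)
qed

lemma linear_map_lincomb:
  assumes "module K V" "module K W" "linear_map K V W f"
    and "b \<in> {..<n} \<rightarrow> carrier V" "c \<in> {..<n} \<rightarrow> carrier K"
  shows "f (lincomb V n b c) = lincomb W n (\<lambda>i. f (b i)) c"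
  using assms(4,5)
proof (induction n)
  case 0
  then show ?case
    using assms(1-3) by (simp add: linear_map_zero)
next
  case (Suc n)
  interpret V: module K V by fact
  interpret W: module K W by fact
  have b: "b \<in> {..<n} \<rightarrow> carrier V" "b n \<in> carrier V" and c: "c \<in> {..<n} \<rightarrow> carrier K" "c n \<in> carrier K"
    and fb: "(\<lambda>i. f (b i)) \<in> {..<Suc n} \<rightarrow> carrier W"
    using Suc.prems assms(3) by (auto simp: linear_map_closed Pi_iff)
  show ?case
    using Suc.IH[OF b(1) c(1)] b c lincomb_closed[OF assms(1) b(1) c(1)]
    by (simp add: lincomb_Suc[OF assms(1) Suc.prems] lincomb_Suc[OF assms(2) fb Suc.prems(2)]
        linear_map_add[OF assms(3)] linear_map_smult[OF assms(3)])
qed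

lemma lincomb_add:
  assumes "module K V" "b \<in> {..<n} \<rightarrow> carrier V" "c \<in> {..<n} \<rightarrow> carrier K" "d \<in> {..<n} \<rightarrow> carrier K"
  shows "lincomb V n b (\<lambda>i. c i \<oplus>\<^bsub>K\<^esub> d i) = lincomb V n b c \<oplus>\<^bsub>V\<^esub> lincomb V n b d"
proof -
  interpret module K V by fact
  have "lincomb V n b (\<lambda>i. c i \<oplus>\<^bsub>K\<^esub> d i) = (\<Oplus>\<^bsub>V\<^esub>i\<in>{..<n}. c i \<odot>\<^bsub>V\<^esub> b i \<oplus>\<^bsub>V\<^esub> d i \<odot>\<^bsub>V\<^esub> b i)"
    unfolding lincomb_def using assms by (intro M.finsum_cong') (auto simp: Pi_iff smult_l_distr)
  then show ?thesis
    unfolding lincomb_def using assms by (subst M.finsum_addf[symmetric]) (auto simp: Pi_iff)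
qed

lemma lincomb_smult:
  assumes "module K V" "b \<in> {..<n} \<rightarrow> carrier V" "c \<in> {..<n} \<rightarrow> carrier K" "k \<in> carrier K"
  shows "lincomb V n b (\<lambda>i. k \<otimes>\<^bsub>K\<^esub> c i) = k \<odot>\<^bsub>V\<^esub> lincomb V n b c"
proof -
  interpret module K V by fact
  have "lincomb V n b (\<lambda>i. k \<otimes>\<^bsub>K\<^esub> c i) = (\<Oplus>\<^bsub>V\<^esub>i\<in>{..<n}. k \<odot>\<^bsub>V\<^esub> (c i \<odot>\<^bsub>V\<^esub> b i))"
    unfolding lincomb_def using assms by (intro M.finsum_cong') (auto simp: Pi_iff smult_assoc1)
  then show ?thesis
    unfolding lincomb_def using assms by (subst finsum_smult_ldistr) (auto simp: Pi_iff)
qed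

text \<open>The functionals are the components of the inverse of the coordinate map; uniqueness of
  coefficients makes them linear.\<close>

lemma coordinate_functionals:
  assumes "module K V" "finite_dimensional K V"
  obtains n b c where "b \<in> {..<n} \<rightarrow> carrier V"
    and "\<And>i. i < n \<Longrightarrow> linear_map K V (ground_space K) (c i)"
    and "\<And>x. x \<in> carrier V \<Longrightarrow> x = lincomb V n b (\<lambda>i. c i x)"
proof -
  interpret module K V by fact
  obtain n b where "is_basis K V n b"
    using assms(2) by (auto simp: finite_dimensional_def)
  then have b: "b \<in> {..<n} \<rightarrow> carrier V"
    and bij: "bij_betw (lincomb V n b) ({..<n} \<rightarrow>\<^sub>E carrier K) (carrier V)"
    by (auto simp: is_basis_def)
  define c where "c = the_inv_into ({..<n} \<rightarrow>\<^sub>E carrier K) (lincomb V n b)"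
  have c: "c x \<in> {..<n} \<rightarrow>\<^sub>E carrier K" "lincomb V n b (c x) = x" if "x \<in> carrier V" for x
    using bij that unfolding c_def
    by (auto simp: bij_betw_def the_inv_into_into f_the_inv_into_f)
  have c': "c x \<in> {..<n} \<rightarrow> carrier K" if "x \<in> carrier V" for x
    using c(1)[OF that] by (auto simp: PiE_def)
  \<comment> \<open>The coordinate map is injective on extensional families only, hence the detour
    through \<open>restrict d {..<n}\<close>.\<close>
  have unique: "c (lincomb V n b d) i = d i" if "d \<in> {..<n} \<rightarrow> carrier K" "i < n" for d i
  proof -
    have "lincomb V n b (c (lincomb V n b d)) = lincomb V n b (restrict d {..<n})"
      using c(2)[OF lincomb_closed[OF assms(1) b that(1)]]
        lincomb_cong[OF assms(1) b that(1), of b "restrict d {..<n}"] by simp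
    moreover have "restrict d {..<n} \<in> {..<n} \<rightarrow>\<^sub>E carrier K"
      using that(1) by auto
    ultimately have "c (lincomb V n b d) = restrict d {..<n}"
      using bij c(1)[OF lincomb_closed[OF assms(1) b that(1)]]
      by (auto simp: bij_betw_def inj_on_def)
    then show ?thesis
      using that(2) by simp
  qed
  show ?thesis
  proof (rule that[OF b, of "\<lambda>i x. c x i"])
    fix i assume i: "i < n"
    show "linear_map K V (ground_space K) (\<lambda>x. c x i)"
    proof (rule linear_mapI)
      show "c x i \<in> carrier (ground_space K)" if "x \<in> carrier V" for x
        using c(1)[OF that] i by auto
      show "c (x \<oplus>\<^bsub>V\<^esub> y) i = c x i \<oplus>\<^bsub>ground_space K\<^esub> c y i" if "x \<in> carrier V" "y \<in> carrier V" for x y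
        using that i c' c(2) unique[of "\<lambda>j. c x j \<oplus>\<^bsub>K\<^esub> c y j" i]
        by (simp add: lincomb_add[OF assms(1) b] Pi_iff)
      show "c (k \<odot>\<^bsub>V\<^esub> x) i = k \<odot>\<^bsub>ground_space K\<^esub> c x i" if "k \<in> carrier K" "x \<in> carrier V" for k x
        using that i c' c(2) unique[of "\<lambda>j. k \<otimes>\<^bsub>K\<^esub> c x j" i]
        by (simp add: lincomb_smult[OF assms(1) b] Pi_iff)
    qed
  qed (simp add: c)
qed

text \<open>Induction on the number of functionals: the kernel of the last one has codimension at most one.\<close>

lemma finite_dimensional_if_separated:
  fixes V :: "('k, 'v, 'e) module_scheme" and \<phi> :: "nat \<Rightarrow> 'v \<Rightarrow> 'k"
  assumes "field K" "module K V"
    and "\<And>i. i < n \<Longrightarrow> linear_map K V (ground_space K) (\<phi> i)"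
    and "\<And>x. \<lbrakk>x \<in> carrier V; \<And>i. i < n \<Longrightarrow> \<phi> i x = \<zero>\<^bsub>K\<^esub>\<rbrakk> \<Longrightarrow> x = \<zero>\<^bsub>V\<^esub>"
  shows "finite_dimensional K V"
  using assms(2-4)
proof (induction n arbitrary: V)
  case 0
  interpret module K V by fact
  have "carrier V = {\<zero>\<^bsub>V\<^esub>}"
    using 0 by auto
  then have "is_basis K V 0 undefined"
    using 0(1) by (auto simp: is_basis_def bij_betw_def)
  then show ?case
    by (auto simp: finite_dimensional_def)
next
  case (Suc n)
  interpret field K by fact
  interpret V: module K V by fact
  have K: "cring K" ..
  note G = module_ground_space[OF K]
  have lin: "linear_map K V (ground_space K) (\<phi> n)"
    using Suc.prems by simp
  show ?case
  proof (cases "\<forall>x\<in>carrier V. \<phi> n x = \<zero>\<^bsub>K\<^esub>")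
    case True
    show ?thesis
    proof (rule Suc.IH[OF Suc.prems(1)])
      show "x = \<zero>\<^bsub>V\<^esub>" if "x \<in> carrier V" "\<And>i. i < n \<Longrightarrow> \<phi> i x = \<zero>\<^bsub>K\<^esub>" for x
        using Suc.prems(3)[OF that(1)] that True by (metis less_antisym)
    qed (simp add: Suc.prems(2))
  next
    case False
    then obtain w where w: "w \<in> carrier V" "\<phi> n w \<noteq> \<zero>\<^bsub>K\<^esub>"
      by auto
    \<comment> \<open>With the value scaled to 1, \<open>\<phi> n\<close> reads off the coefficient
      of \<open>v\<close> in the enlarged basis.\<close>
    define v where "v = inv\<^bsub>K\<^esub> (\<phi> n w) \<odot>\<^bsub>V\<^esub> w"
    have inv: "\<phi> n w \<in> Units K"
      using w linear_map_closed[OF lin] field_Units by auto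
    have v: "v \<in> carrier V" "\<phi> n v = \<one>\<^bsub>K\<^esub>"
      using inv w by (simp_all add: v_def linear_map_smult[OF lin] Units_l_inv)
    define U where "U = V\<lparr>carrier := {x \<in> carrier V. \<phi> n x = \<zero>\<^bsub>K\<^esub>}\<rparr>"
    have U: "carrier U = {x \<in> carrier V. \<phi> n x = \<zero>\<^bsub>K\<^esub>}" "\<zero>\<^bsub>U\<^esub> = \<zero>\<^bsub>V\<^esub>"
      "\<And>x y. x \<oplus>\<^bsub>U\<^esub> y = x \<oplus>\<^bsub>V\<^esub> y" "\<And>k x. k \<odot>\<^bsub>U\<^esub> x = k \<odot>\<^bsub>V\<^esub> x"
      by (simp_all add: U_def)
    have mod_U: "module K U"
      by (rule moduleI_smult[OF K])
        (auto simp: U V.a_ac V.smult_l_distr V.smult_r_distr V.smult_assoc1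
          linear_map_add[OF lin] linear_map_smult[OF lin] linear_map_zero[OF Suc.prems(1) G lin, simplified])
    have "finite_dimensional K U"
    proof (rule Suc.IH[OF mod_U])
      show "linear_map K U (ground_space K) (\<phi> i)" if "i < n" for i
        using Suc.prems(2)[of i] that by (auto simp: linear_map_def U)
      show "x = \<zero>\<^bsub>U\<^esub>" if "x \<in> carrier U" "\<And>i. i < n \<Longrightarrow> \<phi> i x = \<zero>\<^bsub>K\<^esub>" for x
        using Suc.prems(3)[of x] that by (auto simp: U less_Suc_eq)
    qed
    then obtain k b where b: "b \<in> {..<k} \<rightarrow> carrier U"
      and bij: "bij_betw (lincomb U k b) ({..<k} \<rightarrow>\<^sub>E carrier K) (carrier U)"
      by (auto simp: finite_dimensional_def is_basis_def)
    define b' where "b' = b(k := v)"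
    have b': "b' \<in> {..<Suc k} \<rightarrow> carrier V"
      using b v by (auto simp: b'_def U Pi_iff)
    have inc: "linear_map K U V (\<lambda>x. x)"
      by (auto simp: linear_map_def U)
    have comb: "lincomb V (Suc k) b' c = c k \<odot>\<^bsub>V\<^esub> v \<oplus>\<^bsub>V\<^esub> lincomb U k b c"
      and comb_U: "lincomb U k b c \<in> carrier U"
      if "c \<in> {..<Suc k} \<rightarrow> carrier K" for c
    proof -
      have c: "c \<in> {..<k} \<rightarrow> carrier K"
        using that by auto
      show "lincomb U k b c \<in> carrier U"
        by (rule lincomb_closed[OF mod_U b c])
      have "lincomb V k b' c = lincomb V k b c"
        using b by (intro lincomb_cong[OF Suc.prems(1) _ c]) (auto simp: b'_def U Pi_iff)
      then show "lincomb V (Suc k) b' c = c k \<odot>\<^bsub>V\<^esub> v \<oplus>\<^bsub>V\<^esub> lincomb U k b c"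
        using linear_map_lincomb[OF mod_U Suc.prems(1) inc b c]
        by (simp add: lincomb_Suc[OF Suc.prems(1) b' that]) (simp add: b'_def)
    qed
    have last: "\<phi> n (lincomb V (Suc k) b' c) = c k" if "c \<in> {..<Suc k} \<rightarrow> carrier K" for c
    proof -
      have "c k \<in> carrier K"
        using that by auto
      then show ?thesis
        using comb_U[OF that] v
        by (simp add: comb[OF that] U linear_map_add[OF lin] linear_map_smult[OF lin])
    qed
    have "inj_on (lincomb V (Suc k) b') ({..<Suc k} \<rightarrow>\<^sub>E carrier K)"
    proof (rule inj_onI)
      fix c d assume c: "c \<in> {..<Suc k} \<rightarrow>\<^sub>E carrier K" and d: "d \<in> {..<Suc k} \<rightarrow>\<^sub>E carrier K"
        and eq: "lincomb V (Suc k) b' c = lincomb V (Suc k) b' d"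
      have c': "c \<in> {..<Suc k} \<rightarrow> carrier K" "c \<in> {..<k} \<rightarrow> carrier K" "c k \<in> carrier K"
        and d': "d \<in> {..<Suc k} \<rightarrow> carrier K" "d \<in> {..<k} \<rightarrow> carrier K" "d k \<in> carrier K"
        using c d by (auto simp: PiE_def)
      have k: "c k = d k"
        using last[OF c'(1)] last[OF d'(1)] eq by simp
      then have "lincomb U k b c = lincomb U k b d"
        using eq comb[OF c'(1)] comb[OF d'(1)] comb_U[OF c'(1)] comb_U[OF d'(1)] v c'(3)
        by (auto simp: U)
      then have "lincomb U k b (restrict c {..<k}) = lincomb U k b (restrict d {..<k})"
        using lincomb_cong[OF mod_U b c'(2), of b "restrict c {..<k}"]
          lincomb_cong[OF mod_U b d'(2), of b "restrict d {..<k}"] by simp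
      moreover have "restrict c {..<k} \<in> {..<k} \<rightarrow>\<^sub>E carrier K" "restrict d {..<k} \<in> {..<k} \<rightarrow>\<^sub>E carrier K"
        using c' d' by auto
      ultimately have r: "restrict c {..<k} = restrict d {..<k}"
        using bij by (auto simp: bij_betw_def inj_on_def)
      show "c = d"
      proof (rule PiE_ext[OF c d])
        show "c i = d i" if "i \<in> {..<Suc k}" for i
          using k fun_cong[OF r, of i] that by (cases "i = k") auto
      qed
    qed
    moreover have "lincomb V (Suc k) b' ` ({..<Suc k} \<rightarrow>\<^sub>E carrier K) = carrier V"
    proof (intro equalityI subsetI)
      fix x assume "x \<in> lincomb V (Suc k) b' ` ({..<Suc k} \<rightarrow>\<^sub>E carrier K)"
      then show "x \<in> carrier V"
        using lincomb_closed[OF Suc.prems(1) b'] by (auto simp: PiE_def)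
    next
      fix x assume x: "x \<in> carrier V"
      \<comment> \<open>The projection of \<open>x\<close> to the kernel of \<open>\<phi> n\<close>
        along \<open>v\<close>.\<close>
      define y where "y = (\<ominus>\<^bsub>K\<^esub> \<phi> n x) \<odot>\<^bsub>V\<^esub> v \<oplus>\<^bsub>V\<^esub> x"
      have px: "\<phi> n x \<in> carrier K"
        using linear_map_closed[OF lin x] by simp
      have "y \<in> carrier U"
        using x v px by (simp add: y_def U linear_map_add[OF lin] linear_map_smult[OF lin] l_neg)
      then obtain d where d: "d \<in> {..<k} \<rightarrow>\<^sub>E carrier K" "lincomb U k b d = y"
        using bij_betw_imp_surj_on[OF bij] by (metis imageE)
      define c where "c = d(k := \<phi> n x)"
      have c: "c \<in> {..<Suc k} \<rightarrow>\<^sub>E carrier K" "c \<in> {..<Suc k} \<rightarrow> carrier K" "c \<in> {..<k} \<rightarrow> carrier K"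
        using d px by (auto simp: c_def PiE_def extensional_def Pi_iff less_Suc_eq)
      have "lincomb U k b c = y"
        unfolding d(2)[symmetric] using c(3) by (intro lincomb_cong[OF mod_U b]) (auto simp: c_def)
      then have "lincomb V (Suc k) b' c = \<phi> n x \<odot>\<^bsub>V\<^esub> v \<oplus>\<^bsub>V\<^esub> ((\<ominus>\<^bsub>K\<^esub> \<phi> n x) \<odot>\<^bsub>V\<^esub> v \<oplus>\<^bsub>V\<^esub> x)"
        using comb[OF c(2)] by (simp add: y_def c_def)
      also have "\<dots> = x"
        using x v px by (simp add: V.smult_l_minus V.r_neg1 V.r_neg2)
      finally show "x \<in> lincomb V (Suc k) b' ` ({..<Suc k} \<rightarrow>\<^sub>E carrier K)"
        using c(1) by (metis imageI)
    qed
    ultimately have "is_basis K V (Suc k) b'"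
      using b' by (auto simp: is_basis_def bij_betw_def)
    then show ?thesis
      by (auto simp: finite_dimensional_def)
  qed
qed

text \<open>Together with \<open>finite_dimensional_if_separated\<close> this turns finite
  dimensionality into a property of finitely many functionals, which can be checked for subspaces,
  products and Hom spaces without exhibiting a basis.\<close>

lemma separating_functionals:
  assumes "module K V" "finite_dimensional K V"
  obtains \<Phi> where "finite \<Phi>" "\<And>\<phi>. \<phi> \<in> \<Phi> \<Longrightarrow> linear_map K V (ground_space K) \<phi>"
    and "\<And>x. \<lbrakk>x \<in> carrier V; \<And>\<phi>. \<phi> \<in> \<Phi> \<Longrightarrow> \<phi> x = \<zero>\<^bsub>K\<^esub>\<rbrakk> \<Longrightarrow> x = \<zero>\<^bsub>V\<^esub>"
proof -
  interpret module K V by fact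
  obtain n b c where b: "b \<in> {..<n} \<rightarrow> carrier V"
    and c: "\<And>i. i < n \<Longrightarrow> linear_map K V (ground_space K) (c i)"
    and x: "\<And>x. x \<in> carrier V \<Longrightarrow> x = lincomb V n b (\<lambda>i. c i x)"
    using coordinate_functionals[OF assms] by metis
  show ?thesis
  proof (rule that[of "c ` {..<n}"])
    fix y assume y: "y \<in> carrier V" and 0: "\<And>\<phi>. \<phi> \<in> c ` {..<n} \<Longrightarrow> \<phi> y = \<zero>\<^bsub>K\<^esub>"
    have "y = lincomb V n b (\<lambda>i. c i y)"
      using x y .
    \<comment> \<open>Writing zero as a product of zeros gives the coefficients the shape of
      \<open>lincomb_smult\<close>, so that the scalar zero can be pulled out.\<close>
    also have "\<dots> = lincomb V n b (\<lambda>i. \<zero>\<^bsub>K\<^esub> \<otimes>\<^bsub>K\<^esub> \<zero>\<^bsub>K\<^esub>)"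
      using 0 c y by (intro lincomb_cong[OF assms(1) b]) (auto simp: linear_map_def Pi_iff)
    also have "\<dots> = \<zero>\<^bsub>V\<^esub>"
      by (subst lincomb_smult[OF assms(1) b]) (simp_all add: lincomb_closed[OF assms(1) b])
    finally show "y = \<zero>\<^bsub>V\<^esub>" .
  qed (use c in auto)
qed

text \<open>A finite, jointly injective family of maps pulls separating functionals of the target
  back to separating functionals of the source. With the inclusion as its only member the family
  yields the case of subspaces.\<close>

lemma finite_dimensional_if_separated_by_maps:
  assumes "field K" "module K U" "module K V" "finite_dimensional K V"
    and "finite F" "\<And>f. f \<in> F \<Longrightarrow> linear_map K U V f"
    and "\<And>x. \<lbrakk>x \<in> carrier U; \<And>f. f \<in> F \<Longrightarrow> f x = \<zero>\<^bsub>V\<^esub>\<rbrakk> \<Longrightarrow> x = \<zero>\<^bsub>U\<^esub>"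
  shows "finite_dimensional K U"
proof -
  obtain \<Phi> where \<Phi>: "finite \<Phi>" "\<And>\<phi>. \<phi> \<in> \<Phi> \<Longrightarrow> linear_map K V (ground_space K) \<phi>"
    "\<And>x. \<lbrakk>x \<in> carrier V; \<And>\<phi>. \<phi> \<in> \<Phi> \<Longrightarrow> \<phi> x = \<zero>\<^bsub>K\<^esub>\<rbrakk> \<Longrightarrow> x = \<zero>\<^bsub>V\<^esub>"
    using separating_functionals[OF assms(3,4)] by metis
  define \<Psi> where "\<Psi> = (\<lambda>(\<phi>, f) x. \<phi> (f x)) ` (\<Phi> \<times> F)"
  have "finite \<Psi>"
    using \<Phi>(1) assms(5) by (simp add: \<Psi>_def)
  then obtain \<psi> where \<psi>: "bij_betw \<psi> {0..<card \<Psi>} \<Psi>"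
    using ex_bij_betw_nat_finite by blast
  show ?thesis
  proof (rule finite_dimensional_if_separated[OF assms(1,2)])
    fix i assume "i < card \<Psi>"
    then have "\<psi> i \<in> \<Psi>"
      using \<psi> by (auto simp: bij_betw_def)
    then show "linear_map K U (ground_space K) (\<psi> i)"
      using linear_map_compose[OF \<Phi>(2) assms(6)] by (auto simp: \<Psi>_def)
  next
    fix x assume x: "x \<in> carrier U" and 0: "\<And>i. i < card \<Psi> \<Longrightarrow> \<psi> i x = \<zero>\<^bsub>K\<^esub>"
    have "p x = \<zero>\<^bsub>K\<^esub>" if "p \<in> \<Psi>" for p
      using 0 that bij_betw_imp_surj_on[OF \<psi>] by (metis atLeastLessThan_iff imageE)
    then have "\<phi> (f x) = \<zero>\<^bsub>K\<^esub>" if "\<phi> \<in> \<Phi>" "f \<in> F" for \<phi> f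
      using that by (force simp: \<Psi>_def)
    then show "x = \<zero>\<^bsub>U\<^esub>"
      using \<Phi>(3) assms(6,7) x by (meson linear_map_closed)
  qed
qed

section \<open>Hom spaces and the double dual\<close>

lemma linear_hom_simps:
  "f \<in> carrier (linear_hom K V W) \<longleftrightarrow> linear_map K V W f \<and> f \<in> extensional (carrier V)"
  "\<zero>\<^bsub>linear_hom K V W\<^esub> = (\<lambda>x\<in>carrier V. \<zero>\<^bsub>W\<^esub>)"
  "f \<oplus>\<^bsub>linear_hom K V W\<^esub> g = (\<lambda>x\<in>carrier V. f x \<oplus>\<^bsub>W\<^esub> g x)"
  "k \<odot>\<^bsub>linear_hom K V W\<^esub> f = (\<lambda>x\<in>carrier V. k \<odot>\<^bsub>W\<^esub> f x)"
  by (auto simp: linear_hom_def linear_map_def PiE_def)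

lemma linear_map_restrict:
  assumes "module K V"
  shows "linear_map K V W (restrict f (carrier V)) \<longleftrightarrow> linear_map K V W f"
proof -
  interpret module K V by fact
  show ?thesis by (auto simp: linear_map_def Pi_iff)
qed

lemma module_linear_hom:
  assumes "module K V" "module K W"
  shows "module K (linear_hom K V W)"
proof -
  interpret V: module K V by fact
  interpret W: module K W by fact
  have K: "cring K" ..
  have cl: "f x \<in> carrier W" if "linear_map K V W f" "x \<in> carrier V" for f x
    using that by (rule linear_map_closed)
  show ?thesis
  proof (rule moduleI_smult[OF K], unfold linear_hom_simps)
    fix f g assume fg: "linear_map K V W f \<and> f \<in> extensional (carrier V)"
      "linear_map K V W g \<and> g \<in> extensional (carrier V)"
    then show "linear_map K V W (\<lambda>x\<in>carrier V. f x \<oplus>\<^bsub>W\<^esub> g x) \<and> (\<lambda>x\<in>carrier V. f x \<oplus>\<^bsub>W\<^esub> g x) \<in> extensional (carrier V)"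
      by (auto simp: linear_map_restrict[OF assms(1)] cl linear_map_add linear_map_smult W.a_ac
          W.smult_r_distr intro!: linear_mapI)
    show "(\<lambda>x\<in>carrier V. f x \<oplus>\<^bsub>W\<^esub> g x) = (\<lambda>x\<in>carrier V. g x \<oplus>\<^bsub>W\<^esub> f x)"
      using fg by (auto simp: cl W.a_comm)
  next
    fix f g h assume fg: "linear_map K V W f \<and> f \<in> extensional (carrier V)"
      "linear_map K V W g \<and> g \<in> extensional (carrier V)" "linear_map K V W h \<and> h \<in> extensional (carrier V)"
    then show "(\<lambda>x\<in>carrier V. (\<lambda>x\<in>carrier V. f x \<oplus>\<^bsub>W\<^esub> g x) x \<oplus>\<^bsub>W\<^esub> h x) =
       (\<lambda>x\<in>carrier V. f x \<oplus>\<^bsub>W\<^esub> (\<lambda>x\<in>carrier V. g x \<oplus>\<^bsub>W\<^esub> h x) x)"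
      by (auto simp: cl W.a_assoc)
  next
    fix f assume f: "linear_map K V W f \<and> f \<in> extensional (carrier V)"
    then show "(\<lambda>x\<in>carrier V. (\<lambda>x\<in>carrier V. \<zero>\<^bsub>W\<^esub>) x \<oplus>\<^bsub>W\<^esub> f x) = f"
      "(\<lambda>x\<in>carrier V. \<one>\<^bsub>K\<^esub> \<odot>\<^bsub>W\<^esub> f x) = f"
      by (auto simp: cl fun_eq_iff extensional_def)
    show "(\<lambda>x\<in>carrier V. \<zero>\<^bsub>K\<^esub> \<odot>\<^bsub>W\<^esub> f x) = (\<lambda>x\<in>carrier V. \<zero>\<^bsub>W\<^esub>)"
      using f by (auto simp: cl)
    fix k assume k: "k \<in> carrier K"
    then show "linear_map K V W (\<lambda>x\<in>carrier V. k \<odot>\<^bsub>W\<^esub> f x) \<and> (\<lambda>x\<in>carrier V. k \<odot>\<^bsub>W\<^esub> f x) \<in> extensional (carrier V)"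
      using f by (auto simp: linear_map_restrict[OF assms(1)] cl linear_map_add linear_map_smult
          W.smult_r_distr W.smult_assoc1[symmetric] V.m_comm intro!: linear_mapI)
    fix l assume l: "l \<in> carrier K"
    show "(\<lambda>x\<in>carrier V. (k \<oplus>\<^bsub>K\<^esub> l) \<odot>\<^bsub>W\<^esub> f x) =
       (\<lambda>x\<in>carrier V. (\<lambda>x\<in>carrier V. k \<odot>\<^bsub>W\<^esub> f x) x \<oplus>\<^bsub>W\<^esub> (\<lambda>x\<in>carrier V. l \<odot>\<^bsub>W\<^esub> f x) x)"
      "(\<lambda>x\<in>carrier V. (k \<otimes>\<^bsub>K\<^esub> l) \<odot>\<^bsub>W\<^esub> f x) =
       (\<lambda>x\<in>carrier V. k \<odot>\<^bsub>W\<^esub> (\<lambda>x\<in>carrier V. l \<odot>\<^bsub>W\<^esub> f x) x)"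
      using f k l by (auto simp: cl W.smult_l_distr W.smult_assoc1)
  next
    fix k f g assume "linear_map K V W f \<and> f \<in> extensional (carrier V)" "k \<in> carrier K"
      "linear_map K V W g \<and> g \<in> extensional (carrier V)"
    then show "(\<lambda>x\<in>carrier V. k \<odot>\<^bsub>W\<^esub> (\<lambda>x\<in>carrier V. f x \<oplus>\<^bsub>W\<^esub> g x) x) =
       (\<lambda>x\<in>carrier V. (\<lambda>x\<in>carrier V. k \<odot>\<^bsub>W\<^esub> f x) x \<oplus>\<^bsub>W\<^esub> (\<lambda>x\<in>carrier V. k \<odot>\<^bsub>W\<^esub> g x) x)"
      by (auto simp: cl W.smult_r_distr)
  next
    show "linear_map K V W (\<lambda>x\<in>carrier V. \<zero>\<^bsub>W\<^esub>) \<and> (\<lambda>x\<in>carrier V. \<zero>\<^bsub>W\<^esub>) \<in> extensional (carrier V)"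
      by (auto simp: linear_map_def)
  qed
qed

text \<open>A linear map is determined by its values on the finitely many spanning vectors
  \<open>b i\<close>, so evaluation at these is a separating family of maps to
  \<open>W\<close>.\<close>

lemma finite_dimensional_linear_hom:
  fixes V :: "('k, 'v, 'e) module_scheme" and W :: "('k, 'w, 'f) module_scheme"
  assumes "field K" "module K V" "module K W" "finite_dimensional K V" "finite_dimensional K W"
  shows "finite_dimensional K (linear_hom K V W)"
proof -
  interpret V: module K V by fact
  interpret W: module K W by fact
  obtain n b c where b: "b \<in> {..<n} \<rightarrow> carrier V"
    and c: "\<And>i. i < n \<Longrightarrow> linear_map K V (ground_space K) (c i)"
    and x: "\<And>x. x \<in> carrier V \<Longrightarrow> x = lincomb V n b (\<lambda>i. c i x)"
    using coordinate_functionals[OF assms(2,4)] by metis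
  define F :: "(('v \<Rightarrow> 'w) \<Rightarrow> 'w) set" where "F = (\<lambda>i f. f (b i)) ` {..<n}"
  show ?thesis
  proof (rule finite_dimensional_if_separated_by_maps[OF assms(1) module_linear_hom[OF assms(2,3)] assms(3,5)])
    show "finite F"
      by (simp add: F_def)
  next
    fix e assume "e \<in> F"
    then show "linear_map K (linear_hom K V W) W e"
      using b by (auto simp: F_def linear_map_def linear_hom_simps Pi_iff)
  next
    fix f assume f: "f \<in> carrier (linear_hom K V W)"
      and 0: "\<And>e. e \<in> F \<Longrightarrow> e f = \<zero>\<^bsub>W\<^esub>"
    have "f y = \<zero>\<^bsub>W\<^esub>" if y: "y \<in> carrier V" for y
    proof -
      have cy: "(\<lambda>i. c i y) \<in> {..<n} \<rightarrow> carrier K"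
        using c y by (auto simp: linear_map_def Pi_iff)
      \<comment> \<open>The zero map is included because its value on a combination is the
        combination of zeros left over at the end.\<close>
      have lin: "linear_map K V W f" "linear_map K V W (\<lambda>x. \<zero>\<^bsub>W\<^esub>)"
        using f by (auto simp: linear_hom_simps linear_map_def)
      have "f y = lincomb W n (\<lambda>i. f (b i)) (\<lambda>i. c i y)"
        by (subst x[OF y]) (rule linear_map_lincomb[OF assms(2,3) lin(1) b cy])
      also have "\<dots> = lincomb W n (\<lambda>i. \<zero>\<^bsub>W\<^esub>) (\<lambda>i. c i y)"
        using 0 lin(1) b cy by (intro lincomb_cong[OF assms(3)]) (auto simp: F_def linear_map_def Pi_iff)
      also have "\<dots> = \<zero>\<^bsub>W\<^esub>"
        by (rule linear_map_lincomb[OF assms(2,3) lin(2) b cy, symmetric])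
      finally show ?thesis .
    qed
    then show "f = \<zero>\<^bsub>linear_hom K V W\<^esub>"
      using f by (auto simp: linear_hom_simps fun_eq_iff extensional_def)
  qed
qed

lemma finite_dimensional_ground_space:
  assumes "field K"
  shows "finite_dimensional K (ground_space K)"
proof -
  interpret field K by fact
  have "cring K" ..
  then show ?thesis
    by (intro finite_dimensional_if_separated[where n = 1 and \<phi> = "\<lambda>i x. x"] assms module_ground_space)
      (auto simp: linear_map_def)
qed

text \<open>Reflexivity: the values of \<open>\<Psi>\<close> on the coordinate functionals are the
  coefficients of the representing vector. It will supply the element of \<open>A\<close> that
  represents a functional on \<open>DA\<close>.\<close>

lemma double_dual:
  assumes "field K" "module K V" "finite_dimensional K V"
    and "linear_map K (linear_hom K V (ground_space K)) (ground_space K) \<Psi>"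
  obtains v where "v \<in> carrier V" "\<And>\<phi>. \<phi> \<in> carrier (linear_hom K V (ground_space K)) \<Longrightarrow> \<Psi> \<phi> = \<phi> v"
proof -
  interpret field K by fact
  interpret V: module K V by fact
  have G: "module K (ground_space K)"
    by (rule module_ground_space) unfold_locales
  have H: "module K (linear_hom K V (ground_space K))"
    by (rule module_linear_hom[OF assms(2) G])
  obtain n b c where b: "b \<in> {..<n} \<rightarrow> carrier V"
    and c: "\<And>i. i < n \<Longrightarrow> linear_map K V (ground_space K) (c i)"
    and x: "\<And>x. x \<in> carrier V \<Longrightarrow> x = lincomb V n b (\<lambda>i. c i x)"
    using coordinate_functionals[OF assms(2,3)] by metis
  \<comment> \<open>Members of the dual space are extensional, coordinate functionals need not
    be.\<close>
  define d where "d i = restrict (c i) (carrier V)" for i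
  have d: "d \<in> {..<n} \<rightarrow> carrier (linear_hom K V (ground_space K))"
    using c by (auto simp: d_def linear_hom_simps linear_map_restrict[OF assms(2)])
  have \<Psi>d: "(\<lambda>i. \<Psi> (d i)) \<in> {..<n} \<rightarrow> carrier K"
    using d linear_map_closed[OF assms(4)] by (auto simp: Pi_iff)
  define v where "v = lincomb V n b (\<lambda>i. \<Psi> (d i))"
  show ?thesis
  proof (rule that)
    show "v \<in> carrier V"
      unfolding v_def by (rule lincomb_closed[OF assms(2) b \<Psi>d])
    fix \<phi> assume \<phi>: "\<phi> \<in> carrier (linear_hom K V (ground_space K))"
    then have lin: "linear_map K V (ground_space K) \<phi>"
      by (simp add: linear_hom_simps)
    have \<phi>b: "(\<lambda>i. \<phi> (b i)) \<in> {..<n} \<rightarrow> carrier K"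
      using linear_map_closed[OF lin] b by (auto simp: Pi_iff)
    \<comment> \<open>In the ground space coefficients and vectors are both scalars and may trade
      places.\<close>
    have sw: "lincomb (ground_space K) n f g = lincomb (ground_space K) n g f"
      if "f \<in> {..<n} \<rightarrow> carrier K" "g \<in> {..<n} \<rightarrow> carrier K" for f g
    proof -
      interpret G: module K "ground_space K" by (rule G)
      show ?thesis
        unfolding lincomb_def using that by (intro G.M.finsum_cong') (auto simp: Pi_iff m_comm)
    qed
    \<comment> \<open>The expansion of \<open>\<phi>\<close> in the coordinate functionals. Off
      \<open>carrier V\<close> both sides are \<open>undefined\<close> by extensionality.\<close>
    have "\<phi> = lincomb (linear_hom K V (ground_space K)) n d (\<lambda>i. \<phi> (b i))" (is "_ = ?R")
    proof
      fix y
      show "\<phi> y = ?R y"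
      proof (cases "y \<in> carrier V")
        case True
        have cy: "(\<lambda>i. c i y) \<in> {..<n} \<rightarrow> carrier K"
          using c True by (auto simp: linear_map_def Pi_iff)
        have ev: "linear_map K (linear_hom K V (ground_space K)) (ground_space K) (\<lambda>f. f y)"
          using True by (auto simp: linear_map_def linear_hom_simps)
        have "\<phi> y = lincomb (ground_space K) n (\<lambda>i. \<phi> (b i)) (\<lambda>i. c i y)"
          by (subst x[OF True]) (rule linear_map_lincomb[OF assms(2) G lin b cy])
        also have "\<dots> = lincomb (ground_space K) n (\<lambda>i. c i y) (\<lambda>i. \<phi> (b i))"
          by (rule sw[OF \<phi>b cy])
        also have "\<dots> = lincomb (ground_space K) n (\<lambda>i. d i y) (\<lambda>i. \<phi> (b i))"
          using True by (simp add: d_def)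
        also have "\<dots> = ?R y"
          by (rule linear_map_lincomb[OF H G ev d \<phi>b, symmetric])
        finally show ?thesis .
      next
        case False
        then show ?thesis
          using \<phi> lincomb_closed[OF H d \<phi>b] by (auto simp: linear_hom_simps extensional_def)
      qed
    qed
    then have "\<Psi> \<phi> = lincomb (ground_space K) n (\<lambda>i. \<Psi> (d i)) (\<lambda>i. \<phi> (b i))"
      using linear_map_lincomb[OF H G assms(4) d \<phi>b] by simp
    also have "\<dots> = lincomb (ground_space K) n (\<lambda>i. \<phi> (b i)) (\<lambda>i. \<Psi> (d i))"
      by (rule sw[OF \<Psi>d \<phi>b])
    also have "\<dots> = \<phi> v"
      unfolding v_def by (rule linear_map_lincomb[OF assms(2) G lin b \<Psi>d, symmetric])
    finally show "\<Psi> \<phi> = \<phi> v" .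
  qed
qed


section \<open>Transport of structure\<close>

text \<open>The zeros are matched by a hypothesis of their own: as long as \<open>W\<close> is not
  known to be a group, linearity of \<open>h\<close> does not force it to preserve zero.\<close>

lemma module_transport:
  assumes "module K V" "bij_betw h (carrier V) (carrier W)" "linear_map K V W h" "h \<zero>\<^bsub>V\<^esub> = \<zero>\<^bsub>W\<^esub>"
  shows "module K W"
proof -
  interpret module K V by fact
  have K: "cring K" ..
  have im: "carrier W = h ` carrier V"
    using assms(2) by (auto simp: bij_betw_def)
  show ?thesis
    by (rule moduleI_smult[OF K])
      (auto simp: im linear_map_add[OF assms(3), symmetric] linear_map_smult[OF assms(3), symmetric]
        assms(4)[symmetric] M.a_ac smult_l_distr smult_r_distr smult_assoc1)
qed

lemma finite_dimensional_transport:
  assumes "module K V" "module K W" "bij_betw h (carrier V) (carrier W)" "linear_map K V W h"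
    and "finite_dimensional K V"
  shows "finite_dimensional K W"
proof -
  interpret V: module K V by fact
  obtain n b where b: "b \<in> {..<n} \<rightarrow> carrier V"
    and bij: "bij_betw (lincomb V n b) ({..<n} \<rightarrow>\<^sub>E carrier K) (carrier V)"
    using assms(5) by (auto simp: finite_dimensional_def is_basis_def)
  have "bij_betw (h \<circ> lincomb V n b) ({..<n} \<rightarrow>\<^sub>E carrier K) (carrier W)"
    by (rule bij_betw_trans[OF bij assms(3)])
  then have "bij_betw (lincomb W n (\<lambda>i. h (b i))) ({..<n} \<rightarrow>\<^sub>E carrier K) (carrier W)"
    by (rule bij_betw_cong[THEN iffD1, rotated])
      (auto simp: linear_map_lincomb[OF assms(1,2,4) b] PiE_def)
  then have "is_basis K W n (\<lambda>i. h (b i))"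
    using b linear_map_closed[OF assms(4)] by (auto simp: is_basis_def Pi_iff)
  then show ?thesis
    by (auto simp: finite_dimensional_def)
qed

text \<open>The zero is listed because the target may at first be a bare record, whose algebra laws
  are then derived from the isomorphism.\<close>

definition alg_iso ::
    "('k, 'z) ring_scheme \<Rightarrow> ('k, 'a, 'e) module_scheme \<Rightarrow> ('k, 'b, 'f) module_scheme
      \<Rightarrow> ('a \<Rightarrow> 'b) \<Rightarrow> bool" where
  "alg_iso K A B h \<longleftrightarrow> bij_betw h (carrier A) (carrier B) \<and> linear_map K A B h \<and>
     (\<forall>x\<in>carrier A. \<forall>y\<in>carrier A. h (x \<otimes>\<^bsub>A\<^esub> y) = h x \<otimes>\<^bsub>B\<^esub> h y) \<and>
     h \<one>\<^bsub>A\<^esub> = \<one>\<^bsub>B\<^esub> \<and> h \<zero>\<^bsub>A\<^esub> = \<zero>\<^bsub>B\<^esub>"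

lemma alg_isoD:
  assumes "alg_iso K A B h"
  shows "bij_betw h (carrier A) (carrier B)" "linear_map K A B h"
    and "x \<in> carrier A \<Longrightarrow> h x \<in> carrier B"
    and "\<lbrakk>x \<in> carrier A; y \<in> carrier A\<rbrakk> \<Longrightarrow> h (x \<oplus>\<^bsub>A\<^esub> y) = h x \<oplus>\<^bsub>B\<^esub> h y"
    and "\<lbrakk>k \<in> carrier K; x \<in> carrier A\<rbrakk> \<Longrightarrow> h (k \<odot>\<^bsub>A\<^esub> x) = k \<odot>\<^bsub>B\<^esub> h x"
    and "\<lbrakk>x \<in> carrier A; y \<in> carrier A\<rbrakk> \<Longrightarrow> h (x \<otimes>\<^bsub>A\<^esub> y) = h x \<otimes>\<^bsub>B\<^esub> h y"
    and "h \<one>\<^bsub>A\<^esub> = \<one>\<^bsub>B\<^esub>" "h \<zero>\<^bsub>A\<^esub> = \<zero>\<^bsub>B\<^esub>"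
  using assms by (auto simp: alg_iso_def linear_map_def)

lemma alg_iso_trans:
  assumes "alg_iso K A B h" "alg_iso K B C g"
  shows "alg_iso K A C (g \<circ> h)"
  using bij_betw_trans[OF alg_isoD(1)[OF assms(1)] alg_isoD(1)[OF assms(2)]]
    linear_map_compose[OF alg_isoD(2)[OF assms(2)] alg_isoD(2)[OF assms(1)]]
  by (simp add: alg_iso_def[of K A C] alg_isoD[OF assms(1)] alg_isoD[OF assms(2)] comp_def)

text \<open>This spares direct proofs that endomorphism algebras and coordinate copies are finite
  dimensional algebras.\<close>

lemma fd_algebra_transport:
  assumes "fd_algebra K A" "alg_iso K A B h"
  shows "fd_algebra K B"
proof -
  interpret A: fd_algebra K A by fact
  note h = alg_isoD[OF assms(2)]
  have A: "module K A" ..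
  have B: "module K B"
    by (rule module_transport[OF A h(1,2,8)])
  interpret B: module K B by (rule B)
  have im: "carrier B = h ` carrier A"
    using h(1) by (auto simp: bij_betw_def)
  have "monoid B"
    by (rule monoidI) (auto simp: im h(6,7)[symmetric] A.m_assoc)
  then have "ring B"
    by (intro ringI module.axioms(2)[OF B])
      (auto simp: im h(4,6)[symmetric] A.l_distr A.r_distr)
  moreover have "finite_dimensional K B"
    by (rule finite_dimensional_transport[OF A B h(1,2) A.finite_dim])
  moreover have "fd_algebra_axioms K B" if "finite_dimensional K B"
    by (rule fd_algebra_axioms.intro[OF _ _ that])
      (auto simp: im h(5,6)[symmetric] A.smult_mult_left A.smult_mult_right)
  ultimately show ?thesis
    using B by (intro fd_algebra.intro)
qed

lemma alg_iso_inverse: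
  assumes "fd_algebra K A" "alg_iso K A B h"
  shows "alg_iso K B A (the_inv_into (carrier A) h)"
proof -
  interpret A: fd_algebra K A by fact
  note h = alg_isoD[OF assms(2)]
  have im: "carrier B = h ` carrier A" and inj: "inj_on h (carrier A)"
    using h(1) by (auto simp: bij_betw_def)
  show ?thesis
    unfolding alg_iso_def linear_map_def
    using bij_betw_the_inv_into[OF h(1)]
    by (auto simp: im the_inv_into_f_f[OF inj] h(4-8)[symmetric])
qed

lemma from_to_coords:
  assumes "finite_dimensional K V"
  shows "bij_betw (from_coords K V) (coord_space K V) (carrier V)"
    and "bij_betw (to_coords K V) (carrier V) (coord_space K V)"
    and "x \<in> carrier V \<Longrightarrow> from_coords K V (to_coords K V x) = x"
    and "c \<in> coord_space K V \<Longrightarrow> to_coords K V (from_coords K V c) = c"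
proof -
  have "\<exists>p. (case p of (n, b) \<Rightarrow> is_basis K V n b)"
    using assms by (auto simp: finite_dimensional_def)
  then have "case chosen_basis K V of (n, b) \<Rightarrow> is_basis K V n b"
    unfolding chosen_basis_def by (rule someI_ex)
  then show bij: "bij_betw (from_coords K V) (coord_space K V) (carrier V)"
    by (auto simp: is_basis_def from_coords_def[abs_def] coord_space_def split: prod.splits)
  show "bij_betw (to_coords K V) (carrier V) (coord_space K V)"
    unfolding to_coords_def by (rule bij_betw_the_inv_into[OF bij])
  show "x \<in> carrier V \<Longrightarrow> from_coords K V (to_coords K V x) = x"
    unfolding to_coords_def by (rule f_the_inv_into_f_bij_betw[OF bij])
  show "c \<in> coord_space K V \<Longrightarrow> to_coords K V (from_coords K V c) = c"
    unfolding to_coords_def using bij by (simp add: the_inv_into_f_f bij_betw_def)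
qed

lemma alg_iso_coordinate_copy:
  assumes "fd_algebra K A"
  shows "alg_iso K A (coordinate_copy K A) (to_coords K A)"
proof -
  interpret fd_algebra K A by fact
  note ft = from_to_coords[OF finite_dim]
  show ?thesis
    unfolding alg_iso_def linear_map_def
    using ft(2) by (auto simp: coordinate_copy_def ft(3) bij_betw_def)
qed

section \<open>Equivalences of linear categories\<close>

locale linear_cat =
  fixes K :: "('k, 'z) ring_scheme" and C :: "('k, 'o, 'h) linear_category"
  assumes id_closed: "X \<in> Obj C \<Longrightarrow> Id C X \<in> carrier (Hom C X X)"
    and comp_closed: "\<lbrakk>X \<in> Obj C; Y \<in> Obj C; Z \<in> Obj C; f \<in> carrier (Hom C X Y); g \<in> carrier (Hom C Y Z)\<rbrakk>
      \<Longrightarrow> Comp C X Y Z g f \<in> carrier (Hom C X Z)"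
    and comp_assoc: "\<lbrakk>W \<in> Obj C; X \<in> Obj C; Y \<in> Obj C; Z \<in> Obj C; f \<in> carrier (Hom C W X);
        g \<in> carrier (Hom C X Y); h \<in> carrier (Hom C Y Z)\<rbrakk>
      \<Longrightarrow> Comp C W Y Z h (Comp C W X Y g f) = Comp C W X Z (Comp C X Y Z h g) f"
    and comp_id_left: "\<lbrakk>X \<in> Obj C; Y \<in> Obj C; f \<in> carrier (Hom C X Y)\<rbrakk> \<Longrightarrow> Comp C X Y Y (Id C Y) f = f"
    and comp_id_right: "\<lbrakk>X \<in> Obj C; Y \<in> Obj C; f \<in> carrier (Hom C X Y)\<rbrakk> \<Longrightarrow> Comp C X X Y f (Id C X) = f"
    and hom_add_closed: "\<lbrakk>X \<in> Obj C; Y \<in> Obj C; f \<in> carrier (Hom C X Y); g \<in> carrier (Hom C X Y)\<rbrakk>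
      \<Longrightarrow> f \<oplus>\<^bsub>Hom C X Y\<^esub> g \<in> carrier (Hom C X Y)"
    and hom_smult_closed: "\<lbrakk>X \<in> Obj C; Y \<in> Obj C; k \<in> carrier K; f \<in> carrier (Hom C X Y)\<rbrakk>
      \<Longrightarrow> k \<odot>\<^bsub>Hom C X Y\<^esub> f \<in> carrier (Hom C X Y)"
    and comp_add_left: "\<lbrakk>X \<in> Obj C; Y \<in> Obj C; Z \<in> Obj C; f \<in> carrier (Hom C X Y);
        g \<in> carrier (Hom C Y Z); h \<in> carrier (Hom C Y Z)\<rbrakk>
      \<Longrightarrow> Comp C X Y Z (g \<oplus>\<^bsub>Hom C Y Z\<^esub> h) f = Comp C X Y Z g f \<oplus>\<^bsub>Hom C X Z\<^esub> Comp C X Y Z h f"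
    and comp_add_right: "\<lbrakk>X \<in> Obj C; Y \<in> Obj C; Z \<in> Obj C; f \<in> carrier (Hom C X Y);
        g \<in> carrier (Hom C X Y); h \<in> carrier (Hom C Y Z)\<rbrakk>
      \<Longrightarrow> Comp C X Y Z h (f \<oplus>\<^bsub>Hom C X Y\<^esub> g) = Comp C X Y Z h f \<oplus>\<^bsub>Hom C X Z\<^esub> Comp C X Y Z h g"
    and comp_smult_left: "\<lbrakk>X \<in> Obj C; Y \<in> Obj C; Z \<in> Obj C; k \<in> carrier K; f \<in> carrier (Hom C X Y);
        g \<in> carrier (Hom C Y Z)\<rbrakk>
      \<Longrightarrow> Comp C X Y Z (k \<odot>\<^bsub>Hom C Y Z\<^esub> g) f = k \<odot>\<^bsub>Hom C X Z\<^esub> Comp C X Y Z g f"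
    and comp_smult_right: "\<lbrakk>X \<in> Obj C; Y \<in> Obj C; Z \<in> Obj C; k \<in> carrier K; f \<in> carrier (Hom C X Y);
        g \<in> carrier (Hom C Y Z)\<rbrakk>
      \<Longrightarrow> Comp C X Y Z g (k \<odot>\<^bsub>Hom C X Y\<^esub> f) = k \<odot>\<^bsub>Hom C X Z\<^esub> Comp C X Y Z g f"

text \<open>Every object \<open>Y\<close> of \<open>D\<close> gets a chosen object
  \<open>G0 Y\<close> and mutually inverse morphisms \<open>\<epsilon> Y\<close> from
  \<open>F (G0 Y)\<close> to \<open>Y\<close> and \<open>\<epsilon>' Y\<close> back. Conjugation by
  these turns a morphism \<open>f\<close> of \<open>D\<close> into one between objects in the image
  of \<open>F\<close>, and its unique lift is the value of the inverse functor at
  \<open>f\<close>.\<close>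

lemma equivalent_categories_if_fully_faithful:
  assumes "linear_cat K C" "linear_cat K D" and F: "is_linear_functor K C D F"
    and ff: "\<And>X Y. \<lbrakk>X \<in> Obj C; Y \<in> Obj C\<rbrakk> \<Longrightarrow>
      bij_betw (hom_map F X Y) (carrier (Hom C X Y)) (carrier (Hom D (obj_map F X) (obj_map F Y)))"
    and es: "\<And>Y. Y \<in> Obj D \<Longrightarrow> \<exists>X\<in>Obj C. \<exists>\<epsilon>. is_iso_in D (obj_map F X) Y \<epsilon>"
  shows "equivalent_categories K C D"
proof -
  interpret C: linear_cat K C by fact
  interpret D: linear_cat K D by fact
  have FO: "obj_map F X \<in> Obj D" if "X \<in> Obj C" for X
    using F that by (simp add: is_linear_functor_def)
  have F_id: "hom_map F X X (Id C X) = Id D (obj_map F X)" if "X \<in> Obj C" for X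
    using F that by (simp add: is_linear_functor_def)
  have F_cl: "hom_map F X Y f \<in> carrier (Hom D (obj_map F X) (obj_map F Y))"
    and F_smult: "k \<in> carrier K \<Longrightarrow> hom_map F X Y (k \<odot>\<^bsub>Hom C X Y\<^esub> f) =
             k \<odot>\<^bsub>Hom D (obj_map F X) (obj_map F Y)\<^esub> hom_map F X Y f"
    and F_add: "g \<in> carrier (Hom C X Y) \<Longrightarrow> hom_map F X Y (f \<oplus>\<^bsub>Hom C X Y\<^esub> g) =
             hom_map F X Y f \<oplus>\<^bsub>Hom D (obj_map F X) (obj_map F Y)\<^esub> hom_map F X Y g"
    if "X \<in> Obj C" "Y \<in> Obj C" "f \<in> carrier (Hom C X Y)" for X Y f g k
    using F that by (simp_all add: is_linear_functor_def Pi_iff)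
  have F_comp: "hom_map F X Z (Comp C X Y Z g f) =
          Comp D (obj_map F X) (obj_map F Y) (obj_map F Z) (hom_map F Y Z g) (hom_map F X Y f)"
    if "X \<in> Obj C" "Y \<in> Obj C" "Z \<in> Obj C" "f \<in> carrier (Hom C X Y)" "g \<in> carrier (Hom C Y Z)"
    for X Y Z f g
    using F that by (simp add: is_linear_functor_def)
  have F_inj: "f = g" if "X \<in> Obj C" "Y \<in> Obj C" "f \<in> carrier (Hom C X Y)" "g \<in> carrier (Hom C X Y)"
      "hom_map F X Y f = hom_map F X Y g" for X Y f g
    using ff[OF that(1,2)] that(3-5) by (auto simp: bij_betw_def inj_on_def)
  define P where "P X Y \<epsilon> \<epsilon>' \<longleftrightarrow> X \<in> Obj C \<and> \<epsilon> \<in> carrier (Hom D (obj_map F X) Y) \<and>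
      \<epsilon>' \<in> carrier (Hom D Y (obj_map F X)) \<and>
      Comp D (obj_map F X) Y (obj_map F X) \<epsilon>' \<epsilon> = Id D (obj_map F X) \<and>
      Comp D Y (obj_map F X) Y \<epsilon> \<epsilon>' = Id D Y" for X Y \<epsilon> \<epsilon>'
  have "\<forall>Y\<in>Obj D. \<exists>X \<epsilon> \<epsilon>'. P X Y \<epsilon> \<epsilon>'"
    unfolding P_def using es unfolding is_iso_in_def by blast
  then obtain G0 \<epsilon> \<epsilon>' where P: "\<And>Y. Y \<in> Obj D \<Longrightarrow> P (G0 Y) Y (\<epsilon> Y) (\<epsilon>' Y)"
    by metis
  define FG where "FG Y = obj_map F (G0 Y)" for Y
  have GO: "G0 Y \<in> Obj C" and FGO: "FG Y \<in> Obj D" and e: "\<epsilon> Y \<in> carrier (Hom D (FG Y) Y)"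
    and e': "\<epsilon>' Y \<in> carrier (Hom D Y (FG Y))"
    and e'e: "Comp D (FG Y) Y (FG Y) (\<epsilon>' Y) (\<epsilon> Y) = Id D (FG Y)"
    and ee': "Comp D Y (FG Y) Y (\<epsilon> Y) (\<epsilon>' Y) = Id D Y" if "Y \<in> Obj D" for Y
    using P[OF that] FO by (auto simp: P_def FG_def)
  \<comment> \<open>What \<open>F (G f)\<close> has to be if \<open>\<epsilon>\<close> is to be
    natural.\<close>
  define H where "H Y Z f = Comp D (FG Y) Z (FG Z) (\<epsilon>' Z) (Comp D (FG Y) Y Z f (\<epsilon> Y))" for Y Z f
  have H_cl: "H Y Z f \<in> carrier (Hom D (FG Y) (FG Z))"
    if "Y \<in> Obj D" "Z \<in> Obj D" "f \<in> carrier (Hom D Y Z)" for Y Z f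
    using that e e' FGO by (auto simp: H_def intro!: D.comp_closed[of _ Z] D.comp_closed[of _ Y])
  have H_nat: "Comp D (FG Y) (FG Z) Z (\<epsilon> Z) (H Y Z f) = Comp D (FG Y) Y Z f (\<epsilon> Y)"
    if "Y \<in> Obj D" "Z \<in> Obj D" "f \<in> carrier (Hom D Y Z)" for Y Z f
  proof -
    have c: "Comp D (FG Y) Y Z f (\<epsilon> Y) \<in> carrier (Hom D (FG Y) Z)"
      using that e FGO by (intro D.comp_closed)
    have "Comp D (FG Y) (FG Z) Z (\<epsilon> Z) (H Y Z f) =
        Comp D (FG Y) Z Z (Comp D Z (FG Z) Z (\<epsilon> Z) (\<epsilon>' Z)) (Comp D (FG Y) Y Z f (\<epsilon> Y))"
      unfolding H_def using that e e' FGO c by (intro D.comp_assoc)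
    then show ?thesis
      using that c FGO by (simp add: ee' D.comp_id_left)
  qed
  define G where "G = \<lparr>obj_map = G0, hom_map = (\<lambda>Y Z f.
      inv_into (carrier (Hom C (G0 Y) (G0 Z))) (hom_map F (G0 Y) (G0 Z)) (H Y Z f))\<rparr>"
  have G_obj: "obj_map G = G0"
    by (simp add: G_def)
  have G_cl: "hom_map G Y Z f \<in> carrier (Hom C (G0 Y) (G0 Z))"
    and FG_hom: "hom_map F (G0 Y) (G0 Z) (hom_map G Y Z f) = H Y Z f"
    if "Y \<in> Obj D" "Z \<in> Obj D" "f \<in> carrier (Hom D Y Z)" for Y Z f
  proof -
    have "H Y Z f \<in> hom_map F (G0 Y) (G0 Z) ` carrier (Hom C (G0 Y) (G0 Z))"
      using bij_betw_imp_surj_on[OF ff[OF GO[OF that(1)] GO[OF that(2)]]] H_cl[OF that]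
      by (simp add: FG_def)
    then show "hom_map G Y Z f \<in> carrier (Hom C (G0 Y) (G0 Z))"
      "hom_map F (G0 Y) (G0 Z) (hom_map G Y Z f) = H Y Z f"
      unfolding G_def by (simp_all add: inv_into_into f_inv_into_f)
  qed
  \<comment> \<open>By faithfulness every functor law for \<open>G\<close> can be checked after
    applying \<open>F\<close>, where it becomes a law for \<open>H\<close>.\<close>
  have G_eqI: "hom_map G Y Z f = g" if "Y \<in> Obj D" "Z \<in> Obj D" "f \<in> carrier (Hom D Y Z)"
      "g \<in> carrier (Hom C (G0 Y) (G0 Z))" "H Y Z f = hom_map F (G0 Y) (G0 Z) g" for Y Z f g
    by (rule F_inj[OF GO[OF that(1)] GO[OF that(2)] G_cl[OF that(1-3)] that(4)])
      (simp add: FG_hom[OF that(1-3)] that(5))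
  have G: "is_linear_functor K D C G"
    unfolding is_linear_functor_def G_obj
  proof (intro conjI ballI)
    show "G0 Y \<in> Obj C" if "Y \<in> Obj D" for Y
      using GO that .
  next
    fix Y assume Y: "Y \<in> Obj D"
    show "hom_map G Y Y (Id D Y) = Id C (G0 Y)"
      using Y by (intro G_eqI) (simp_all add: D.id_closed C.id_closed GO F_id H_def D.comp_id_right
          D.comp_id_left FGO e e'e flip: FG_def)
    fix Z assume Z: "Z \<in> Obj D"
    show "hom_map G Y Z \<in> carrier (Hom D Y Z) \<rightarrow> carrier (Hom C (G0 Y) (G0 Z))"
      using G_cl[OF Y Z] by auto
    fix f assume f: "f \<in> carrier (Hom D Y Z)"
    have c: "Comp D (FG Y) Y Z f (\<epsilon> Y) \<in> carrier (Hom D (FG Y) Z)" if "f \<in> carrier (Hom D Y Z)" for f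
      using Y Z that e FGO by (intro D.comp_closed)
    show "hom_map G Y Z (k \<odot>\<^bsub>Hom D Y Z\<^esub> f) = k \<odot>\<^bsub>Hom C (G0 Y) (G0 Z)\<^esub> hom_map G Y Z f"
      if k: "k \<in> carrier K" for k
    proof (rule G_eqI[OF Y Z])
      have "H Y Z (k \<odot>\<^bsub>Hom D Y Z\<^esub> f) = k \<odot>\<^bsub>Hom D (FG Y) (FG Z)\<^esub> H Y Z f"
        using Y Z f k c by (simp add: H_def D.comp_smult_left D.comp_smult_right FGO e e')
      then show "H Y Z (k \<odot>\<^bsub>Hom D Y Z\<^esub> f) =
          hom_map F (G0 Y) (G0 Z) (k \<odot>\<^bsub>Hom C (G0 Y) (G0 Z)\<^esub> hom_map G Y Z f)"
        using Y Z f k by (simp add: F_smult GO G_cl FG_hom flip: FG_def)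
    qed (use Y Z f k in \<open>simp_all add: D.hom_smult_closed C.hom_smult_closed GO G_cl\<close>)
    show "hom_map G Y Z (f \<oplus>\<^bsub>Hom D Y Z\<^esub> g) = hom_map G Y Z f \<oplus>\<^bsub>Hom C (G0 Y) (G0 Z)\<^esub> hom_map G Y Z g"
      if g: "g \<in> carrier (Hom D Y Z)" for g
    proof (rule G_eqI[OF Y Z])
      have "H Y Z (f \<oplus>\<^bsub>Hom D Y Z\<^esub> g) = H Y Z f \<oplus>\<^bsub>Hom D (FG Y) (FG Z)\<^esub> H Y Z g"
        using Y Z f g c by (simp add: H_def D.comp_add_left D.comp_add_right FGO e e')
      then show "H Y Z (f \<oplus>\<^bsub>Hom D Y Z\<^esub> g) =
          hom_map F (G0 Y) (G0 Z) (hom_map G Y Z f \<oplus>\<^bsub>Hom C (G0 Y) (G0 Z)\<^esub> hom_map G Y Z g)"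
        using Y Z f g by (simp add: F_add GO G_cl FG_hom flip: FG_def)
    qed (use Y Z f g in \<open>simp_all add: D.hom_add_closed C.hom_add_closed GO G_cl\<close>)
  next
    fix X Y Z f g assume X: "X \<in> Obj D" and Y: "Y \<in> Obj D" and Z: "Z \<in> Obj D"
      and f: "f \<in> carrier (Hom D X Y)" and g: "g \<in> carrier (Hom D Y Z)"
    have fe: "Comp D (FG X) X Y f (\<epsilon> X) \<in> carrier (Hom D (FG X) Y)"
      using X Y f e FGO by (intro D.comp_closed)
    have ge: "Comp D (FG Y) Y Z g (\<epsilon> Y) \<in> carrier (Hom D (FG Y) Z)"
      using Y Z g e FGO by (intro D.comp_closed)
    have gf: "Comp D X Y Z g f \<in> carrier (Hom D X Z)"
      using X Y Z f g by (intro D.comp_closed)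
    show "hom_map G X Z (Comp D X Y Z g f) =
        Comp C (G0 X) (G0 Y) (G0 Z) (hom_map G Y Z g) (hom_map G X Y f)"
    proof (rule G_eqI[OF X Z])
      \<comment> \<open>In the composite of \<open>H Y Z g\<close> and \<open>H X Y f\<close> the
        middle factors \<open>\<epsilon> Y\<close> and \<open>\<epsilon>' Y\<close> cancel;
        \<open>H_nat\<close> does this in one step.\<close>
      have "Comp D (FG X) (FG Y) Z (Comp D (FG Y) Y Z g (\<epsilon> Y)) (H X Y f) =
          Comp D (FG X) Y Z g (Comp D (FG X) (FG Y) Y (\<epsilon> Y) (H X Y f))"
        using X Y Z g e FGO H_cl[OF X Y f] by (intro D.comp_assoc[symmetric])
      also have "\<dots> = Comp D (FG X) Y Z g (Comp D (FG X) X Y f (\<epsilon> X))"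
        by (simp add: H_nat[OF X Y f])
      also have "\<dots> = Comp D (FG X) X Z (Comp D X Y Z g f) (\<epsilon> X)"
        using X Y Z f g e FGO by (intro D.comp_assoc)
      finally have 1: "Comp D (FG X) (FG Y) Z (Comp D (FG Y) Y Z g (\<epsilon> Y)) (H X Y f) =
          Comp D (FG X) X Z (Comp D X Y Z g f) (\<epsilon> X)" .
      have "Comp D (FG X) (FG Y) (FG Z) (H Y Z g) (H X Y f) =
          Comp D (FG X) Z (FG Z) (\<epsilon>' Z) (Comp D (FG X) (FG Y) Z (Comp D (FG Y) Y Z g (\<epsilon> Y)) (H X Y f))"
        unfolding H_def[of Y Z g] using X Y Z ge e' FGO H_cl[OF X Y f] by (intro D.comp_assoc[symmetric])
      also have "\<dots> = H X Z (Comp D X Y Z g f)"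
        unfolding 1 by (simp add: H_def)
      finally have "H X Z (Comp D X Y Z g f) = Comp D (FG X) (FG Y) (FG Z) (H Y Z g) (H X Y f)" ..
      then show "H X Z (Comp D X Y Z g f) =
          hom_map F (G0 X) (G0 Z) (Comp C (G0 X) (G0 Y) (G0 Z) (hom_map G Y Z g) (hom_map G X Y f))"
        using X Y Z f g by (simp add: F_comp GO G_cl FG_hom flip: FG_def)
    qed (use X Y Z f g in \<open>simp_all add: gf C.comp_closed[of _ "G0 Y"] GO G_cl\<close>)
  qed
  have "naturally_isomorphic D D (comp_functor F G) id_functor"
    unfolding naturally_isomorphic_def
  proof (intro exI[of _ \<epsilon>] conjI ballI)
    fix Y assume Y: "Y \<in> Obj D"
    show "is_iso_in D (obj_map (comp_functor F G) Y) (obj_map id_functor Y) (\<epsilon> Y)"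
      using e[OF Y] e'[OF Y] e'e[OF Y] ee'[OF Y]
      by (auto simp: is_iso_in_def comp_functor_def id_functor_def G_obj simp flip: FG_def)
    fix Z f assume "Z \<in> Obj D" "f \<in> carrier (Hom D Y Z)"
    then show "Comp D (obj_map (comp_functor F G) Y) (obj_map (comp_functor F G) Z) (obj_map id_functor Z)
         (\<epsilon> Z) (hom_map (comp_functor F G) Y Z f) =
        Comp D (obj_map (comp_functor F G) Y) (obj_map id_functor Y) (obj_map id_functor Z)
         (hom_map id_functor Y Z f) (\<epsilon> Y)"
      using Y by (simp add: comp_functor_def id_functor_def G_obj FG_hom H_nat flip: FG_def)
  qed
  moreover have "naturally_isomorphic C C (comp_functor G F) id_functor"
  proof -
    \<comment> \<open>The isomorphism from \<open>G (F X)\<close> to \<open>X\<close> is the lift of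
      \<open>\<epsilon>\<close> at \<open>F X\<close>, and its inverse is the lift of
      \<open>\<epsilon>'\<close>.\<close>
    define \<eta> where "\<eta> X = inv_into (carrier (Hom C (G0 (obj_map F X)) X))
        (hom_map F (G0 (obj_map F X)) X) (\<epsilon> (obj_map F X))" for X
    define \<eta>' where "\<eta>' X = inv_into (carrier (Hom C X (G0 (obj_map F X))))
        (hom_map F X (G0 (obj_map F X))) (\<epsilon>' (obj_map F X))" for X
    have \<eta>: "\<eta> X \<in> carrier (Hom C (G0 (obj_map F X)) X)"
        "hom_map F (G0 (obj_map F X)) X (\<eta> X) = \<epsilon> (obj_map F X)"
      and \<eta>': "\<eta>' X \<in> carrier (Hom C X (G0 (obj_map F X)))"
        "hom_map F X (G0 (obj_map F X)) (\<eta>' X) = \<epsilon>' (obj_map F X)"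
      if "X \<in> Obj C" for X
    proof -
      note O = FO[OF that] and GO' = GO[OF FO[OF that]]
      have "\<epsilon> (obj_map F X) \<in> hom_map F (G0 (obj_map F X)) X ` carrier (Hom C (G0 (obj_map F X)) X)"
        using bij_betw_imp_surj_on[OF ff[OF GO' that]] e[OF O] by (simp add: FG_def)
      then show "\<eta> X \<in> carrier (Hom C (G0 (obj_map F X)) X)"
        "hom_map F (G0 (obj_map F X)) X (\<eta> X) = \<epsilon> (obj_map F X)"
        unfolding \<eta>_def by (simp_all add: inv_into_into f_inv_into_f)
      have "\<epsilon>' (obj_map F X) \<in> hom_map F X (G0 (obj_map F X)) ` carrier (Hom C X (G0 (obj_map F X)))"
        using bij_betw_imp_surj_on[OF ff[OF that GO']] e'[OF O] by (simp add: FG_def)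
      then show "\<eta>' X \<in> carrier (Hom C X (G0 (obj_map F X)))"
        "hom_map F X (G0 (obj_map F X)) (\<eta>' X) = \<epsilon>' (obj_map F X)"
        unfolding \<eta>'_def by (simp_all add: inv_into_into f_inv_into_f)
    qed
    show ?thesis
      unfolding naturally_isomorphic_def
    proof (intro exI[of _ \<eta>] conjI ballI)
      fix X assume X: "X \<in> Obj C"
      note O = FO[OF X] and GO' = GO[OF FO[OF X]]
      have "Comp C (G0 (obj_map F X)) X (G0 (obj_map F X)) (\<eta>' X) (\<eta> X) = Id C (G0 (obj_map F X))"
        by (rule F_inj[OF GO' GO'])
          (use X GO' O in \<open>simp_all add: C.comp_closed[of _ X] C.id_closed \<eta> \<eta>' F_comp F_id e'e flip: FG_def\<close>)
      moreover have "Comp C X (G0 (obj_map F X)) X (\<eta> X) (\<eta>' X) = Id C X"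
        by (rule F_inj[OF X X])
          (use X GO' O in \<open>simp_all add: C.comp_closed[of _ "G0 (obj_map F X)"] C.id_closed \<eta> \<eta>' F_comp F_id ee' flip: FG_def\<close>)
      ultimately show "is_iso_in C (obj_map (comp_functor G F) X) (obj_map id_functor X) (\<eta> X)"
        using \<eta>(1)[OF X] \<eta>'(1)[OF X] by (auto simp: is_iso_in_def comp_functor_def id_functor_def G_obj)
      fix Y f assume Y: "Y \<in> Obj C" and f: "f \<in> carrier (Hom C X Y)"
      note OY = FO[OF Y] and GOY = GO[OF FO[OF Y]] and Ff = F_cl[OF X Y f]
      note Gf = G_cl[OF O OY Ff]
      have "Comp C (G0 (obj_map F X)) (G0 (obj_map F Y)) Y (\<eta> Y)
            (hom_map G (obj_map F X) (obj_map F Y) (hom_map F X Y f)) =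
          Comp C (G0 (obj_map F X)) X Y f (\<eta> X)" (is "?l = ?r")
      proof (rule F_inj[OF GO' Y])
        show "?l \<in> carrier (Hom C (G0 (obj_map F X)) Y)" "?r \<in> carrier (Hom C (G0 (obj_map F X)) Y)"
          by (rule C.comp_closed[OF GO' GOY Y Gf \<eta>(1)[OF Y]], rule C.comp_closed[OF GO' X Y \<eta>(1)[OF X] f])
        show "hom_map F (G0 (obj_map F X)) Y ?l = hom_map F (G0 (obj_map F X)) Y ?r"
          using F_comp[OF GO' GOY Y Gf \<eta>(1)[OF Y]] F_comp[OF GO' X Y \<eta>(1)[OF X] f]
          by (simp add: \<eta>(2) X Y FG_hom[OF O OY Ff] H_nat[OF O OY Ff] flip: FG_def)
      qed
      then show "Comp C (obj_map (comp_functor G F) X) (obj_map (comp_functor G F) Y) (obj_map id_functor Y)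
          (\<eta> Y) (hom_map (comp_functor G F) X Y f) =
          Comp C (obj_map (comp_functor G F) X) (obj_map id_functor X) (obj_map id_functor Y)
          (hom_map id_functor X Y f) (\<eta> X)"
        by (simp add: comp_functor_def id_functor_def G_obj)
    qed
  qed
  ultimately show ?thesis
    unfolding equivalent_categories_def using F G by blast
qed

section \<open>The linear category of modules\<close>

lemma module_hom_simps:
  "f \<in> carrier (module_hom K A M N) \<longleftrightarrow> linear_map K M N f \<and> f \<in> extensional (carrier M) \<and>
    (\<forall>x\<in>carrier M. \<forall>a\<in>carrier A. f (x \<triangleleft>\<^bsub>M\<^esub> a) = f x \<triangleleft>\<^bsub>N\<^esub> a)"
  "\<zero>\<^bsub>module_hom K A M N\<^esub> = (\<lambda>x\<in>carrier M. \<zero>\<^bsub>N\<^esub>)"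
  "f \<oplus>\<^bsub>module_hom K A M N\<^esub> g = (\<lambda>x\<in>carrier M. f x \<oplus>\<^bsub>N\<^esub> g x)"
  "k \<odot>\<^bsub>module_hom K A M N\<^esub> f = (\<lambda>x\<in>carrier M. k \<odot>\<^bsub>N\<^esub> f x)"
  by (auto simp: module_hom_def linear_hom_simps)

lemma mod_cat_simps [simp]:
  "X \<in> Obj (mod_cat K A) \<longleftrightarrow> fd_right_module K A X" "Hom (mod_cat K A) = module_hom K A"
  "Id (mod_cat K A) X = (\<lambda>x\<in>carrier X. x)" "Comp (mod_cat K A) X Y Z g f = compose (carrier X) g f"
  by (simp_all add: mod_cat_def)

lemma linear_cat_mod_cat:
  fixes K :: "('k, 'z) ring_scheme" and A :: "('k, 'a, 'e) module_scheme"
  shows "linear_cat K (mod_cat K A)"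
proof (unfold_locales, unfold mod_cat_simps)
  fix X :: "('k, 'a, nat \<Rightarrow> 'k) right_module" assume "fd_right_module K A X"
  then interpret X: fd_right_module K A X .
  show "(\<lambda>x\<in>carrier X. x) \<in> carrier (module_hom K A X X)"
    by (auto simp: module_hom_simps linear_map_def X.act_closed)
  fix Y :: "('k, 'a, nat \<Rightarrow> 'k) right_module" assume "fd_right_module K A Y"
  then interpret Y: fd_right_module K A Y .
  show "compose (carrier X) (\<lambda>x\<in>carrier Y. x) f = f" "compose (carrier X) f (\<lambda>x\<in>carrier X. x) = f"
    if "f \<in> carrier (module_hom K A X Y)" for f
    using that by (auto simp: module_hom_simps linear_map_def compose_def fun_eq_iff extensional_def Pi_iff)
  show "f \<oplus>\<^bsub>module_hom K A X Y\<^esub> g \<in> carrier (module_hom K A X Y)"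
    if "f \<in> carrier (module_hom K A X Y)" "g \<in> carrier (module_hom K A X Y)" for f g
    using that by (auto simp: module_hom_simps linear_map_def Pi_iff X.act_closed Y.act_l_distr
        Y.smult_r_distr Y.M.a_ac)
  show "k \<odot>\<^bsub>module_hom K A X Y\<^esub> f \<in> carrier (module_hom K A X Y)"
    if "k \<in> carrier K" "f \<in> carrier (module_hom K A X Y)" for k f
    using that by (auto simp: module_hom_simps linear_map_def Pi_iff X.act_closed Y.act_smult_left
        Y.smult_r_distr Y.smult_assoc1[symmetric] X.R.m_comm)
  fix Z :: "('k, 'a, nat \<Rightarrow> 'k) right_module" assume "fd_right_module K A Z"
  then interpret Z: fd_right_module K A Z .
  show "compose (carrier X) g f \<in> carrier (module_hom K A X Z)"
    if "f \<in> carrier (module_hom K A X Y)" "g \<in> carrier (module_hom K A Y Z)" for f g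
    using that by (auto simp: module_hom_simps linear_map_def Pi_iff compose_def X.act_closed)
  show "compose (carrier X) (g \<oplus>\<^bsub>module_hom K A Y Z\<^esub> h) f =
      compose (carrier X) g f \<oplus>\<^bsub>module_hom K A X Z\<^esub> compose (carrier X) h f"
    if "f \<in> carrier (module_hom K A X Y)" for f g h
    using that by (auto simp: module_hom_simps linear_map_def Pi_iff compose_def)
  show "compose (carrier X) (k \<odot>\<^bsub>module_hom K A Y Z\<^esub> g) f =
      k \<odot>\<^bsub>module_hom K A X Z\<^esub> compose (carrier X) g f"
    if "f \<in> carrier (module_hom K A X Y)" for f g k
    using that by (auto simp: module_hom_simps linear_map_def Pi_iff compose_def)
  show "compose (carrier X) h (f \<oplus>\<^bsub>module_hom K A X Y\<^esub> g) =
      compose (carrier X) h f \<oplus>\<^bsub>module_hom K A X Z\<^esub> compose (carrier X) h g"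
    if "f \<in> carrier (module_hom K A X Y)" "g \<in> carrier (module_hom K A X Y)"
      "h \<in> carrier (module_hom K A Y Z)" for f g h
    using that by (auto simp: module_hom_simps linear_map_def Pi_iff compose_def)
  show "compose (carrier X) g (k \<odot>\<^bsub>module_hom K A X Y\<^esub> f) =
      k \<odot>\<^bsub>module_hom K A X Z\<^esub> compose (carrier X) g f"
    if "k \<in> carrier K" "f \<in> carrier (module_hom K A X Y)" "g \<in> carrier (module_hom K A Y Z)" for f g k
    using that by (auto simp: module_hom_simps linear_map_def Pi_iff compose_def)
next
  fix W X Y Z f g h assume "f \<in> carrier (module_hom K A W X)"
  then show "compose (carrier W) h (compose (carrier W) g f) = compose (carrier W) (compose (carrier X) h g) f"
    by (auto simp: module_hom_simps linear_map_def Pi_iff compose_def)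
qed

section \<open>Morita equivalence with the corner of a full idempotent\<close>

lemma fd_right_module_transport:
  assumes "fd_right_module K A M" "bij_betw h (carrier M) (carrier N)" "linear_map K M N h"
    and "h \<zero>\<^bsub>M\<^esub> = \<zero>\<^bsub>N\<^esub>"
    and act: "\<And>x a. \<lbrakk>x \<in> carrier M; a \<in> carrier A\<rbrakk> \<Longrightarrow> h (x \<triangleleft>\<^bsub>M\<^esub> a) = h x \<triangleleft>\<^bsub>N\<^esub> a"
    and closed: "\<And>a b. \<lbrakk>a \<in> carrier A; b \<in> carrier A\<rbrakk> \<Longrightarrow> a \<oplus>\<^bsub>A\<^esub> b \<in> carrier A \<and> a \<otimes>\<^bsub>A\<^esub> b \<in> carrier A"
      "\<one>\<^bsub>A\<^esub> \<in> carrier A" "\<And>k a. \<lbrakk>k \<in> carrier K; a \<in> carrier A\<rbrakk> \<Longrightarrow> k \<odot>\<^bsub>A\<^esub> a \<in> carrier A"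
  shows "fd_right_module K A N"
proof -
  interpret M: fd_right_module K A M by fact
  have M: "module K M" ..
  have N: "module K N"
    by (rule module_transport[OF M assms(2-4)])
  have im: "carrier N = h ` carrier M"
    using assms(2) by (auto simp: bij_betw_def)
  note eqs = linear_map_add[OF assms(3), symmetric] linear_map_smult[OF assms(3), symmetric] act[symmetric]
  show ?thesis
    by (intro fd_right_module.intro fd_right_module_axioms.intro N
        finite_dimensional_transport[OF M N assms(2,3) M.finite_dim])
      (auto simp: im eqs closed M.act_closed M.act_l_distr M.act_r_distr M.act_assoc M.act_one
        M.act_smult_left M.act_smult_right)
qed

text \<open>Objects of \<open>mod_cat\<close> have their elements in
  \<open>nat \<Rightarrow> 'k\<close>. A module constructed on another type, such as a space of
  functions, is moved there by coordinates.\<close>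

definition coordinate_module ::
    "('k, 'z) ring_scheme \<Rightarrow> ('k, 'a, 'm) right_module \<Rightarrow> ('k, 'a, nat \<Rightarrow> 'k) right_module" where
  "coordinate_module K M =
     \<lparr>carrier = coord_space K M, mult = undefined, one = undefined,
      zero = to_coords K M \<zero>\<^bsub>M\<^esub>,
      add = (\<lambda>x y. to_coords K M (from_coords K M x \<oplus>\<^bsub>M\<^esub> from_coords K M y)),
      smult = (\<lambda>k x. to_coords K M (k \<odot>\<^bsub>M\<^esub> from_coords K M x)),
      act = (\<lambda>x a. to_coords K M (from_coords K M x \<triangleleft>\<^bsub>M\<^esub> a))\<rparr>"

lemma is_iso_in_mod_cat_if_bij:
  assumes M: "fd_right_module K A M" and "fd_right_module K A N"
    and f: "f \<in> carrier (module_hom K A M N)" and bij: "bij_betw f (carrier M) (carrier N)"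
  shows "is_iso_in (mod_cat K A) M N f"
proof -
  interpret M: fd_right_module K A M by fact
  interpret N: fd_right_module K A N by fact
  define g where "g = restrict (the_inv_into (carrier M) f) (carrier N)"
  have im: "carrier N = f ` carrier M" and inj: "inj_on f (carrier M)"
    using bij by (auto simp: bij_betw_def)
  have gf: "g (f x) = x" if "x \<in> carrier M" for x
    using that im by (simp add: g_def the_inv_into_f_f[OF inj])
  have eqs: "f x \<oplus>\<^bsub>N\<^esub> f y = f (x \<oplus>\<^bsub>M\<^esub> y)" "k \<in> carrier K \<Longrightarrow> k \<odot>\<^bsub>N\<^esub> f x = f (k \<odot>\<^bsub>M\<^esub> x)"
      "a \<in> carrier A \<Longrightarrow> f x \<triangleleft>\<^bsub>N\<^esub> a = f (x \<triangleleft>\<^bsub>M\<^esub> a)"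
    if "x \<in> carrier M" "y \<in> carrier M" for x y k a
    using f that by (auto simp: module_hom_simps linear_map_def)
  have "g \<in> carrier (module_hom K A N M)"
    unfolding module_hom_simps linear_map_def
    by (auto simp: im eqs gf M.act_closed) (simp_all add: g_def im)
  moreover have "compose (carrier M) g f = (\<lambda>x\<in>carrier M. x)" "compose (carrier N) f g = (\<lambda>x\<in>carrier N. x)"
    using gf by (auto simp: compose_def im intro!: restrict_ext)
  ultimately show ?thesis
    unfolding is_iso_in_def using f by auto
qed

text \<open>\<open>\<iota>\<close> identifies \<open>R\<close> with the corner \<open>eSe\<close>.
  The condition \<open>SeS = S\<close> is stated as an induction principle: 1 is a sum of products
  \<open>u v\<close> with \<open>u\<close> in \<open>Se\<close> and \<open>v\<close> in
  \<open>eS\<close>, so a predicate that holds for these products and is closed under sums holds for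
  1. Proofs can then work with one product at a time and need no notation for the sum.\<close>

locale full_corner =
  K: field K + S: fd_algebra K S + R: fd_algebra K R
  for K :: "('k, 'z) ring_scheme" (structure) and S :: "('k, 's, 'e) module_scheme"
    and R :: "('k, 'r, 'f) module_scheme" and \<iota> :: "'r \<Rightarrow> 's" and e :: 's +
  assumes iota_linear: "linear_map K R S \<iota>"
    and iota_mult: "\<lbrakk>r \<in> carrier R; r' \<in> carrier R\<rbrakk> \<Longrightarrow> \<iota> (r \<otimes>\<^bsub>R\<^esub> r') = \<iota> r \<otimes>\<^bsub>S\<^esub> \<iota> r'"
    and iota_one: "\<iota> \<one>\<^bsub>R\<^esub> = e"
    and iota_inj: "inj_on \<iota> (carrier R)"
    and corner: "x \<in> carrier S \<Longrightarrow> e \<otimes>\<^bsub>S\<^esub> x \<otimes>\<^bsub>S\<^esub> e \<in> \<iota> ` carrier R"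
    and full: "\<lbrakk>\<And>x y. \<lbrakk>x \<in> carrier S; y \<in> carrier S; P x; P y\<rbrakk> \<Longrightarrow> P (x \<oplus>\<^bsub>S\<^esub> y);
        \<And>u v. \<lbrakk>u \<in> carrier S; v \<in> carrier S; u \<otimes>\<^bsub>S\<^esub> e = u; e \<otimes>\<^bsub>S\<^esub> v = v\<rbrakk> \<Longrightarrow> P (u \<otimes>\<^bsub>S\<^esub> v)\<rbrakk>
      \<Longrightarrow> P \<one>\<^bsub>S\<^esub>"
begin

lemma iota_closed [simp]: "r \<in> carrier R \<Longrightarrow> \<iota> r \<in> carrier S"
  by (rule linear_map_closed[OF iota_linear])

lemma e_closed [simp]: "e \<in> carrier S"
  using iota_one iota_closed by (metis R.one_closed)

lemma e_iota: "r \<in> carrier R \<Longrightarrow> e \<otimes>\<^bsub>S\<^esub> \<iota> r = \<iota> r" "r \<in> carrier R \<Longrightarrow> \<iota> r \<otimes>\<^bsub>S\<^esub> e = \<iota> r"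
  by (simp_all add: iota_mult[symmetric] iota_one[symmetric])

lemma e_idem: "e \<otimes>\<^bsub>S\<^esub> e = e"
  using e_iota[of "\<one>\<^bsub>R\<^esub>"] by (simp add: iota_one)

text \<open>A product of an element of \<open>eS\<close> with one of \<open>Se\<close> lies in
  \<open>eSe\<close>, the image of \<open>\<iota>\<close>.\<close>

lemma corner_iota:
  assumes "v \<in> carrier S" "u \<in> carrier S" "e \<otimes>\<^bsub>S\<^esub> v = v" "u \<otimes>\<^bsub>S\<^esub> e = u"
  obtains r where "r \<in> carrier R" "\<iota> r = v \<otimes>\<^bsub>S\<^esub> u"
proof -
  have "e \<otimes>\<^bsub>S\<^esub> (v \<otimes>\<^bsub>S\<^esub> u) \<otimes>\<^bsub>S\<^esub> e = v \<otimes>\<^bsub>S\<^esub> u"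
    using assms by (metis S.m_assoc S.m_closed e_closed)
  with corner[of "v \<otimes>\<^bsub>S\<^esub> u"] assms that show thesis
    by auto
qed

text \<open>This is \<open>Me\<close>: since \<open>e\<close> is idempotent, its elements are
  exactly those fixed by \<open>e\<close>.\<close>

definition cut :: "('k, 's, 'm) right_module \<Rightarrow> ('k, 'r, 'm) right_module" where
  "cut M = \<lparr>carrier = {x \<in> carrier M. x \<triangleleft>\<^bsub>M\<^esub> e = x}, mult = undefined, one = undefined,
     zero = \<zero>\<^bsub>M\<^esub>, add = add M, smult = smult M, act = (\<lambda>x r. x \<triangleleft>\<^bsub>M\<^esub> \<iota> r)\<rparr>"

definition cut_functor where
  "cut_functor = \<lparr>obj_map = cut, hom_map = (\<lambda>M N f. restrict f (carrier (cut M)))\<rparr>"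

lemma cut_simps [simp]:
  "x \<in> carrier (cut M) \<longleftrightarrow> x \<in> carrier M \<and> x \<triangleleft>\<^bsub>M\<^esub> e = x" "\<zero>\<^bsub>cut M\<^esub> = \<zero>\<^bsub>M\<^esub>"
  "x \<oplus>\<^bsub>cut M\<^esub> y = x \<oplus>\<^bsub>M\<^esub> y" "k \<odot>\<^bsub>cut M\<^esub> x = k \<odot>\<^bsub>M\<^esub> x" "x \<triangleleft>\<^bsub>cut M\<^esub> r = x \<triangleleft>\<^bsub>M\<^esub> \<iota> r"
  by (simp_all add: cut_def)

lemma fd_right_module_cut:
  assumes "fd_right_module K S M"
  shows "fd_right_module K R (cut M)"
proof -
  interpret M: fd_right_module K S M by fact
  have M: "module K M" ..
  have K: "cring K" ..
  have 0: "\<zero>\<^bsub>M\<^esub> \<triangleleft>\<^bsub>M\<^esub> e = \<zero>\<^bsub>M\<^esub>"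
    using M.act_smult_left[of "\<zero>" "\<zero>\<^bsub>M\<^esub>" e] M.act_closed by simp
  have mod: "module K (cut M)"
    by (rule moduleI_smult[OF K])
      (auto simp: M.a_ac M.smult_l_distr M.smult_r_distr M.smult_assoc1 M.act_l_distr M.act_smult_left 0)
  have fd: "finite_dimensional K (cut M)"
    by (rule finite_dimensional_if_separated_by_maps[OF K.field_axioms mod M M.finite_dim, of "{\<lambda>x. x}"])
      (auto simp: linear_map_def)
  show ?thesis
    by (intro fd_right_module.intro fd_right_module_axioms.intro mod fd)
      (auto simp: M.act_closed M.act_l_distr M.act_r_distr M.act_assoc M.act_smult_left
        M.act_smult_right linear_map_add[OF iota_linear] linear_map_smult[OF iota_linear] iota_mult
        iota_one e_iota simp flip: M.act_assoc)
qed

lemma restrict_cut: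
  assumes M: "fd_right_module K S M" and f: "f \<in> carrier (module_hom K S M N)"
  shows "restrict f (carrier (cut M)) \<in> carrier (module_hom K R (cut M) (cut N))"
proof -
  interpret M: fd_right_module K S M by fact
  interpret cut: fd_right_module K R "cut M"
    by (rule fd_right_module_cut[OF M])
  have act: "f (x \<triangleleft>\<^bsub>M\<^esub> s) = f x \<triangleleft>\<^bsub>N\<^esub> s" if "x \<in> carrier M" "s \<in> carrier S" for x s
    using f that by (simp add: module_hom_simps)
  have "f x \<in> carrier (cut N)" if "x \<in> carrier (cut M)" for x
    using f that act[of x e] by (simp add: module_hom_simps linear_map_def Pi_iff)
  moreover have "f (x \<triangleleft>\<^bsub>cut M\<^esub> r) = f x \<triangleleft>\<^bsub>cut N\<^esub> r" if "x \<in> carrier (cut M)" "r \<in> carrier R" for x r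
    using act[of x "\<iota> r"] that by simp
  moreover have "f (x \<oplus>\<^bsub>cut M\<^esub> y) = f x \<oplus>\<^bsub>cut N\<^esub> f y" if "x \<in> carrier (cut M)" "y \<in> carrier (cut M)" for x y
    using f that by (simp add: module_hom_simps linear_map_def)
  moreover have "f (k \<odot>\<^bsub>cut M\<^esub> x) = k \<odot>\<^bsub>cut N\<^esub> f x" if "k \<in> carrier K" "x \<in> carrier (cut M)" for k x
    using f that by (simp add: module_hom_simps linear_map_def)
  ultimately show ?thesis
    unfolding module_hom_simps
    by (auto simp: linear_map_restrict[OF cut.module_axioms] cut.act_closed simp del: cut_simps
        intro: linear_mapI)
qed

lemma cut_functor_linear: "is_linear_functor K (mod_cat K S) (mod_cat K R) cut_functor"
  unfolding is_linear_functor_def mod_cat_simps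
proof (intro conjI ballI; (unfold mod_cat_simps)?)
  fix M :: "('k, 's, nat \<Rightarrow> 'k) right_module" assume "fd_right_module K S M"
  then interpret M: fd_right_module K S M .
  show "fd_right_module K R (obj_map cut_functor M)"
    by (simp add: cut_functor_def fd_right_module_cut M.fd_right_module_axioms)
  show "hom_map cut_functor M M (\<lambda>x\<in>carrier M. x) = (\<lambda>x\<in>carrier (obj_map cut_functor M). x)"
    by (auto simp: cut_functor_def)
  fix N :: "('k, 's, nat \<Rightarrow> 'k) right_module" assume "fd_right_module K S N"
  then interpret N: fd_right_module K S N .
  show "hom_map cut_functor M N \<in> carrier (module_hom K S M N) \<rightarrow>
      carrier (module_hom K R (obj_map cut_functor M) (obj_map cut_functor N))"
    by (auto simp: cut_functor_def restrict_cut[OF M.fd_right_module_axioms] simp del: cut_simps)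
  show "hom_map cut_functor M N (f \<oplus>\<^bsub>module_hom K S M N\<^esub> g) =
      hom_map cut_functor M N f \<oplus>\<^bsub>module_hom K R (obj_map cut_functor M) (obj_map cut_functor N)\<^esub>
      hom_map cut_functor M N g" for f g
    by (auto simp: cut_functor_def module_hom_simps)
  show "hom_map cut_functor M N (k \<odot>\<^bsub>module_hom K S M N\<^esub> f) =
      k \<odot>\<^bsub>module_hom K R (obj_map cut_functor M) (obj_map cut_functor N)\<^esub> hom_map cut_functor M N f" for k f
    by (auto simp: cut_functor_def module_hom_simps)
  fix L :: "('k, 's, nat \<Rightarrow> 'k) right_module" and f g
  assume "f \<in> carrier (module_hom K S M N)"
  from restrict_cut[OF M.fd_right_module_axioms this]
  have "f x \<in> carrier (cut N)" if "x \<in> carrier (cut M)" for x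
    using that by (auto simp: module_hom_simps linear_map_def Pi_iff simp del: cut_simps)
  moreover have "x \<in> carrier M" if "x \<in> carrier (cut M)" for x
    using that by simp
  ultimately show "hom_map cut_functor M L (compose (carrier M) g f) =
      compose (carrier (obj_map cut_functor M)) (hom_map cut_functor N L g) (hom_map cut_functor M N f)"
    by (auto simp: cut_functor_def compose_def simp del: cut_simps intro!: restrict_ext)
qed

text \<open>Fullness is applied to the predicate \<open>x s = y s\<close>: if \<open>x\<close> and
  \<open>y\<close> agree after multiplication by \<open>u\<close> in \<open>Se\<close>, they agree
  after multiplication by \<open>u v\<close>, hence by 1.\<close>

lemma eq_if_act_eq:
  assumes "fd_right_module K S M" "x \<in> carrier M" "y \<in> carrier M"
    and "\<And>u. \<lbrakk>u \<in> carrier S; u \<otimes>\<^bsub>S\<^esub> e = u\<rbrakk> \<Longrightarrow> x \<triangleleft>\<^bsub>M\<^esub> u = y \<triangleleft>\<^bsub>M\<^esub> u"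
  shows "x = y"
proof -
  interpret M: fd_right_module K S M by fact
  have "x \<triangleleft>\<^bsub>M\<^esub> \<one>\<^bsub>S\<^esub> = y \<triangleleft>\<^bsub>M\<^esub> \<one>\<^bsub>S\<^esub>"
    by (rule full) (use assms in \<open>simp_all add: M.act_r_distr M.act_assoc\<close>)
  then show ?thesis
    using assms by (simp add: M.act_one)
qed

text \<open>The extension of \<open>f : Me \<rightarrow> Ne\<close> to \<open>M\<close> sends \<open>x\<close> to the unique \<open>y\<close> such that
  \<open>y u = f (x u)\<close> for all \<open>u\<close> in \<open>Se\<close>.\<close>

lemma cut_functor_fully_faithful:
  fixes M N :: "('k, 's, nat \<Rightarrow> 'k) right_module"
  assumes M: "fd_right_module K S M" and N: "fd_right_module K S N"
  shows "bij_betw (\<lambda>f. restrict f (carrier (cut M))) (carrier (module_hom K S M N))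
    (carrier (module_hom K R (cut M) (cut N)))"
proof -
  interpret M: fd_right_module K S M by fact
  interpret N: fd_right_module K S N by fact
  have Me: "x \<triangleleft>\<^bsub>M\<^esub> u \<in> carrier (cut M)" if "x \<in> carrier M" "u \<in> carrier S" "u \<otimes>\<^bsub>S\<^esub> e = u" for x u
    using that by (simp add: M.act_closed M.act_assoc[symmetric])
  show ?thesis
  proof (rule bij_betw_imageI)
    show "inj_on (\<lambda>f. restrict f (carrier (cut M))) (carrier (module_hom K S M N))"
    proof (rule inj_onI)
      fix f g assume f: "f \<in> carrier (module_hom K S M N)" and g: "g \<in> carrier (module_hom K S M N)"
        and eq: "restrict f (carrier (cut M)) = restrict g (carrier (cut M))"
      have "f x = g x" if x: "x \<in> carrier M" for x
      proof -
        \<comment> \<open>By fullness it suffices to compare \<open>f\<close> and \<open>g\<close>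
          on \<open>x u v\<close>, where \<open>x u\<close> lies in \<open>Me\<close> and the
          restrictions agree.\<close>
        have "f (x \<triangleleft>\<^bsub>M\<^esub> \<one>\<^bsub>S\<^esub>) = g (x \<triangleleft>\<^bsub>M\<^esub> \<one>\<^bsub>S\<^esub>)"
        proof (rule full)
          fix u v assume u: "u \<in> carrier S" "u \<otimes>\<^bsub>S\<^esub> e = u" and v: "v \<in> carrier S"
          have "f (x \<triangleleft>\<^bsub>M\<^esub> u) = g (x \<triangleleft>\<^bsub>M\<^esub> u)"
            using fun_cong[OF eq, of "x \<triangleleft>\<^bsub>M\<^esub> u"] Me[OF x u] by (simp only: restrict_apply' if_True)
          then show "f (x \<triangleleft>\<^bsub>M\<^esub> (u \<otimes>\<^bsub>S\<^esub> v)) = g (x \<triangleleft>\<^bsub>M\<^esub> (u \<otimes>\<^bsub>S\<^esub> v))"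
            using f g x u v by (simp add: module_hom_simps M.act_assoc M.act_closed)
        qed (use f g x in \<open>simp add: module_hom_simps M.act_r_distr M.act_closed linear_map_def\<close>)
        then show ?thesis
          using x by (simp add: M.act_one)
      qed
      then show "f = g"
        using f g by (auto simp: module_hom_simps intro: extensionalityI)
    qed
    show "(\<lambda>f. restrict f (carrier (cut M))) ` carrier (module_hom K S M N) =
        carrier (module_hom K R (cut M) (cut N))"
    proof (intro equalityI subsetI)
      fix f assume "f \<in> (\<lambda>f. restrict f (carrier (cut M))) ` carrier (module_hom K S M N)"
      then show "f \<in> carrier (module_hom K R (cut M) (cut N))"
        using restrict_cut[OF M] by auto
    next
      fix f assume f: "f \<in> carrier (module_hom K R (cut M) (cut N))"
      have f_cl: "f x \<in> carrier N" if "x \<in> carrier (cut M)" for x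
        using f that by (auto simp: module_hom_simps linear_map_def Pi_iff)
      have f_add: "f (x \<oplus>\<^bsub>M\<^esub> y) = f x \<oplus>\<^bsub>N\<^esub> f y" if "x \<in> carrier (cut M)" "y \<in> carrier (cut M)" for x y
        using f that by (auto simp: module_hom_simps linear_map_def)
      have f_smult: "f (k \<odot>\<^bsub>M\<^esub> x) = k \<odot>\<^bsub>N\<^esub> f x" if "k \<in> carrier K" "x \<in> carrier (cut M)" for k x
        using f that by (auto simp: module_hom_simps linear_map_def)
      have f_act: "f (x \<triangleleft>\<^bsub>M\<^esub> \<iota> r) = f x \<triangleleft>\<^bsub>N\<^esub> \<iota> r" if "r \<in> carrier R" "x \<in> carrier (cut M)" for r x
        using f that by (auto simp: module_hom_simps)
      define Q where "Q x y \<longleftrightarrow> y \<in> carrier N \<and>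
          (\<forall>u\<in>carrier S. u \<otimes>\<^bsub>S\<^esub> e = u \<longrightarrow> f (x \<triangleleft>\<^bsub>M\<^esub> u) = y \<triangleleft>\<^bsub>N\<^esub> u)" for x y
      have unique: "y = y'" if "Q x y" "Q x y'" for x y y'
        by (rule eq_if_act_eq[OF N]) (use that in \<open>unfold Q_def, metis+\<close>)
      \<comment> \<open>Fullness is applied to the predicate that \<open>x s\<close> has an image.
        Images of sums are sums of images, and the image of \<open>x u v\<close> is
        \<open>f (x u) v\<close>.\<close>
      have "\<exists>y. Q (x \<triangleleft>\<^bsub>M\<^esub> \<one>\<^bsub>S\<^esub>) y" if x: "x \<in> carrier M" for x
      proof (rule full)
        fix s t assume s: "s \<in> carrier S" and t: "t \<in> carrier S"
          and "\<exists>y. Q (x \<triangleleft>\<^bsub>M\<^esub> s) y" "\<exists>y. Q (x \<triangleleft>\<^bsub>M\<^esub> t) y"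
        then obtain y z where yz: "Q (x \<triangleleft>\<^bsub>M\<^esub> s) y" "Q (x \<triangleleft>\<^bsub>M\<^esub> t) z"
          by auto
        have "Q (x \<triangleleft>\<^bsub>M\<^esub> (s \<oplus>\<^bsub>S\<^esub> t)) (y \<oplus>\<^bsub>N\<^esub> z)"
          unfolding Q_def
        proof (intro conjI ballI impI)
          fix u assume u: "u \<in> carrier S" "u \<otimes>\<^bsub>S\<^esub> e = u"
          have "f (x \<triangleleft>\<^bsub>M\<^esub> (s \<oplus>\<^bsub>S\<^esub> t) \<triangleleft>\<^bsub>M\<^esub> u) = f (x \<triangleleft>\<^bsub>M\<^esub> s \<triangleleft>\<^bsub>M\<^esub> u) \<oplus>\<^bsub>N\<^esub> f (x \<triangleleft>\<^bsub>M\<^esub> t \<triangleleft>\<^bsub>M\<^esub> u)"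
            using x s t u by (simp add: M.act_r_distr M.act_l_distr M.act_closed f_add[OF Me Me])
          then show "f (x \<triangleleft>\<^bsub>M\<^esub> (s \<oplus>\<^bsub>S\<^esub> t) \<triangleleft>\<^bsub>M\<^esub> u) = (y \<oplus>\<^bsub>N\<^esub> z) \<triangleleft>\<^bsub>N\<^esub> u"
            using yz u by (simp add: Q_def N.act_l_distr)
        qed (use yz in \<open>simp add: Q_def\<close>)
        then show "\<exists>y. Q (x \<triangleleft>\<^bsub>M\<^esub> (s \<oplus>\<^bsub>S\<^esub> t)) y" by blast
      next
        fix u v assume u: "u \<in> carrier S" "u \<otimes>\<^bsub>S\<^esub> e = u" and v: "v \<in> carrier S" "e \<otimes>\<^bsub>S\<^esub> v = v"
        have "Q (x \<triangleleft>\<^bsub>M\<^esub> (u \<otimes>\<^bsub>S\<^esub> v)) (f (x \<triangleleft>\<^bsub>M\<^esub> u) \<triangleleft>\<^bsub>N\<^esub> v)"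
          unfolding Q_def
        proof (intro conjI ballI impI)
          fix w assume w: "w \<in> carrier S" "w \<otimes>\<^bsub>S\<^esub> e = w"
          \<comment> \<open>The product \<open>v w\<close> lies in \<open>eSe\<close>, so
            \<open>f\<close>, being \<open>R\<close>-linear, commutes with it.\<close>
          obtain r where r: "r \<in> carrier R" "\<iota> r = v \<otimes>\<^bsub>S\<^esub> w"
            using corner_iota[OF v(1) w(1) v(2) w(2)] .
          have "f (x \<triangleleft>\<^bsub>M\<^esub> (u \<otimes>\<^bsub>S\<^esub> v) \<triangleleft>\<^bsub>M\<^esub> w) = f (x \<triangleleft>\<^bsub>M\<^esub> u \<triangleleft>\<^bsub>M\<^esub> \<iota> r)"
            using x u v w r by (simp add: M.act_assoc M.act_closed)
          also have "\<dots> = f (x \<triangleleft>\<^bsub>M\<^esub> u) \<triangleleft>\<^bsub>N\<^esub> \<iota> r"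
            by (rule f_act[OF r(1) Me[OF x u]])
          finally show "f (x \<triangleleft>\<^bsub>M\<^esub> (u \<otimes>\<^bsub>S\<^esub> v) \<triangleleft>\<^bsub>M\<^esub> w) = f (x \<triangleleft>\<^bsub>M\<^esub> u) \<triangleleft>\<^bsub>N\<^esub> v \<triangleleft>\<^bsub>N\<^esub> w"
            using v w r f_cl[OF Me[OF x u]] by (simp add: N.act_assoc)
        qed (use N.act_closed f_cl[OF Me[OF x u]] v in auto)
        then show "\<exists>y. Q (x \<triangleleft>\<^bsub>M\<^esub> (u \<otimes>\<^bsub>S\<^esub> v)) y" by blast
      qed
      then have ex: "\<exists>y. Q x y" if "x \<in> carrier M" for x
        using that by (simp add: M.act_one)
      define g where "g = (\<lambda>x\<in>carrier M. THE y. Q x y)"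
      have Qg: "Q x (g x)" if "x \<in> carrier M" for x
        using theI'[of "Q x"] ex[OF that] unique that by (auto simp: g_def)
      have g_eqI: "g x = y" if "x \<in> carrier M" "Q x y" for x y
        using unique Qg that by blast
      have g_cl: "g x \<in> carrier N" if "x \<in> carrier M" for x
        using Qg[OF that] by (simp add: Q_def)
      have gu: "g x \<triangleleft>\<^bsub>N\<^esub> u = f (x \<triangleleft>\<^bsub>M\<^esub> u)" if "x \<in> carrier M" "u \<in> carrier S" "u \<otimes>\<^bsub>S\<^esub> e = u" for x u
        using Qg[OF that(1)] that by (simp add: Q_def)
      have "g \<in> carrier (module_hom K S M N)"
        unfolding module_hom_simps
      proof (intro conjI ballI linear_mapI)
        show "g (x \<oplus>\<^bsub>M\<^esub> y) = g x \<oplus>\<^bsub>N\<^esub> g y" if "x \<in> carrier M" "y \<in> carrier M" for x y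
          using that by (intro g_eqI) (auto simp: Q_def g_cl M.act_l_distr N.act_l_distr f_add[OF Me Me] gu)
        show "g (k \<odot>\<^bsub>M\<^esub> x) = k \<odot>\<^bsub>N\<^esub> g x" if "k \<in> carrier K" "x \<in> carrier M" for k x
          using that by (intro g_eqI) (auto simp: Q_def g_cl M.act_smult_left N.act_smult_left f_smult[OF _ Me] gu)
        fix x a assume x: "x \<in> carrier M" and a: "a \<in> carrier S"
        have "f (x \<triangleleft>\<^bsub>M\<^esub> a \<triangleleft>\<^bsub>M\<^esub> u) = g x \<triangleleft>\<^bsub>N\<^esub> a \<triangleleft>\<^bsub>N\<^esub> u" if u: "u \<in> carrier S" "u \<otimes>\<^bsub>S\<^esub> e = u" for u
          using gu[OF x, of "a \<otimes>\<^bsub>S\<^esub> u"] x a u g_cl[OF x] by (simp add: M.act_assoc N.act_assoc S.m_assoc)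
        then show "g (x \<triangleleft>\<^bsub>M\<^esub> a) = g x \<triangleleft>\<^bsub>N\<^esub> a"
          using x a by (intro g_eqI) (auto simp: Q_def g_cl M.act_closed N.act_closed)
      qed (auto simp: g_cl, simp add: g_def)
      moreover have "restrict g (carrier (cut M)) = f"
      proof
        fix x
        show "restrict g (carrier (cut M)) x = f x"
        proof (cases "x \<in> carrier (cut M)")
          case x: True
          \<comment> \<open>For \<open>x\<close> in \<open>Me\<close> the product \<open>x u\<close>
            equals \<open>x (e u)\<close> with \<open>e u\<close> in \<open>eSe\<close>, so the
            extension agrees with \<open>f\<close> there.\<close>
          then have "Q x (f x)"
            unfolding Q_def
          proof (intro conjI ballI impI)
            fix u assume u: "u \<in> carrier S" "u \<otimes>\<^bsub>S\<^esub> e = u"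
            obtain r where r: "r \<in> carrier R" "\<iota> r = e \<otimes>\<^bsub>S\<^esub> u"
              using corner_iota[OF e_closed u(1) e_idem u(2)] .
            have fe: "f x \<triangleleft>\<^bsub>N\<^esub> e = f x"
              using f x by (auto simp: module_hom_simps linear_map_def Pi_iff)
            have "f (x \<triangleleft>\<^bsub>M\<^esub> u) = f (x \<triangleleft>\<^bsub>M\<^esub> \<iota> r)"
              using x u r by (simp add: M.act_assoc)
            also have "\<dots> = f x \<triangleleft>\<^bsub>N\<^esub> (e \<otimes>\<^bsub>S\<^esub> u)"
              using f_act[OF r(1) x] r by simp
            also have "\<dots> = f x \<triangleleft>\<^bsub>N\<^esub> u"
              using u fe f_cl[OF x] by (simp add: N.act_assoc)
            finally show "f (x \<triangleleft>\<^bsub>M\<^esub> u) = f x \<triangleleft>\<^bsub>N\<^esub> u" .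
          qed (rule f_cl)
          then show ?thesis
            using x g_eqI by auto
        next
          case False
          have "f \<in> extensional (carrier (cut M))"
            using f by (simp only: module_hom_simps)
          then show ?thesis
            using False by (metis extensional_arb restrict_apply)
        qed
      qed
      ultimately show "f \<in> (\<lambda>f. restrict f (carrier (cut M))) ` carrier (module_hom K S M N)"
        by (metis imageI)
    qed
  qed
qed

text \<open>The module induced from \<open>N\<close> is realized as \<open>Hom (Se, N)\<close>.\<close>

lemma cut_functor_essentially_surjective:
  fixes N :: "('k, 'r, nat \<Rightarrow> 'k) right_module"
  assumes N: "fd_right_module K R N"
  shows "\<exists>M. fd_right_module K S M \<and> (\<exists>f. is_iso_in (mod_cat K R) (cut M) N f)"
proof -
  interpret N: fd_right_module K R N by fact
  have K: "cring K" and S: "module K S" and N': "module K N" ..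
  \<comment> \<open>\<open>Se\<close>, a left \<open>S\<close>-module on which \<open>R\<close> acts
    from the right through \<open>\<iota>\<close>.\<close>
  define U where "U = S\<lparr>carrier := {x \<in> carrier S. x \<otimes>\<^bsub>S\<^esub> e = x}\<rparr>"
  have U: "x \<in> carrier U \<longleftrightarrow> x \<in> carrier S \<and> x \<otimes>\<^bsub>S\<^esub> e = x" "\<zero>\<^bsub>U\<^esub> = \<zero>\<^bsub>S\<^esub>"
      "x \<oplus>\<^bsub>U\<^esub> y = x \<oplus>\<^bsub>S\<^esub> y" "k \<odot>\<^bsub>U\<^esub> x = k \<odot>\<^bsub>S\<^esub> x" for x y k
    by (auto simp: U_def)
  have mod_U: "module K U"
    by (rule moduleI_smult[OF K])
      (auto simp: U S.a_ac S.smult_l_distr S.smult_r_distr S.smult_assoc1 S.l_distr S.smult_mult_left)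
  have fd_U: "finite_dimensional K U"
    by (rule finite_dimensional_if_separated_by_maps[OF K.field_axioms mod_U S S.finite_dim, of "{\<lambda>x. x}"])
      (auto simp: linear_map_def U)
  define L where "L = linear_hom K U N"
  have L: "module K L" "finite_dimensional K L"
    unfolding L_def
    by (rule module_linear_hom[OF mod_U N'],
        rule finite_dimensional_linear_hom[OF K.field_axioms mod_U N' fd_U N.finite_dim])
  interpret L: module K L by (rule L)
  \<comment> \<open>The \<open>R\<close>-linear maps from \<open>Se\<close> to \<open>N\<close>;
    left multiplication of \<open>S\<close> on \<open>Se\<close> turns into a right action on
    them.\<close>
  define M :: "('k, 's, 's \<Rightarrow> nat \<Rightarrow> 'k) right_module" where
    "M = \<lparr>carrier = {g \<in> carrier L. \<forall>x\<in>carrier U. \<forall>r\<in>carrier R. g (x \<otimes>\<^bsub>S\<^esub> \<iota> r) = g x \<triangleleft>\<^bsub>N\<^esub> r},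
      mult = undefined, one = undefined, zero = \<zero>\<^bsub>L\<^esub>, add = add L, smult = smult L,
      act = (\<lambda>g s. \<lambda>x\<in>carrier U. g (s \<otimes>\<^bsub>S\<^esub> x))\<rparr>"
  have M: "g \<in> carrier M \<longleftrightarrow> g \<in> carrier L \<and> (\<forall>x\<in>carrier U. \<forall>r\<in>carrier R. g (x \<otimes>\<^bsub>S\<^esub> \<iota> r) = g x \<triangleleft>\<^bsub>N\<^esub> r)"
      "\<zero>\<^bsub>M\<^esub> = \<zero>\<^bsub>L\<^esub>" "g \<oplus>\<^bsub>M\<^esub> h = g \<oplus>\<^bsub>L\<^esub> h" "k \<odot>\<^bsub>M\<^esub> g = k \<odot>\<^bsub>L\<^esub> g"
      "g \<triangleleft>\<^bsub>M\<^esub> s = (\<lambda>x\<in>carrier U. g (s \<otimes>\<^bsub>S\<^esub> x))" for g h k s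
    by (auto simp: M_def)
  have Ui: "x \<otimes>\<^bsub>S\<^esub> \<iota> r \<in> carrier U" if "x \<in> carrier U" "r \<in> carrier R" for x r
    using that by (simp add: U S.m_assoc e_iota)
  have sU: "s \<otimes>\<^bsub>S\<^esub> x \<in> carrier U" if "x \<in> carrier U" "s \<in> carrier S" for x s
    using that by (simp add: U S.m_assoc)
  have N0: "\<zero>\<^bsub>N\<^esub> \<triangleleft>\<^bsub>N\<^esub> r = \<zero>\<^bsub>N\<^esub>" if "r \<in> carrier R" for r
    using N.act_smult_left[of "\<zero>" "\<zero>\<^bsub>N\<^esub>" r] that N.act_closed by simp
  have L_simps: "g \<in> carrier L \<longleftrightarrow> linear_map K U N g \<and> g \<in> extensional (carrier U)"
     "\<zero>\<^bsub>L\<^esub> = (\<lambda>x\<in>carrier U. \<zero>\<^bsub>N\<^esub>)" "g \<oplus>\<^bsub>L\<^esub> h = (\<lambda>x\<in>carrier U. g x \<oplus>\<^bsub>N\<^esub> h x)"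
     "k \<odot>\<^bsub>L\<^esub> g = (\<lambda>x\<in>carrier U. k \<odot>\<^bsub>N\<^esub> g x)" for g h k
    by (simp_all add: L_def linear_hom_simps)
  have g_cl: "g x \<in> carrier N" if "g \<in> carrier L" "x \<in> carrier U" for g x
    using that by (auto simp: L_simps linear_map_def)
  have mod_M: "module K M"
  proof (rule moduleI_smult[OF K])
    show "g \<oplus>\<^bsub>M\<^esub> h \<in> carrier M" if "g \<in> carrier M" "h \<in> carrier M" for g h
      using that L.a_closed[of g h] unfolding M
      by (auto simp: L_simps(3) Ui N.act_l_distr g_cl)
    show "k \<odot>\<^bsub>M\<^esub> g \<in> carrier M" if "k \<in> carrier K" "g \<in> carrier M" for k g
      using that L.smult_closed[of k g] unfolding M
      by (auto simp: L_simps(4) Ui N.act_smult_left g_cl)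
    show "\<zero>\<^bsub>M\<^esub> \<in> carrier M"
      using L.zero_closed unfolding M by (auto simp: L_simps(2) Ui N0)
  qed (auto simp: M L.a_ac L.smult_l_distr L.smult_r_distr L.smult_assoc1)
  have fd_M: "finite_dimensional K M"
    by (rule finite_dimensional_if_separated_by_maps[OF K.field_axioms mod_M L, of "{\<lambda>x. x}"])
      (auto simp: linear_map_def M)
  have act_closed: "g \<triangleleft>\<^bsub>M\<^esub> s \<in> carrier M" if g: "g \<in> carrier M" and s: "s \<in> carrier S" for g s
  proof -
    have lin: "linear_map K U N g"
      using g by (simp add: M L_simps)
    have "linear_map K U U (\<lambda>x. s \<otimes>\<^bsub>S\<^esub> x)"
      using s by (auto simp: linear_map_def sU U S.r_distr S.smult_mult_right S.m_assoc)
    then have "linear_map K U N (\<lambda>x. g (s \<otimes>\<^bsub>S\<^esub> x))"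
      by (rule linear_map_compose[OF lin])
    moreover have "g (s \<otimes>\<^bsub>S\<^esub> (x \<otimes>\<^bsub>S\<^esub> \<iota> r)) = g (s \<otimes>\<^bsub>S\<^esub> x) \<triangleleft>\<^bsub>N\<^esub> r" if "x \<in> carrier U" "r \<in> carrier R" for x r
    proof -
      have "g (s \<otimes>\<^bsub>S\<^esub> (x \<otimes>\<^bsub>S\<^esub> \<iota> r)) = g (s \<otimes>\<^bsub>S\<^esub> x \<otimes>\<^bsub>S\<^esub> \<iota> r)"
        using that s by (simp add: U S.m_assoc)
      then show ?thesis
        using g sU[OF that(1) s] that(2) by (simp add: M)
    qed
    ultimately show ?thesis
      by (auto simp: M L_simps linear_map_restrict[OF mod_U] Ui)
  qed
  have fd_right_M: "fd_right_module K S M"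
  proof (intro fd_right_module.intro fd_right_module_axioms.intro mod_M fd_M act_closed)
    fix g a b assume g: "g \<in> carrier M" and a: "a \<in> carrier S" and b: "b \<in> carrier S"
    have lin: "linear_map K U N g"
      using g by (simp add: M L_simps)
    show "g \<triangleleft>\<^bsub>M\<^esub> (a \<oplus>\<^bsub>S\<^esub> b) = g \<triangleleft>\<^bsub>M\<^esub> a \<oplus>\<^bsub>M\<^esub> g \<triangleleft>\<^bsub>M\<^esub> b"
      using linear_map_add[OF lin sU sU] a b by (auto simp: M(3-) L_simps(2-) S.l_distr U)
    show "g \<triangleleft>\<^bsub>M\<^esub> (a \<otimes>\<^bsub>S\<^esub> b) = (g \<triangleleft>\<^bsub>M\<^esub> a) \<triangleleft>\<^bsub>M\<^esub> b"
      using a b sU by (auto simp: M(5) S.m_assoc U)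
  next
    fix g assume "g \<in> carrier M"
    then show "g \<triangleleft>\<^bsub>M\<^esub> \<one>\<^bsub>S\<^esub> = g"
      by (auto simp: M L_simps U fun_eq_iff extensional_def)
  next
    fix k g a assume k: "k \<in> carrier K" and g: "g \<in> carrier M" and a: "a \<in> carrier S"
    have lin: "linear_map K U N g"
      using g by (simp add: M L_simps)
    show "(k \<odot>\<^bsub>M\<^esub> g) \<triangleleft>\<^bsub>M\<^esub> a = k \<odot>\<^bsub>M\<^esub> (g \<triangleleft>\<^bsub>M\<^esub> a)"
      using sU a by (auto simp: M(3-) L_simps(2-))
    show "g \<triangleleft>\<^bsub>M\<^esub> (k \<odot>\<^bsub>S\<^esub> a) = k \<odot>\<^bsub>M\<^esub> (g \<triangleleft>\<^bsub>M\<^esub> a)"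
      using linear_map_smult[OF lin k sU] a k by (auto simp: M(3-) L_simps(2-) U S.smult_mult_left)
  next
    fix g h a assume "g \<in> carrier M" "h \<in> carrier M" "a \<in> carrier S"
    then show "(g \<oplus>\<^bsub>M\<^esub> h) \<triangleleft>\<^bsub>M\<^esub> a = g \<triangleleft>\<^bsub>M\<^esub> a \<oplus>\<^bsub>M\<^esub> h \<triangleleft>\<^bsub>M\<^esub> a"
      using sU by (auto simp: M(3-) L_simps(2-))
  qed
  \<comment> \<open>Elements of \<open>M\<close> are functions on \<open>'s\<close>, so
    \<open>M\<close> itself is not an object of \<open>mod_cat\<close>.\<close>
  define M' where "M' = coordinate_module K M"
  note ft = from_to_coords[OF fd_M]
  have M': "carrier M' = coord_space K M" "\<zero>\<^bsub>M'\<^esub> = to_coords K M \<zero>\<^bsub>M\<^esub>"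
      "x \<oplus>\<^bsub>M'\<^esub> y = to_coords K M (from_coords K M x \<oplus>\<^bsub>M\<^esub> from_coords K M y)"
      "k \<odot>\<^bsub>M'\<^esub> x = to_coords K M (k \<odot>\<^bsub>M\<^esub> from_coords K M x)"
      "x \<triangleleft>\<^bsub>M'\<^esub> a = to_coords K M (from_coords K M x \<triangleleft>\<^bsub>M\<^esub> a)" for x y k a
    by (simp_all add: M'_def coordinate_module_def)
  interpret M: fd_right_module K S M by (rule fd_right_M)
  have to_cl: "to_coords K M g \<in> coord_space K M" if "g \<in> carrier M" for g
    using bij_betwE[OF ft(2)] that by blast
  have from_cl: "from_coords K M c \<in> carrier M" if "c \<in> coord_space K M" for c
    using bij_betwE[OF ft(1)] that by blast
  have lin: "linear_map K M M' (to_coords K M)"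
    by (rule linear_mapI) (simp_all add: M'(1,3,4) to_cl ft(3) del: M.smult_closed)
  have bij: "bij_betw (to_coords K M) (carrier M) (carrier M')"
    using ft(2) by (simp add: M'(1))
  have fd_M': "fd_right_module K S M'"
    by (rule fd_right_module_transport[OF fd_right_M bij lin]) (simp_all add: M'(2,5) ft(3))
  have eU: "e \<in> carrier U"
    by (simp add: U e_idem)
  \<comment> \<open>Evaluation at \<open>e\<close>, applied to the map whose coordinates are
    \<open>c\<close>.\<close>
  define \<epsilon> where "\<epsilon> = (\<lambda>c\<in>carrier (cut M'). from_coords K M c e)"
  have cutM': "c \<in> carrier (cut M') \<longleftrightarrow> c \<in> coord_space K M \<and> from_coords K M c \<triangleleft>\<^bsub>M\<^esub> e = from_coords K M c" for c
    using ft(4)[of c] ft(3)[OF act_closed[OF from_cl[of c] e_closed]]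
    by (auto simp: M'(1,5))
  \<comment> \<open>A map fixed by \<open>e\<close> satisfies \<open>g x = g (e x)\<close>, and
    \<open>e x\<close> lies in the corner, so \<open>g\<close> is determined by
    \<open>g e\<close>.\<close>
  have fix_e: "g x = g e \<triangleleft>\<^bsub>N\<^esub> r" if "g \<in> carrier M" "g \<triangleleft>\<^bsub>M\<^esub> e = g" "x \<in> carrier U" "r \<in> carrier R" "\<iota> r = e \<otimes>\<^bsub>S\<^esub> x"
    for g x r
  proof -
    have "g x = g (e \<otimes>\<^bsub>S\<^esub> x)"
      using fun_cong[OF that(2), of x] that(3) by (simp add: M(5))
    also have "\<dots> = g (e \<otimes>\<^bsub>S\<^esub> \<iota> r)"
      using that by (simp add: e_iota flip: that(5))
    also have "\<dots> = g e \<triangleleft>\<^bsub>N\<^esub> r"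
      using that(1,4) eU by (simp add: M(1))
    finally show ?thesis .
  qed
  have hom: "\<epsilon> \<in> carrier (module_hom K R (cut M') N)"
    unfolding module_hom_simps
  proof (intro conjI ballI linear_mapI)
    interpret cut: fd_right_module K R "cut M'"
      by (rule fd_right_module_cut[OF fd_M'])
    have M_L: "g \<in> carrier L" if "g \<in> carrier M" for g
      using that by (simp add: M(1))
    show "\<epsilon> c \<in> carrier N" if "c \<in> carrier (cut M')" for c
      using that cutM' g_cl[OF M_L eU] from_cl by (simp add: \<epsilon>_def)
    show "\<epsilon> (c \<oplus>\<^bsub>cut M'\<^esub> d) = \<epsilon> c \<oplus>\<^bsub>N\<^esub> \<epsilon> d" if "c \<in> carrier (cut M')" "d \<in> carrier (cut M')" for c d
    proof -
      have "from_coords K M (c \<oplus>\<^bsub>cut M'\<^esub> d) = from_coords K M c \<oplus>\<^bsub>M\<^esub> from_coords K M d"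
        using that cutM' from_cl by (simp add: M'(3) ft(3))
      then show ?thesis
        using that cut.a_closed[OF that] eU by (simp add: \<epsilon>_def M(3) L_simps(3) del: cut_simps)
    qed
    show "\<epsilon> (k \<odot>\<^bsub>cut M'\<^esub> c) = k \<odot>\<^bsub>N\<^esub> \<epsilon> c" if "k \<in> carrier K" "c \<in> carrier (cut M')" for k c
    proof -
      have "from_coords K M (k \<odot>\<^bsub>cut M'\<^esub> c) = k \<odot>\<^bsub>M\<^esub> from_coords K M c"
        using that cutM' from_cl by (simp add: M'(4) ft(3))
      then show ?thesis
        using that cut.smult_closed[OF that] eU by (simp add: \<epsilon>_def M(4) L_simps(4) del: cut_simps)
    qed
    show "\<epsilon> (c \<triangleleft>\<^bsub>cut M'\<^esub> r) = \<epsilon> c \<triangleleft>\<^bsub>N\<^esub> r" if "c \<in> carrier (cut M')" "r \<in> carrier R" for c r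
    proof -
      have c: "c \<in> coord_space K M" "from_coords K M c \<triangleleft>\<^bsub>M\<^esub> e = from_coords K M c"
        using that cutM' by auto
      have "from_coords K M (c \<triangleleft>\<^bsub>cut M'\<^esub> r) = from_coords K M c \<triangleleft>\<^bsub>M\<^esub> \<iota> r"
        using that c from_cl by (simp add: M'(5) ft(3) act_closed)
      moreover have "(from_coords K M c \<triangleleft>\<^bsub>M\<^esub> \<iota> r) e = from_coords K M c (\<iota> r)"
        using that eU by (simp add: M(5) e_iota)
      moreover have "from_coords K M c (\<iota> r) = from_coords K M c e \<triangleleft>\<^bsub>N\<^esub> r"
        using that by (intro fix_e from_cl c) (simp_all add: U e_iota)
      ultimately show ?thesis
        using that cut.act_closed[OF that] by (simp add: \<epsilon>_def del: cut_simps)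
    qed
  qed (simp add: \<epsilon>_def)
  have "bij_betw \<epsilon> (carrier (cut M')) (carrier N)"
  proof (rule bij_betw_imageI)
    show "inj_on \<epsilon> (carrier (cut M'))"
    proof (rule inj_onI)
      fix c d assume c: "c \<in> carrier (cut M')" and d: "d \<in> carrier (cut M')" and eq: "\<epsilon> c = \<epsilon> d"
      have c': "from_coords K M c \<in> carrier M" "from_coords K M c \<triangleleft>\<^bsub>M\<^esub> e = from_coords K M c"
        and d': "from_coords K M d \<in> carrier M" "from_coords K M d \<triangleleft>\<^bsub>M\<^esub> e = from_coords K M d"
        using c d cutM' from_cl by auto
      have "from_coords K M c = from_coords K M d"
      proof (rule extensionalityI[where A = "carrier U"])
        fix x assume x: "x \<in> carrier U"
        obtain r where r: "r \<in> carrier R" "\<iota> r = e \<otimes>\<^bsub>S\<^esub> x"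
          using corner_iota[OF e_closed _ e_idem, of x] x by (auto simp: U)
        have "from_coords K M c e = from_coords K M d e"
          using eq c d by (simp add: \<epsilon>_def del: cut_simps)
        then show "from_coords K M c x = from_coords K M d x"
          using fix_e[OF c' x r] fix_e[OF d' x r] by simp
      qed (use c' d' in \<open>simp_all add: M(1) L_simps(1)\<close>)
      then show "c = d"
        using c d ft(4) cutM' by metis
    qed
    have "y \<in> \<epsilon> ` carrier (cut M')" if y: "y \<in> carrier N" for y
    proof -
      \<comment> \<open>\<open>\<rho> x\<close> is the element of \<open>R\<close> that corresponds
        to \<open>e x\<close> in the corner.\<close>
      define \<rho> where "\<rho> x = the_inv_into (carrier R) \<iota> (e \<otimes>\<^bsub>S\<^esub> x)" for x
      have \<rho>: "\<rho> x \<in> carrier R" "\<iota> (\<rho> x) = e \<otimes>\<^bsub>S\<^esub> x" if "x \<in> carrier U" for x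
      proof -
        have "e \<otimes>\<^bsub>S\<^esub> x \<in> \<iota> ` carrier R"
          using corner_iota[OF e_closed _ e_idem, of x] that by (metis U(1) imageI)
        then show "\<rho> x \<in> carrier R" "\<iota> (\<rho> x) = e \<otimes>\<^bsub>S\<^esub> x"
          unfolding \<rho>_def using the_inv_into_into[OF iota_inj _ subset_refl] f_the_inv_into_f[OF iota_inj] by auto
      qed
      have \<rho>_eqI: "\<rho> x = r" if "x \<in> carrier U" "r \<in> carrier R" "\<iota> r = e \<otimes>\<^bsub>S\<^esub> x" for x r
        using \<rho>[OF that(1)] that iota_inj by (auto simp: inj_on_def)
      have U_add: "x \<oplus>\<^bsub>S\<^esub> z \<in> carrier U" if "x \<in> carrier U" "z \<in> carrier U" for x z
        using that by (simp add: U S.l_distr)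
      have U_smult: "k \<odot>\<^bsub>S\<^esub> x \<in> carrier U" if "k \<in> carrier K" "x \<in> carrier U" for x k
        using that by (simp add: U S.smult_mult_left)
      have US: "x \<in> carrier S" if "x \<in> carrier U" for x
        using that by (simp add: U)
      have \<rho>_add: "\<rho> (x \<oplus>\<^bsub>S\<^esub> z) = \<rho> x \<oplus>\<^bsub>R\<^esub> \<rho> z" if "x \<in> carrier U" "z \<in> carrier U" for x z
        using that by (intro \<rho>_eqI) (simp_all add: U_add \<rho> linear_map_add[OF iota_linear] S.r_distr US)
      have \<rho>_smult: "\<rho> (k \<odot>\<^bsub>S\<^esub> x) = k \<odot>\<^bsub>R\<^esub> \<rho> x" if "k \<in> carrier K" "x \<in> carrier U" for x k
        using that by (intro \<rho>_eqI) (simp_all add: U_smult \<rho> linear_map_smult[OF iota_linear] S.smult_mult_right US)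
      have \<rho>_mult: "\<rho> (x \<otimes>\<^bsub>S\<^esub> \<iota> r) = \<rho> x \<otimes>\<^bsub>R\<^esub> r" if "x \<in> carrier U" "r \<in> carrier R" for x r
        using that by (intro \<rho>_eqI) (simp_all add: Ui \<rho> iota_mult S.m_assoc US)
      have \<rho>_e: "\<rho> (e \<otimes>\<^bsub>S\<^esub> x) = \<rho> x" if "x \<in> carrier U" for x
        using that by (intro \<rho>_eqI) (simp_all add: sU \<rho> US e_idem flip: S.m_assoc)
      \<comment> \<open>The map with \<open>g e = y\<close>; \<open>fix_e\<close> leaves no other
        choice.\<close>
      define g where "g = (\<lambda>x\<in>carrier U. y \<triangleleft>\<^bsub>N\<^esub> \<rho> x)"
      have "linear_map K U N (\<lambda>x. y \<triangleleft>\<^bsub>N\<^esub> \<rho> x)"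
        using y by (intro linear_mapI)
          (simp_all add: U(3,4) N.act_closed \<rho> \<rho>_add \<rho>_smult N.act_r_distr N.act_smult_right)
      then have g: "g \<in> carrier M"
        using y by (auto simp: M(1) L_simps(1) g_def linear_map_restrict[OF mod_U] Ui \<rho>_mult N.act_assoc \<rho>)
      have ge: "g \<triangleleft>\<^bsub>M\<^esub> e = g"
        by (auto simp: M(5) g_def sU \<rho>_e)
      have "\<rho> e = \<one>\<^bsub>R\<^esub>"
        by (rule \<rho>_eqI) (simp_all add: eU iota_one e_idem)
      then have "g e = y"
        using eU y by (simp add: g_def N.act_one)
      moreover have "to_coords K M g \<in> carrier (cut M')"
        unfolding cutM' using to_cl[OF g] ft(3)[OF g] ge by simp
      ultimately show ?thesis
        by (intro image_eqI[of _ _ "to_coords K M g"]) (simp_all add: \<epsilon>_def ft(3)[OF g] del: cut_simps)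
    qed
    then show "\<epsilon> ` carrier (cut M') = carrier N"
      using hom by (auto simp: module_hom_simps linear_map_def Pi_iff simp del: cut_simps)
  qed
  then have "is_iso_in (mod_cat K R) (cut M') N \<epsilon>"
    by (rule is_iso_in_mod_cat_if_bij[OF fd_right_module_cut[OF fd_M'] N hom])
  with fd_M' show ?thesis by blast
qed

lemma Morita_equivalent_corner: "Morita_equivalent K S R"
  unfolding Morita_equivalent_def
proof (rule equivalent_categories_if_fully_faithful[OF linear_cat_mod_cat linear_cat_mod_cat cut_functor_linear])
  show "bij_betw (hom_map cut_functor X Y) (carrier (Hom (mod_cat K S) X Y))
     (carrier (Hom (mod_cat K R) (obj_map cut_functor X) (obj_map cut_functor Y)))"
    if "X \<in> Obj (mod_cat K S)" "Y \<in> Obj (mod_cat K S)" for X Y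
    using cut_functor_fully_faithful[of X Y] that by (simp add: cut_functor_def)
  show "\<exists>X\<in>Obj (mod_cat K S). \<exists>\<epsilon>. is_iso_in (mod_cat K R) (obj_map cut_functor X) Y \<epsilon>"
    if "Y \<in> Obj (mod_cat K R)" for Y
    using cut_functor_essentially_surjective[of Y] that by (auto simp: cut_functor_def)
qed

end

section \<open>Matrices over a graded algebra\<close>

lemma (in abelian_monoid) finsum_swap:
  assumes "finite A" "finite B" "\<And>a b. \<lbrakk>a \<in> A; b \<in> B\<rbrakk> \<Longrightarrow> f a b \<in> carrier G"
  shows "(\<Oplus>a\<in>A. \<Oplus>b\<in>B. f a b) = (\<Oplus>b\<in>B. \<Oplus>a\<in>A. f a b)"
  using assms(1,3)
proof (induction A)
  case empty
  then show ?case by (simp add: finsum_zero)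
next
  case (insert x A)
  have "(\<Oplus>b\<in>B. \<Oplus>a\<in>insert x A. f a b) = (\<Oplus>b\<in>B. f x b \<oplus> (\<Oplus>a\<in>A. f a b))"
    using insert by (intro finsum_cong') (auto simp: finsum_insert Pi_iff)
  also have "\<dots> = (\<Oplus>b\<in>B. f x b) \<oplus> (\<Oplus>b\<in>B. \<Oplus>a\<in>A. f a b)"
    using insert by (intro finsum_addf) (auto simp: Pi_iff)
  finally show ?case
    using insert by (subst finsum_insert) (auto simp: Pi_iff)
qed

lemma (in abelian_monoid) finsum_delta:
  assumes "finite A" "a \<in> A" "f a \<in> carrier G"
  shows "(\<Oplus>i\<in>A. if i = a then f i else \<zero>) = f a"
proof -
  have "(\<Oplus>i\<in>A. if i = a then f i else \<zero>) = (\<Oplus>i\<in>A. if a = i then f a else \<zero>)"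
    using assms by (intro finsum_cong') auto
  then show ?thesis
    using assms finsum_singleton[of a A "\<lambda>i. f a"] by simp
qed

text \<open>\<open>piece i j\<close> contains the entries admitted at a matrix position whose row has level \<open>i\<close> and
  whose column has level \<open>j\<close>. Levels are assigned to row and column indices by functions, so that
  several indices may share a level.\<close>

locale graded_algebra =
  K: field K + E: fd_algebra K E
  for K :: "('k, 'z) ring_scheme" (structure) and E :: "('k, 'a, 'e) module_scheme" +
  fixes piece :: "nat \<Rightarrow> nat \<Rightarrow> 'a set"
  assumes piece_subset: "piece i j \<subseteq> carrier E"
    and piece_zero [simp]: "\<zero>\<^bsub>E\<^esub> \<in> piece i j"
    and piece_add: "\<lbrakk>x \<in> piece i j; y \<in> piece i j\<rbrakk> \<Longrightarrow> x \<oplus>\<^bsub>E\<^esub> y \<in> piece i j"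
    and piece_smult: "\<lbrakk>k \<in> carrier K; x \<in> piece i j\<rbrakk> \<Longrightarrow> k \<odot>\<^bsub>E\<^esub> x \<in> piece i j"
    and piece_one [simp]: "\<one>\<^bsub>E\<^esub> \<in> piece i i"
    and piece_mult: "\<lbrakk>x \<in> piece i j; y \<in> piece j l\<rbrakk> \<Longrightarrow> x \<otimes>\<^bsub>E\<^esub> y \<in> piece i l"
begin

lemma piece_closed: "x \<in> piece i j \<Longrightarrow> x \<in> carrier E"
  using piece_subset by blast

lemma piece_finsum:
  assumes "\<And>l. l \<in> L \<Longrightarrow> f l \<in> piece i j"
  shows "(\<Oplus>\<^bsub>E\<^esub>l\<in>L. f l) \<in> piece i j"
proof (cases "finite L")
  case True
  then show ?thesis
    using assms
  proof (induction L)
    case (insert l L)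
    then show ?case
      by (subst E.finsum_insert) (auto simp: Pi_iff intro!: piece_add piece_closed[of _ i j])
  qed (simp add: E.finsum_empty)
qed (simp add: E.finsum_infinite)

definition mats :: "nat set \<Rightarrow> (nat \<Rightarrow> nat) \<Rightarrow> nat set \<Rightarrow> (nat \<Rightarrow> nat) \<Rightarrow> (nat \<times> nat \<Rightarrow> 'a) set" where
  "mats I u J w = (\<Pi>\<^sub>E p\<in>I \<times> J. piece (u (fst p)) (w (snd p)))"

definition mmul :: "nat set \<Rightarrow> nat set \<Rightarrow> nat set \<Rightarrow> (nat \<times> nat \<Rightarrow> 'a) \<Rightarrow> (nat \<times> nat \<Rightarrow> 'a) \<Rightarrow> nat \<times> nat \<Rightarrow> 'a" where
  "mmul I J L X Y = (\<lambda>(i, j)\<in>I \<times> L. \<Oplus>\<^bsub>E\<^esub>l\<in>J. X (i, l) \<otimes>\<^bsub>E\<^esub> Y (l, j))"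

text \<open>One record covers rectangular matrices and, when rows and columns share their indices
  and levels, the algebra \<open>mat_alg\<close>; \<open>mult\<close> and \<open>one\<close> are
  meant for the square case.\<close>

definition mat_space ::
    "nat set \<Rightarrow> (nat \<Rightarrow> nat) \<Rightarrow> nat set \<Rightarrow> (nat \<Rightarrow> nat) \<Rightarrow> ('k, nat \<times> nat \<Rightarrow> 'a) module" where
  "mat_space I u J w =
     \<lparr>carrier = mats I u J w, mult = mmul I J J,
      one = (\<lambda>(i, j)\<in>I \<times> J. if i = j then \<one>\<^bsub>E\<^esub> else \<zero>\<^bsub>E\<^esub>),
      zero = (\<lambda>p\<in>I \<times> J. \<zero>\<^bsub>E\<^esub>),
      add = (\<lambda>X Y. \<lambda>p\<in>I \<times> J. X p \<oplus>\<^bsub>E\<^esub> Y p),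
      smult = (\<lambda>k X. \<lambda>p\<in>I \<times> J. k \<odot>\<^bsub>E\<^esub> X p)\<rparr>"

abbreviation mat_alg :: "nat set \<Rightarrow> (nat \<Rightarrow> nat) \<Rightarrow> ('k, nat \<times> nat \<Rightarrow> 'a) module" where
  "mat_alg I u \<equiv> mat_space I u I u"

definition single :: "nat set \<Rightarrow> nat set \<Rightarrow> nat \<Rightarrow> nat \<Rightarrow> 'a \<Rightarrow> nat \<times> nat \<Rightarrow> 'a" where
  "single I J i j x = (\<lambda>p\<in>I \<times> J. if p = (i, j) then x else \<zero>\<^bsub>E\<^esub>)"

lemma mat_space_simps [simp]:
  "carrier (mat_space I u J w) = mats I u J w"
  "X \<otimes>\<^bsub>mat_space I u J w\<^esub> Y = mmul I J J X Y"
  "\<one>\<^bsub>mat_space I u J w\<^esub> = (\<lambda>(i, j)\<in>I \<times> J. if i = j then \<one>\<^bsub>E\<^esub> else \<zero>\<^bsub>E\<^esub>)"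
  "\<zero>\<^bsub>mat_space I u J w\<^esub> = (\<lambda>p\<in>I \<times> J. \<zero>\<^bsub>E\<^esub>)"
  "X \<oplus>\<^bsub>mat_space I u J w\<^esub> Y = (\<lambda>p\<in>I \<times> J. X p \<oplus>\<^bsub>E\<^esub> Y p)"
  "k \<odot>\<^bsub>mat_space I u J w\<^esub> X = (\<lambda>p\<in>I \<times> J. k \<odot>\<^bsub>E\<^esub> X p)"
  by (simp_all add: mat_space_def)

lemma mats_piece: "\<lbrakk>X \<in> mats I u J w; i \<in> I; j \<in> J\<rbrakk> \<Longrightarrow> X (i, j) \<in> piece (u i) (w j)"
  by (force simp: mats_def PiE_def Pi_iff)

lemma mats_closed: "\<lbrakk>X \<in> mats I u J w; i \<in> I; j \<in> J\<rbrakk> \<Longrightarrow> X (i, j) \<in> carrier E"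
  by (rule piece_closed[OF mats_piece])

lemma mats_extensional: "X \<in> mats I u J w \<Longrightarrow> X \<in> extensional (I \<times> J)"
  by (auto simp: mats_def PiE_def)

lemma mats_eqI:
  assumes "X \<in> extensional (I \<times> J)" "Y \<in> extensional (I \<times> J)"
    and "\<And>i j. \<lbrakk>i \<in> I; j \<in> J\<rbrakk> \<Longrightarrow> X (i, j) = Y (i, j)"
  shows "X = Y"
  using assms by (intro extensionalityI[of X "I \<times> J" Y]) auto

lemma restrict_mats: "(\<lambda>p\<in>I \<times> J. f p) \<in> mats I u J w \<longleftrightarrow> (\<forall>i\<in>I. \<forall>j\<in>J. f (i, j) \<in> piece (u i) (w j))"
  by (auto simp: mats_def PiE_def Pi_iff)

lemma mmul_apply: "\<lbrakk>i \<in> I; j \<in> L\<rbrakk> \<Longrightarrow> mmul I J L X Y (i, j) = (\<Oplus>\<^bsub>E\<^esub>l\<in>J. X (i, l) \<otimes>\<^bsub>E\<^esub> Y (l, j))"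
  by (simp add: mmul_def)

lemma mmul_extensional: "mmul I J L X Y \<in> extensional (I \<times> L)"
  by (simp add: mmul_def)

lemma mmul_closed:
  "\<lbrakk>X \<in> mats I u J v; Y \<in> mats J v L w\<rbrakk> \<Longrightarrow> mmul I J L X Y \<in> mats I u L w"
  unfolding mmul_def restrict_mats by (auto intro!: piece_finsum piece_mult mats_piece)

lemma mmul_assoc:
  assumes "finite J" "finite L" "X \<in> mats I u J v" "Y \<in> mats J v L w" "Z \<in> mats L w M s"
  shows "mmul I L M (mmul I J L X Y) Z = mmul I J M X (mmul J L M Y Z)"
proof (rule mats_eqI[where I = I and J = M])
  fix i j assume i: "i \<in> I" and j: "j \<in> M"
  note X = mats_closed[OF assms(3) i] and Y = mats_closed[OF assms(4)] and Z = mats_closed[OF assms(5) _ j]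
  have "mmul I L M (mmul I J L X Y) Z (i, j) =
      (\<Oplus>\<^bsub>E\<^esub>b\<in>L. (\<Oplus>\<^bsub>E\<^esub>a\<in>J. X (i, a) \<otimes>\<^bsub>E\<^esub> Y (a, b)) \<otimes>\<^bsub>E\<^esub> Z (b, j))"
    unfolding mmul_apply[OF i j] using X Y Z i
    by (intro E.finsum_cong') (auto simp: mmul_apply Pi_iff intro!: E.finsum_closed E.m_closed)
  also have "\<dots> = (\<Oplus>\<^bsub>E\<^esub>b\<in>L. \<Oplus>\<^bsub>E\<^esub>a\<in>J. X (i, a) \<otimes>\<^bsub>E\<^esub> Y (a, b) \<otimes>\<^bsub>E\<^esub> Z (b, j))"
    using X Y Z assms(1) by (intro E.finsum_cong') (auto simp: Pi_iff E.finsum_ldistr intro!: E.finsum_closed)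
  also have "\<dots> = (\<Oplus>\<^bsub>E\<^esub>b\<in>L. \<Oplus>\<^bsub>E\<^esub>a\<in>J. X (i, a) \<otimes>\<^bsub>E\<^esub> (Y (a, b) \<otimes>\<^bsub>E\<^esub> Z (b, j)))"
    using X Y Z by (intro E.finsum_cong') (auto simp: Pi_iff E.m_assoc intro!: E.finsum_closed E.finsum_cong')
  also have "\<dots> = (\<Oplus>\<^bsub>E\<^esub>a\<in>J. \<Oplus>\<^bsub>E\<^esub>b\<in>L. X (i, a) \<otimes>\<^bsub>E\<^esub> (Y (a, b) \<otimes>\<^bsub>E\<^esub> Z (b, j)))"
    using X Y Z assms(1,2) by (intro E.finsum_swap) auto
  also have "\<dots> = (\<Oplus>\<^bsub>E\<^esub>a\<in>J. X (i, a) \<otimes>\<^bsub>E\<^esub> (\<Oplus>\<^bsub>E\<^esub>b\<in>L. Y (a, b) \<otimes>\<^bsub>E\<^esub> Z (b, j)))"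
  proof (rule E.finsum_cong'[OF refl])
    show "(\<Oplus>\<^bsub>E\<^esub>b\<in>L. X (i, a) \<otimes>\<^bsub>E\<^esub> (Y (a, b) \<otimes>\<^bsub>E\<^esub> Z (b, j))) =
        X (i, a) \<otimes>\<^bsub>E\<^esub> (\<Oplus>\<^bsub>E\<^esub>b\<in>L. Y (a, b) \<otimes>\<^bsub>E\<^esub> Z (b, j))" if a: "a \<in> J" for a
    proof -
      have "X (i, a) \<in> carrier E"
        using assms(3) i a by (rule mats_closed)
      then show ?thesis
        using Y Z assms(2) a by (intro E.finsum_rdistr[symmetric]) (auto simp: Pi_iff)
    qed
    show "(\<lambda>a. X (i, a) \<otimes>\<^bsub>E\<^esub> (\<Oplus>\<^bsub>E\<^esub>b\<in>L. Y (a, b) \<otimes>\<^bsub>E\<^esub> Z (b, j))) \<in> J \<rightarrow> carrier E"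
      using mats_closed[OF assms(3) i] Y Z by (auto intro!: E.finsum_closed)
  qed
  also have "\<dots> = mmul I J M X (mmul J L M Y Z) (i, j)"
    using X Y Z j by (auto simp: mmul_apply[OF i j] mmul_apply[OF _ j] intro!: E.finsum_cong' E.finsum_closed
        mats_closed[OF assms(3) i])
  finally show "mmul I L M (mmul I J L X Y) Z (i, j) = mmul I J M X (mmul J L M Y Z) (i, j)" .
qed (simp_all add: mmul_extensional)

lemma mmul_add_left:
  assumes "X \<in> mats I u J v" "X' \<in> mats I u J v" "Y \<in> mats J v L w"
  shows "mmul I J L (\<lambda>p\<in>I \<times> J. X p \<oplus>\<^bsub>E\<^esub> X' p) Y = (\<lambda>p\<in>I \<times> L. mmul I J L X Y p \<oplus>\<^bsub>E\<^esub> mmul I J L X' Y p)"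
proof (rule mats_eqI[where I = I and J = L])
  fix i j assume i: "i \<in> I" and j: "j \<in> L"
  note cl = mats_closed[OF assms(1) i] mats_closed[OF assms(2) i] mats_closed[OF assms(3) _ j]
  show "mmul I J L (\<lambda>p\<in>I \<times> J. X p \<oplus>\<^bsub>E\<^esub> X' p) Y (i, j) =
      (\<lambda>p\<in>I \<times> L. mmul I J L X Y p \<oplus>\<^bsub>E\<^esub> mmul I J L X' Y p) (i, j)"
    using i j cl by (auto simp: mmul_apply E.l_distr Pi_iff simp flip: E.finsum_addf intro!: E.finsum_cong')
qed (simp_all add: mmul_extensional)

lemma mmul_add_right:
  assumes "X \<in> mats I u J v" "Y \<in> mats J v L w" "Y' \<in> mats J v L w"
  shows "mmul I J L X (\<lambda>p\<in>J \<times> L. Y p \<oplus>\<^bsub>E\<^esub> Y' p) = (\<lambda>p\<in>I \<times> L. mmul I J L X Y p \<oplus>\<^bsub>E\<^esub> mmul I J L X Y' p)"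
proof (rule mats_eqI[where I = I and J = L])
  fix i j assume i: "i \<in> I" and j: "j \<in> L"
  note cl = mats_closed[OF assms(1) i] mats_closed[OF assms(2) _ j] mats_closed[OF assms(3) _ j]
  show "mmul I J L X (\<lambda>p\<in>J \<times> L. Y p \<oplus>\<^bsub>E\<^esub> Y' p) (i, j) =
      (\<lambda>p\<in>I \<times> L. mmul I J L X Y p \<oplus>\<^bsub>E\<^esub> mmul I J L X Y' p) (i, j)"
    using i j cl by (auto simp: mmul_apply E.r_distr Pi_iff simp flip: E.finsum_addf intro!: E.finsum_cong')
qed (simp_all add: mmul_extensional)

lemma mmul_smult:
  assumes "finite J" "k \<in> carrier K" "X \<in> mats I u J v" "Y \<in> mats J v L w"
  shows "mmul I J L (\<lambda>p\<in>I \<times> J. k \<odot>\<^bsub>E\<^esub> X p) Y = (\<lambda>p\<in>I \<times> L. k \<odot>\<^bsub>E\<^esub> mmul I J L X Y p)"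
    and "mmul I J L X (\<lambda>p\<in>J \<times> L. k \<odot>\<^bsub>E\<^esub> Y p) = (\<lambda>p\<in>I \<times> L. k \<odot>\<^bsub>E\<^esub> mmul I J L X Y p)"
proof -
  have entry: "mmul I J L (\<lambda>p\<in>I \<times> J. k \<odot>\<^bsub>E\<^esub> X p) Y (i, j) = k \<odot>\<^bsub>E\<^esub> mmul I J L X Y (i, j)"
      "mmul I J L X (\<lambda>p\<in>J \<times> L. k \<odot>\<^bsub>E\<^esub> Y p) (i, j) = k \<odot>\<^bsub>E\<^esub> mmul I J L X Y (i, j)"
    if i: "i \<in> I" and j: "j \<in> L" for i j
  proof -
    note cl = mats_closed[OF assms(3) i] mats_closed[OF assms(4) _ j]
    have s: "k \<odot>\<^bsub>E\<^esub> mmul I J L X Y (i, j) = (\<Oplus>\<^bsub>E\<^esub>l\<in>J. k \<odot>\<^bsub>E\<^esub> (X (i, l) \<otimes>\<^bsub>E\<^esub> Y (l, j)))"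
      unfolding mmul_apply[OF i j] using cl assms(1,2) by (intro E.finsum_smult_ldistr) auto
    show "mmul I J L (\<lambda>p\<in>I \<times> J. k \<odot>\<^bsub>E\<^esub> X p) Y (i, j) = k \<odot>\<^bsub>E\<^esub> mmul I J L X Y (i, j)"
      "mmul I J L X (\<lambda>p\<in>J \<times> L. k \<odot>\<^bsub>E\<^esub> Y p) (i, j) = k \<odot>\<^bsub>E\<^esub> mmul I J L X Y (i, j)"
      unfolding s unfolding mmul_apply[OF i j] using i j cl assms(2)
      by (auto simp: E.smult_mult_left E.smult_mult_right intro!: E.finsum_cong')
  qed
  show "mmul I J L (\<lambda>p\<in>I \<times> J. k \<odot>\<^bsub>E\<^esub> X p) Y = (\<lambda>p\<in>I \<times> L. k \<odot>\<^bsub>E\<^esub> mmul I J L X Y p)"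
    "mmul I J L X (\<lambda>p\<in>J \<times> L. k \<odot>\<^bsub>E\<^esub> Y p) = (\<lambda>p\<in>I \<times> L. k \<odot>\<^bsub>E\<^esub> mmul I J L X Y p)"
    by (rule mats_eqI[where I = I and J = L]; simp add: mmul_extensional entry)+
qed

lemma mmul_zero:
  assumes "X \<in> mats I u J w"
  shows "mmul L I J (\<lambda>p\<in>L \<times> I. \<zero>\<^bsub>E\<^esub>) X = (\<lambda>p\<in>L \<times> J. \<zero>\<^bsub>E\<^esub>)"
    and "mmul I J L X (\<lambda>p\<in>J \<times> L. \<zero>\<^bsub>E\<^esub>) = (\<lambda>p\<in>I \<times> L. \<zero>\<^bsub>E\<^esub>)"
  using mats_closed[OF assms]
  by (auto simp: mmul_def intro!: restrict_ext E.add.finprod_one_eqI)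

lemma mmul_one:
  assumes "X \<in> mats I u J w"
  shows "finite I \<Longrightarrow> mmul I I J \<one>\<^bsub>mat_alg I u\<^esub> X = X"
    and "finite J \<Longrightarrow> mmul I J J X \<one>\<^bsub>mat_alg J w\<^esub> = X"
proof -
  show "mmul I I J \<one>\<^bsub>mat_alg I u\<^esub> X = X" if "finite I"
  proof (rule mats_eqI[OF mmul_extensional mats_extensional[OF assms]])
    fix i j assume i: "i \<in> I" and j: "j \<in> J"
    note cl = mats_closed[OF assms _ j]
    have "mmul I I J \<one>\<^bsub>mat_alg I u\<^esub> X (i, j) = (\<Oplus>\<^bsub>E\<^esub>l\<in>I. if l = i then X (l, j) else \<zero>\<^bsub>E\<^esub>)"
      unfolding mmul_apply[OF i j] using i cl by (intro E.finsum_cong') auto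
    then show "mmul I I J \<one>\<^bsub>mat_alg I u\<^esub> X (i, j) = X (i, j)"
      using E.finsum_delta[OF that i, of "\<lambda>l. X (l, j)"] cl i by simp
  qed
  show "mmul I J J X \<one>\<^bsub>mat_alg J w\<^esub> = X" if "finite J"
  proof (rule mats_eqI[OF mmul_extensional mats_extensional[OF assms]])
    fix i j assume i: "i \<in> I" and j: "j \<in> J"
    note cl = mats_closed[OF assms i]
    have "mmul I J J X \<one>\<^bsub>mat_alg J w\<^esub> (i, j) = (\<Oplus>\<^bsub>E\<^esub>l\<in>J. if l = j then X (i, l) else \<zero>\<^bsub>E\<^esub>)"
      unfolding mmul_apply[OF i j] using j cl by (intro E.finsum_cong') auto
    then show "mmul I J J X \<one>\<^bsub>mat_alg J w\<^esub> (i, j) = X (i, j)"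
      using E.finsum_delta[OF that j, of "\<lambda>l. X (i, l)"] cl j by simp
  qed
qed

lemma module_mat_space: "module K (mat_space I u J w)"
proof -
  have K: "cring K" ..
  note cl = mats_closed mats_piece piece_add piece_smult
  show ?thesis
  proof (rule moduleI_smult[OF K], unfold mat_space_simps)
    fix X assume X: "X \<in> mats I u J w"
    have eqI: "restrict f (I \<times> J) = X" if "\<And>i j. \<lbrakk>i \<in> I; j \<in> J\<rbrakk> \<Longrightarrow> f (i, j) = X (i, j)" for f
      using that mats_extensional[OF X] by (intro mats_eqI[where I = I and J = J]) auto
    show "(\<lambda>p\<in>I \<times> J. (\<lambda>p\<in>I \<times> J. \<zero>\<^bsub>E\<^esub>) p \<oplus>\<^bsub>E\<^esub> X p) = X" "(\<lambda>p\<in>I \<times> J. \<one> \<odot>\<^bsub>E\<^esub> X p) = X"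
      by (rule eqI; simp add: mats_closed[OF X])+
    show "(\<lambda>p\<in>I \<times> J. \<zero> \<odot>\<^bsub>E\<^esub> X p) = (\<lambda>p\<in>I \<times> J. \<zero>\<^bsub>E\<^esub>)"
      using mats_closed[OF X] by (auto intro!: restrict_ext)
  qed (auto simp: restrict_mats mats_closed E.M.a_ac E.smult_l_distr E.smult_r_distr E.smult_assoc1
      intro!: restrict_ext piece_add piece_smult mats_piece[of _ I u J w])
qed

lemma finite_dimensional_mat_space:
  assumes "finite I" "finite J"
  shows "finite_dimensional K (mat_space I u J w)"
proof (rule finite_dimensional_if_separated_by_maps[OF K.field_axioms module_mat_space E.module_axioms E.finite_dim])
  show "finite ((\<lambda>p X. X p :: 'a) ` (I \<times> J))"
    using assms by simp
  show "linear_map K (mat_space I u J w) E f" if "f \<in> (\<lambda>p X. X p) ` (I \<times> J)" for f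
    using that by (auto simp: linear_map_def mats_closed)
  show "X = \<zero>\<^bsub>mat_space I u J w\<^esub>"
    if "X \<in> carrier (mat_space I u J w)" "\<And>f. f \<in> (\<lambda>p X. X p) ` (I \<times> J) \<Longrightarrow> f X = \<zero>\<^bsub>E\<^esub>" for X
    using that by (intro mats_eqI[where I = I and J = J]) (auto simp: mats_extensional)
qed

lemma fd_algebra_mat_alg:
  assumes "finite I"
  shows "fd_algebra K (mat_alg I u)"
proof -
  have m: "module K (mat_alg I u)"
    by (rule module_mat_space)
  have "monoid (mat_alg I u)"
  proof (rule monoidI)
    show "\<one>\<^bsub>mat_alg I u\<^esub> \<in> carrier (mat_alg I u)"
      by (auto simp: restrict_mats case_prod_beta)
  qed (auto simp: mmul_closed mmul_assoc[OF assms assms] mmul_one(1)[OF _ assms, simplified]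
      mmul_one(2)[OF _ assms, simplified])
  then have "ring (mat_alg I u)"
    by (intro ringI module.axioms(2)[OF m])
      (simp_all add: mmul_add_left mmul_add_right)
  then show ?thesis
    by (intro fd_algebra.intro fd_algebra_axioms.intro m finite_dimensional_mat_space assms)
      (simp_all add: mmul_smult assms)
qed

lemma single_closed: "x \<in> piece (u i) (w j) \<Longrightarrow> single I J i j x \<in> mats I u J w"
  by (auto simp: single_def restrict_mats)

lemma single_apply: "\<lbrakk>a \<in> I; b \<in> J\<rbrakk> \<Longrightarrow> single I J i j x (a, b) = (if a = i \<and> b = j then x else \<zero>\<^bsub>E\<^esub>)"
  by (simp add: single_def)

text \<open>The positions are filled in one after the other while the rest is still zero. Additive
  statements are thus reduced to matrices with a single nonzero entry.\<close>

lemma mats_induct [consumes 3, case_names zero single add]: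
  assumes "finite I" "finite J" "X \<in> mats I u J w"
    and "P (\<lambda>p\<in>I \<times> J. \<zero>\<^bsub>E\<^esub>)"
    and "\<And>i j x. \<lbrakk>i \<in> I; j \<in> J; x \<in> piece (u i) (w j)\<rbrakk> \<Longrightarrow> P (single I J i j x)"
    and "\<And>X Y. \<lbrakk>X \<in> mats I u J w; Y \<in> mats I u J w; P X; P Y\<rbrakk> \<Longrightarrow> P (\<lambda>p\<in>I \<times> J. X p \<oplus>\<^bsub>E\<^esub> Y p)"
  shows "P X"
proof -
  have "P (\<lambda>p\<in>I \<times> J. if p \<in> S then X p else \<zero>\<^bsub>E\<^esub>)" if "finite S" "S \<subseteq> I \<times> J" for S
    using that
  proof (induction S)
    case empty
    have "(\<lambda>p\<in>I \<times> J. if p \<in> {} then X p else \<zero>\<^bsub>E\<^esub>) = (\<lambda>p\<in>I \<times> J. \<zero>\<^bsub>E\<^esub>)"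
      by (rule restrict_ext) simp
    then show ?case using assms(4) by (simp only:)
  next
    case (insert q S)
    obtain i j where q: "q = (i, j)" "i \<in> I" "j \<in> J"
      using insert by auto
    define Y where "Y = (\<lambda>p\<in>I \<times> J. if p \<in> S then X p else \<zero>\<^bsub>E\<^esub>)"
    have Y: "Y \<in> mats I u J w"
      unfolding Y_def restrict_mats using mats_piece[OF assms(3)] by auto
    have x: "X (i, j) \<in> piece (u i) (w j)"
      using assms(3) q by (simp add: mats_piece)
    have "P (\<lambda>p\<in>I \<times> J. single I J i j (X (i, j)) p \<oplus>\<^bsub>E\<^esub> Y p)"
      using insert.IH insert.prems x q Y by (intro assms(6) single_closed assms(5)) (simp_all flip: Y_def)
    moreover have "(\<lambda>p\<in>I \<times> J. single I J i j (X (i, j)) p \<oplus>\<^bsub>E\<^esub> Y p) =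
        (\<lambda>p\<in>I \<times> J. if p \<in> insert q S then X p else \<zero>\<^bsub>E\<^esub>)"
      using insert mats_closed[OF assms(3)] by (intro restrict_ext) (auto simp: single_def Y_def q)
    ultimately show ?case by (simp only:)
  qed
  from this[of "I \<times> J"] have "P (\<lambda>p\<in>I \<times> J. if p \<in> I \<times> J then X p else \<zero>\<^bsub>E\<^esub>)"
    using assms(1,2) by simp
  also have "(\<lambda>p\<in>I \<times> J. if p \<in> I \<times> J then X p else \<zero>\<^bsub>E\<^esub>) = X"
    using mats_extensional[OF assms(3)] by (intro mats_eqI[where I = I and J = J]) auto
  finally show ?thesis .
qed

lemma mmul_single_right:
  assumes "finite J" "X \<in> mats I u J w" "a \<in> J" "b \<in> L" "x \<in> carrier E" "i \<in> I" "j \<in> L"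
  shows "mmul I J L X (single J L a b x) (i, j) = (if j = b then X (i, a) \<otimes>\<^bsub>E\<^esub> x else \<zero>\<^bsub>E\<^esub>)"
proof -
  note cl = mats_closed[OF assms(2,6)]
  have "mmul I J L X (single J L a b x) (i, j) =
      (\<Oplus>\<^bsub>E\<^esub>l\<in>J. if l = a then (if j = b then X (i, l) \<otimes>\<^bsub>E\<^esub> x else \<zero>\<^bsub>E\<^esub>) else \<zero>\<^bsub>E\<^esub>)"
    unfolding mmul_apply[OF assms(6,7)] using assms(5,7) cl
    by (intro E.finsum_cong') (auto simp: single_apply)
  then show ?thesis
    using E.finsum_delta[OF assms(1,3), of "\<lambda>l. if j = b then X (i, l) \<otimes>\<^bsub>E\<^esub> x else \<zero>\<^bsub>E\<^esub>"] cl assms(3,5)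
    by simp
qed

lemma mmul_single_single:
  assumes "finite J" "i \<in> I" "a \<in> J" "b \<in> L" "x \<in> carrier E" "y \<in> carrier E"
  shows "mmul I J L (single I J i a x) (single J L a b y) = single I L i b (x \<otimes>\<^bsub>E\<^esub> y)"
proof (rule mats_eqI[where I = I and J = L])
  fix p q assume p: "p \<in> I" and q: "q \<in> L"
  have "mmul I J L (single I J i a x) (single J L a b y) (p, q) =
      (\<Oplus>\<^bsub>E\<^esub>l\<in>J. if l = a then (if p = i \<and> q = b then x \<otimes>\<^bsub>E\<^esub> y else \<zero>\<^bsub>E\<^esub>) else \<zero>\<^bsub>E\<^esub>)"
    unfolding mmul_apply[OF p q] using assms p q by (intro E.finsum_cong') (auto simp: single_apply)
  then show "mmul I J L (single I J i a x) (single J L a b y) (p, q) = single I L i b (x \<otimes>\<^bsub>E\<^esub> y) (p, q)"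
    using E.finsum_delta[OF assms(1,3), of "\<lambda>l. if p = i \<and> q = b then x \<otimes>\<^bsub>E\<^esub> y else \<zero>\<^bsub>E\<^esub>"] p q assms
    by (simp add: single_apply)
qed (simp_all add: mmul_extensional single_def)

end

section \<open>Endomorphisms of a space of matrices\<close>

lemma End_algebra_simps:
  "f \<in> carrier (End_algebra K A M) \<longleftrightarrow> linear_map K M M f \<and> f \<in> extensional (carrier M) \<and>
    (\<forall>x\<in>carrier M. \<forall>a\<in>carrier A. f (x \<triangleleft>\<^bsub>M\<^esub> a) = f x \<triangleleft>\<^bsub>M\<^esub> a)"
  "f \<otimes>\<^bsub>End_algebra K A M\<^esub> g = compose (carrier M) f g"
  "\<one>\<^bsub>End_algebra K A M\<^esub> = (\<lambda>x\<in>carrier M. x)"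
  "\<zero>\<^bsub>End_algebra K A M\<^esub> = (\<lambda>x\<in>carrier M. \<zero>\<^bsub>M\<^esub>)"
  "f \<oplus>\<^bsub>End_algebra K A M\<^esub> g = (\<lambda>x\<in>carrier M. f x \<oplus>\<^bsub>M\<^esub> g x)"
  "k \<odot>\<^bsub>End_algebra K A M\<^esub> f = (\<lambda>x\<in>carrier M. k \<odot>\<^bsub>M\<^esub> f x)"
  by (auto simp: End_algebra_def module_hom_def linear_hom_simps)

text \<open>The properties of \<open>A \<oplus> DA\<close> on which the induction step rests. By
  \<open>pairing\<close>, the form \<open>t (y x)\<close> identifies the entries at levels
  \<open>(j + 1, i)\<close> with the dual of those at \<open>(i, j)\<close>, which covers both the
  dual of \<open>A\<close> and the dual of \<open>DA\<close>. The condition \<open>hom_zero\<close>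
  is \<open>Hom_A(DA, A) = 0\<close>. Updating the carrier of \<open>E\<close> to a piece views the
  piece as a vector space.\<close>

locale paired_graded_algebra = graded_algebra K E piece
  for K :: "('k, 'z) ring_scheme" (structure) and E :: "('k, 'a, 'e) module_scheme"
    and piece :: "nat \<Rightarrow> nat \<Rightarrow> 'a set" +
  fixes t :: "'a \<Rightarrow> 'k"
  assumes t_linear: "linear_map K E (ground_space K) t"
    and pairing: "linear_map K (E\<lparr>carrier := piece i j\<rparr>) (ground_space K) \<psi> \<Longrightarrow>
      \<exists>!y. y \<in> piece (Suc j) i \<and> (\<forall>x\<in>piece i j. \<psi> x = t (y \<otimes>\<^bsub>E\<^esub> x))"
    and piece_trivial: "\<lbrakk>i \<noteq> j; i \<noteq> Suc j\<rbrakk> \<Longrightarrow> piece i j = {\<zero>\<^bsub>E\<^esub>}"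
    and hom_zero: "\<lbrakk>linear_map K (E\<lparr>carrier := piece (Suc i) i\<rparr>) (E\<lparr>carrier := piece i i\<rparr>) f;
        \<And>x a. \<lbrakk>x \<in> piece (Suc i) i; a \<in> piece i i\<rbrakk> \<Longrightarrow> f (x \<otimes>\<^bsub>E\<^esub> a) = f x \<otimes>\<^bsub>E\<^esub> a;
        x \<in> piece (Suc i) i\<rbrakk> \<Longrightarrow> f x = \<zero>\<^bsub>E\<^esub>"
begin

lemma pairing_functional:
  assumes "y \<in> carrier E"
  shows "linear_map K (E\<lparr>carrier := piece i j\<rparr>) (ground_space K) (\<lambda>x. t (y \<otimes>\<^bsub>E\<^esub> x))"
proof (rule linear_mapI)
  note cl = piece_closed[of _ i j]
  show "t (y \<otimes>\<^bsub>E\<^esub> x) \<in> carrier (ground_space K)" if "x \<in> carrier (E\<lparr>carrier := piece i j\<rparr>)" for x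
    using that assms cl linear_map_closed[OF t_linear] by simp
  show "t (y \<otimes>\<^bsub>E\<^esub> (x \<oplus>\<^bsub>E\<lparr>carrier := piece i j\<rparr>\<^esub> x')) =
      t (y \<otimes>\<^bsub>E\<^esub> x) \<oplus>\<^bsub>ground_space K\<^esub> t (y \<otimes>\<^bsub>E\<^esub> x')"
    if "x \<in> carrier (E\<lparr>carrier := piece i j\<rparr>)" "x' \<in> carrier (E\<lparr>carrier := piece i j\<rparr>)" for x x'
    using that assms cl by (simp add: E.r_distr linear_map_add[OF t_linear])
  show "t (y \<otimes>\<^bsub>E\<^esub> (k \<odot>\<^bsub>E\<lparr>carrier := piece i j\<rparr>\<^esub> x)) = k \<odot>\<^bsub>ground_space K\<^esub> t (y \<otimes>\<^bsub>E\<^esub> x)"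
    if "k \<in> carrier K" "x \<in> carrier (E\<lparr>carrier := piece i j\<rparr>)" for k x
    using that assms cl by (simp add: E.smult_mult_right linear_map_smult[OF t_linear])
qed

text \<open>Nondegeneracy of the trace form: the uniqueness part of \<open>pairing\<close>, applied
  to the functional that \<open>y\<close> itself defines.\<close>

lemma pairing_unique:
  assumes "y \<in> piece (Suc j) i" "y' \<in> piece (Suc j) i"
    and "\<And>x. x \<in> piece i j \<Longrightarrow> t (y \<otimes>\<^bsub>E\<^esub> x) = t (y' \<otimes>\<^bsub>E\<^esub> x)"
  shows "y = y'"
  using pairing[OF pairing_functional[of y i j]] assms piece_closed by metis

text \<open>The effect of a matrix endomorphism from a row of level \<open>i\<close> to a row of
  level \<open>r\<close> within one column of level \<open>j\<close>; the scalars
  \<open>piece j j\<close> are a copy of \<open>A\<close>.\<close>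

definition right_linear :: "nat \<Rightarrow> nat \<Rightarrow> nat \<Rightarrow> ('a \<Rightarrow> 'a) \<Rightarrow> bool" where
  "right_linear i j r f \<longleftrightarrow> linear_map K (E\<lparr>carrier := piece i j\<rparr>) (E\<lparr>carrier := piece r j\<rparr>) f \<and>
     (\<forall>x\<in>piece i j. \<forall>a\<in>piece j j. f (x \<otimes>\<^bsub>E\<^esub> a) = f x \<otimes>\<^bsub>E\<^esub> a)"

lemma right_linear_closed: "\<lbrakk>right_linear i j r f; x \<in> piece i j\<rbrakk> \<Longrightarrow> f x \<in> piece r j"
  by (auto simp: right_linear_def linear_map_def)

text \<open>For \<open>r = i + 1\<close> the functional \<open>x \<mapsto> t (f x)\<close> is represented by an element \<open>X\<close>, and
  \<open>t (f x a) = t (X x a)\<close> for all \<open>a\<close> forces \<open>f x = X x\<close>.\<close>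

lemma right_linear_is_left_mult:
  assumes f: "right_linear i j r f" and i: "i = j \<or> i = Suc j \<and> r \<le> i"
  shows "\<exists>!X. X \<in> piece r i \<and> (\<forall>x\<in>piece i j. f x = X \<otimes>\<^bsub>E\<^esub> x)"
  using i
proof (elim disjE conjE)
  \<comment> \<open>The piece contains 1, and \<open>f\<close> is left multiplication by the image
    of 1.\<close>
  assume ij: "i = j"
  have cl: "f \<one>\<^bsub>E\<^esub> \<in> piece r j"
    using right_linear_closed[OF f] ij by simp
  show ?thesis
  proof (rule ex1I)
    have "f x = f \<one>\<^bsub>E\<^esub> \<otimes>\<^bsub>E\<^esub> x" if "x \<in> piece j j" for x
    proof -
      have "f (\<one>\<^bsub>E\<^esub> \<otimes>\<^bsub>E\<^esub> x) = f \<one>\<^bsub>E\<^esub> \<otimes>\<^bsub>E\<^esub> x"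
        using f that ij by (simp only: right_linear_def piece_one)
      then show ?thesis
        using piece_closed[OF that] by simp
    qed
    then show "f \<one>\<^bsub>E\<^esub> \<in> piece r i \<and> (\<forall>x\<in>piece i j. f x = f \<one>\<^bsub>E\<^esub> \<otimes>\<^bsub>E\<^esub> x)"
      using cl ij by blast
    show "X = f \<one>\<^bsub>E\<^esub>" if X: "X \<in> piece r i \<and> (\<forall>x\<in>piece i j. f x = X \<otimes>\<^bsub>E\<^esub> x)" for X
    proof -
      have "f \<one>\<^bsub>E\<^esub> = X \<otimes>\<^bsub>E\<^esub> \<one>\<^bsub>E\<^esub>"
        using X ij by simp
      then show ?thesis
        using X piece_closed[of X r i] by simp
    qed
  qed
next
  assume i: "i = Suc j" and r: "r \<le> i"
  show ?thesis
  proof (cases "r = i")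
    case True
    \<comment> \<open>Here \<open>r = i = j + 1\<close>: \<open>f\<close> is an endomorphism of
      \<open>DA\<close>, and the element \<open>X\<close> lies in \<open>A\<close>.\<close>
    note lin = f[unfolded right_linear_def, THEN conjunct1]
    have tf: "linear_map K (E\<lparr>carrier := piece i j\<rparr>) (ground_space K) (\<lambda>x. t (f x))"
    proof -
      have "linear_map K (E\<lparr>carrier := piece i j\<rparr>) E f"
        using lin True piece_closed unfolding linear_map_def by auto
      then show ?thesis
        by (rule linear_map_compose[OF t_linear])
    qed
    obtain X where X: "X \<in> piece (Suc j) i" and tX: "\<And>x. x \<in> piece i j \<Longrightarrow> t (f x) = t (X \<otimes>\<^bsub>E\<^esub> x)"
      using pairing[OF tf] by blast
    have "f x = X \<otimes>\<^bsub>E\<^esub> x" if x: "x \<in> piece i j" for x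
    proof (rule pairing_unique[of _ j j])
      show "f x \<in> piece (Suc j) j"
        using right_linear_closed[OF f x] True i by simp
      show "X \<otimes>\<^bsub>E\<^esub> x \<in> piece (Suc j) j"
        using piece_mult[OF X x] .
      fix a assume a: "a \<in> piece j j"
      have "t (f x \<otimes>\<^bsub>E\<^esub> a) = t (f (x \<otimes>\<^bsub>E\<^esub> a))"
        using f x a by (simp add: right_linear_def)
      also have "\<dots> = t (X \<otimes>\<^bsub>E\<^esub> (x \<otimes>\<^bsub>E\<^esub> a))"
        by (rule tX[OF piece_mult[OF x a]])
      finally show "t (f x \<otimes>\<^bsub>E\<^esub> a) = t (X \<otimes>\<^bsub>E\<^esub> x \<otimes>\<^bsub>E\<^esub> a)"
        using X x a by (simp add: E.m_assoc piece_closed)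
    qed
    moreover have "X' = X" if "X' \<in> piece r i" "\<forall>x\<in>piece i j. f x = X' \<otimes>\<^bsub>E\<^esub> x" for X'
      by (rule pairing_unique[of _ j i]) (use that True i X tX in \<open>auto simp flip: tX\<close>)
    ultimately show ?thesis
      using X True i by blast
  next
    case False
    then have r: "r \<le> j"
      using r i by simp
    have 0: "piece r i = {\<zero>\<^bsub>E\<^esub>}"
      using piece_trivial[of r i] r i by simp
    have "f x = \<zero>\<^bsub>E\<^esub>" if x: "x \<in> piece i j" for x
    proof (cases "r = j")
      case True
      show ?thesis
        by (rule hom_zero[of j]) (use f x i True in \<open>auto simp: right_linear_def\<close>)
    next
      case False
      then show ?thesis
        using piece_trivial[of r j] right_linear_closed[OF f x] r by auto
    qed
    then show ?thesis
      by (intro ex1I[of _ "\<zero>\<^bsub>E\<^esub>"]) (auto simp: 0 piece_closed)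
  qed
qed

text \<open>Every entry in row \<open>p\<close> is an entry in one fixed column \<open>q p\<close>
  times a factor on the right. By right linearity only the maps from position
  \<open>(p, q p)\<close> to the positions \<open>(r, q p)\<close> matter, and
  \<open>right_linear_is_left_mult\<close> turns each of them into one entry
  \<open>X (r, p)\<close>.\<close>

lemma right_linear_matrix_map_is_left_mult:
  assumes fin: "finite I" "finite J" and w: "w ` J = {..m}" and u: "u ` I \<subseteq> {..Suc m}"
    and g: "linear_map K (mat_space I u J w) (mat_space I u J w) g"
    and gb: "\<And>Y b. \<lbrakk>Y \<in> mats I u J w; b \<in> mats J w J w\<rbrakk> \<Longrightarrow> g (mmul I J J Y b) = mmul I J J (g Y) b"
  shows "\<exists>!X. X \<in> mats I u I u \<and> (\<forall>Y\<in>mats I u J w. g Y = mmul I I J X Y)"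
proof -
  \<comment> \<open>The column chosen for row \<open>p\<close> has the level of the row, except that
    rows of level \<open>m + 1\<close> take level \<open>m\<close>, the highest level of a
    column.\<close>
  have "\<forall>p\<in>I. \<exists>q\<in>J. w q = min (u p) m"
  proof
    fix p assume "p \<in> I"
    have "min (u p) m \<in> w ` J"
      using w by simp
    then show "\<exists>q\<in>J. w q = min (u p) m"
      by fastforce
  qed
  then obtain q where q: "\<And>p. p \<in> I \<Longrightarrow> q p \<in> J" "\<And>p. p \<in> I \<Longrightarrow> w (q p) = min (u p) m"
    by metis
  have level: "u p = w (q p) \<or> u p = Suc (w (q p)) \<and> u r \<le> u p" if "p \<in> I" "r \<in> I" for p r
    using q(2)[OF that(1)] u that by (fastforce simp: min_def image_subset_iff split: if_splits)
  \<comment> \<open>Up to level \<open>m\<close> the first factor is 1. On level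
    \<open>m + 1\<close> the second factor is 1 in columns of level \<open>m\<close>, and the entry
    is zero elsewhere.\<close>
  have factor: "\<exists>y\<in>piece (u p) (w (q p)). \<exists>z\<in>piece (w (q p)) (w j). x = y \<otimes>\<^bsub>E\<^esub> z"
    if p: "p \<in> I" and j: "j \<in> J" and x: "x \<in> piece (u p) (w j)" for p j x
  proof (cases "u p \<le> m")
    case True
    then show ?thesis
      using q(2)[OF p] x piece_closed[OF x] piece_one[of "u p"] by (metis E.l_one min.absorb1)
  next
    case False
    then have up: "u p = Suc m" "w (q p) = m"
      using u p q(2)[OF p] by (force simp: image_subset_iff)+
    have wj: "w j \<le> m"
      using w j by auto
    show ?thesis
    proof (cases "w j = m")
      case True
      then show ?thesis
        using up x piece_closed[OF x] piece_one[of m] by (metis E.r_one)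
    next
      case False
      then have "x = \<zero>\<^bsub>E\<^esub>"
        using piece_trivial[of "Suc m" "w j"] up wj x by auto
      then show ?thesis
        using piece_zero by (metis E.l_null E.zero_closed)
    qed
  qed
  \<comment> \<open>What \<open>g\<close> makes, in row \<open>r\<close>, of an entry in row
    \<open>p\<close>; both are read in column \<open>q p\<close>.\<close>
  define f where "f r p x = g (single I J p (q p) x) (r, q p)" for r p x
  have g_cl: "g Y \<in> mats I u J w" if "Y \<in> mats I u J w" for Y
    using linear_map_closed[OF g] that by simp
  have f: "right_linear (u p) (w (q p)) (u r) (f r p)" if p: "p \<in> I" and r: "r \<in> I" for r p
  proof -
    have s: "single I J p (q p) x \<in> mats I u J w" if "x \<in> piece (u p) (w (q p))" for x
      using that by (rule single_closed)
    note qJ = q(1)[OF p]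
    show ?thesis
      unfolding right_linear_def
    proof (intro conjI linear_mapI ballI)
      fix x y assume x: "x \<in> carrier (E\<lparr>carrier := piece (u p) (w (q p))\<rparr>)"
      then have x': "x \<in> piece (u p) (w (q p))" by simp
      show "f r p x \<in> carrier (E\<lparr>carrier := piece (u r) (w (q p))\<rparr>)"
        unfolding f_def using mats_piece[OF g_cl[OF s[OF x']] r qJ] by simp
      assume "y \<in> carrier (E\<lparr>carrier := piece (u p) (w (q p))\<rparr>)"
      then have y': "y \<in> piece (u p) (w (q p))" by simp
      have "single I J p (q p) (x \<oplus>\<^bsub>E\<^esub> y) = (\<lambda>z\<in>I \<times> J. single I J p (q p) x z \<oplus>\<^bsub>E\<^esub> single I J p (q p) y z)"
        by (auto simp: single_def)
      then show "f r p (x \<oplus>\<^bsub>E\<lparr>carrier := piece (u p) (w (q p))\<rparr>\<^esub> y) =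
          f r p x \<oplus>\<^bsub>E\<lparr>carrier := piece (u r) (w (q p))\<rparr>\<^esub> f r p y"
        using linear_map_add[OF g, of "single I J p (q p) x" "single I J p (q p) y"] s x' y' r qJ
        by (simp add: f_def)
    next
      fix k x assume k: "k \<in> carrier K" and "x \<in> carrier (E\<lparr>carrier := piece (u p) (w (q p))\<rparr>)"
      then have x': "x \<in> piece (u p) (w (q p))" by simp
      have "single I J p (q p) (k \<odot>\<^bsub>E\<^esub> x) = (\<lambda>z\<in>I \<times> J. k \<odot>\<^bsub>E\<^esub> single I J p (q p) x z)"
        using k by (auto simp: single_def)
      then show "f r p (k \<odot>\<^bsub>E\<lparr>carrier := piece (u p) (w (q p))\<rparr>\<^esub> x) =
          k \<odot>\<^bsub>E\<lparr>carrier := piece (u r) (w (q p))\<rparr>\<^esub> f r p x"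
        using linear_map_smult[OF g k, of "single I J p (q p) x"] s x' r qJ by (simp add: f_def)
    next
      fix x a assume x: "x \<in> piece (u p) (w (q p))" and a: "a \<in> piece (w (q p)) (w (q p))"
      have "single I J p (q p) (x \<otimes>\<^bsub>E\<^esub> a) =
          mmul I J J (single I J p (q p) x) (single J J (q p) (q p) a)"
        using fin p qJ x a by (simp add: mmul_single_single piece_closed)
      then have "g (single I J p (q p) (x \<otimes>\<^bsub>E\<^esub> a)) =
          mmul I J J (g (single I J p (q p) x)) (single J J (q p) (q p) a)"
        using gb[OF s[OF x] single_closed[of a w "q p" w "q p" J J]] a by simp
      then show "f r p (x \<otimes>\<^bsub>E\<^esub> a) = f r p x \<otimes>\<^bsub>E\<^esub> a"
        using mmul_single_right[OF fin(2) g_cl[OF s[OF x]] qJ qJ piece_closed[OF a] r qJ] by (simp add: f_def)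
    qed
  qed
  have ex1: "\<exists>!X. X \<in> piece (u r) (u p) \<and> (\<forall>x\<in>piece (u p) (w (q p)). f r p x = X \<otimes>\<^bsub>E\<^esub> x)"
    if "p \<in> I" "r \<in> I" for r p
    by (rule right_linear_is_left_mult[OF f[OF that] level[OF that]])
  define X where "X = (\<lambda>z\<in>I \<times> I. THE X. X \<in> piece (u (fst z)) (u (snd z)) \<and>
      (\<forall>x\<in>piece (u (snd z)) (w (q (snd z))). f (fst z) (snd z) x = X \<otimes>\<^bsub>E\<^esub> x))"
  have X: "X (r, p) \<in> piece (u r) (u p)" "\<And>x. x \<in> piece (u p) (w (q p)) \<Longrightarrow> f r p x = X (r, p) \<otimes>\<^bsub>E\<^esub> x"
    if "p \<in> I" "r \<in> I" for r p
  proof -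
    have eq: "X (r, p) = (THE X. X \<in> piece (u r) (u p) \<and> (\<forall>x\<in>piece (u p) (w (q p)). f r p x = X \<otimes>\<^bsub>E\<^esub> x))"
      using that by (simp add: X_def)
    show "X (r, p) \<in> piece (u r) (u p)" "\<And>x. x \<in> piece (u p) (w (q p)) \<Longrightarrow> f r p x = X (r, p) \<otimes>\<^bsub>E\<^esub> x"
      using theI'[OF ex1[OF that], folded eq] by blast+
  qed
  have "restrict X (I \<times> I) \<in> mats I u I u"
    using X(1) by (simp add: restrict_mats)
  moreover have "restrict X (I \<times> I) = X"
    by (simp add: X_def)
  ultimately have Xm: "X \<in> mats I u I u"
    by simp
  have gX: "g Y = mmul I I J X Y" if "Y \<in> mats I u J w" for Y
    using fin(1,2) that
  proof (induction rule: mats_induct)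
    case zero
    note mmul_zero(2)[OF Xm]
    moreover have "g (\<lambda>p\<in>I \<times> J. \<zero>\<^bsub>E\<^esub>) = (\<lambda>p\<in>I \<times> J. \<zero>\<^bsub>E\<^esub>)"
      using linear_map_zero[OF module_mat_space module_mat_space g] by simp
    ultimately show ?case by (simp only:)
  next
    case (single p j x)
    obtain y z where y: "y \<in> piece (u p) (w (q p))" and z: "z \<in> piece (w (q p)) (w j)" and x: "x = y \<otimes>\<^bsub>E\<^esub> z"
      using factor[OF single] by blast
    note qJ = q(1)[OF single(1)]
    have s: "single I J p (q p) y \<in> mats I u J w"
      using y by (rule single_closed)
    have "single I J p j x = mmul I J J (single I J p (q p) y) (single J J (q p) j z)"
      using fin single(1,2) qJ y z by (simp add: mmul_single_single piece_closed x)
    then have gs: "g (single I J p j x) = mmul I J J (g (single I J p (q p) y)) (single J J (q p) j z)"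
      using gb[OF s single_closed[of z w "q p" w j J J]] z by simp
    show ?case
    proof (rule mats_eqI[where I = I and J = J])
      fix r j' assume r: "r \<in> I" and j': "j' \<in> J"
      have "X (r, p) \<otimes>\<^bsub>E\<^esub> y = g (single I J p (q p) y) (r, q p)"
        using X(2)[OF single(1) r y] by (simp add: f_def)
      then have "g (single I J p (q p) y) (r, q p) \<otimes>\<^bsub>E\<^esub> z = X (r, p) \<otimes>\<^bsub>E\<^esub> x"
        using X(1)[OF single(1) r] y z by (simp add: x E.m_assoc[symmetric] piece_closed)
      then show "g (single I J p j x) (r, j') = mmul I I J X (single I J p j x) (r, j')"
        using mmul_single_right[OF fin(2) g_cl[OF s] qJ single(2) piece_closed[OF z] r j']
          mmul_single_right[OF fin(1) Xm single(1,2) piece_closed[OF single(3)] r j'] by (simp add: gs)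
    qed (simp_all add: gs mmul_extensional)
  next
    case (add Y Z)
    then show ?case
      using linear_map_add[OF g, of Y Z] by (simp only: mat_space_simps mmul_add_right[OF Xm add(1,2)])
  qed
  show ?thesis
  proof (rule ex1I[of _ X])
    show "X \<in> mats I u I u \<and> (\<forall>Y\<in>mats I u J w. g Y = mmul I I J X Y)"
      using Xm gX by blast
    fix X' assume X': "X' \<in> mats I u I u \<and> (\<forall>Y\<in>mats I u J w. g Y = mmul I I J X' Y)"
    show "X' = X"
    proof (rule mats_eqI)
      fix r p assume r: "r \<in> I" and p: "p \<in> I"
      have "f r p x = X' (r, p) \<otimes>\<^bsub>E\<^esub> x" if x: "x \<in> piece (u p) (w (q p))" for x
      proof -
        have "f r p x = mmul I I J X' (single I J p (q p) x) (r, q p)"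
          unfolding f_def using X' single_closed[of x u p w "q p" I J] x by simp
        then show ?thesis
          using mmul_single_right[OF fin(1) X'[THEN conjunct1] p q(1)[OF p] piece_closed[OF x] r q(1)[OF p]] by simp
      qed
      then show "X' (r, p) = X (r, p)"
        using ex1[OF p r] X[OF p r] mats_piece[OF X'[THEN conjunct1] r p] by blast
    qed (use Xm X' in \<open>auto intro: mats_extensional\<close>)
  qed
qed

text \<open>The isomorphisms \<open>T\<close> and \<open>\<theta>\<close> carry the description of
  endomorphisms as left multiplications over to a module \<open>M\<close> that only resembles a
  space of matrices. The matrix \<open>X\<close> acts on \<open>M\<close> as left multiplication by
  \<open>X\<close> between \<open>T\<close> inverse and \<open>T\<close>.\<close>

lemma End_algebra_iso:
  fixes M :: "('k, 's, 'm) right_module" and S :: "('k, 's, 'f) module_scheme"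
  assumes fin: "finite I" "finite J" and w: "w ` J = {..m}" and u: "u ` I \<subseteq> {..Suc m}"
    and \<theta>: "alg_iso K (mat_alg J w) S \<theta>"
    and bij: "bij_betw T (mats I u J w) (carrier M)"
    and lin: "linear_map K (mat_space I u J w) M T"
    and T0: "T (\<lambda>p\<in>I \<times> J. \<zero>\<^bsub>E\<^esub>) = \<zero>\<^bsub>M\<^esub>"
    and act: "\<And>Y b. \<lbrakk>Y \<in> mats I u J w; b \<in> mats J w J w\<rbrakk> \<Longrightarrow> T (mmul I J J Y b) = T Y \<triangleleft>\<^bsub>M\<^esub> \<theta> b"
  shows "alg_iso K (mat_alg I u) (End_algebra K S M)
    (\<lambda>X. \<lambda>x\<in>carrier M. T (mmul I I J X (the_inv_into (mats I u J w) T x)))"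
proof -
  define V where "V = mats I u J w"
  define T' where "T' = the_inv_into V T"
  have im: "carrier M = T ` V" and inj: "inj_on T V"
    using bij by (auto simp: bij_betw_def V_def)
  have T'T: "T' (T Y) = Y" if "Y \<in> V" for Y
    unfolding T'_def by (rule the_inv_into_f_f[OF inj that])
  have S: "carrier S = \<theta> ` mats J w J w"
    using alg_isoD(1)[OF \<theta>] by (auto simp: bij_betw_def)
  have add: "T Y \<oplus>\<^bsub>M\<^esub> T Z = T (\<lambda>p\<in>I \<times> J. Y p \<oplus>\<^bsub>E\<^esub> Z p)" if "Y \<in> V" "Z \<in> V" for Y Z
    using linear_map_add[OF lin, of Y Z] that by (simp add: V_def)
  have smult: "k \<odot>\<^bsub>M\<^esub> T Y = T (\<lambda>p\<in>I \<times> J. k \<odot>\<^bsub>E\<^esub> Y p)" if "k \<in> carrier K" "Y \<in> V" for k Y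
    using linear_map_smult[OF lin, of k Y] that by (simp add: V_def)
  note Vm = module_mat_space[of I u J w]
  interpret V: module K "mat_space I u J w" by (rule Vm)
  have V_add: "(\<lambda>p\<in>I \<times> J. Y p \<oplus>\<^bsub>E\<^esub> Z p) \<in> V" if "Y \<in> V" "Z \<in> V" for Y Z
    using V.a_closed[of Y Z] that by (simp add: V_def)
  have V_smult: "(\<lambda>p\<in>I \<times> J. k \<odot>\<^bsub>E\<^esub> Y p) \<in> V" if "k \<in> carrier K" "Y \<in> V" for k Y
    using V.smult_closed[of k Y] that by (simp add: V_def)
  have V_mmul: "mmul I I J X Y \<in> V" if "X \<in> mats I u I u" "Y \<in> V" for X Y
    using that mmul_closed unfolding V_def by blast
  have V_mmul_right: "mmul I J J Y b \<in> V" if "Y \<in> V" "b \<in> mats J w J w" for Y b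
    using that mmul_closed unfolding V_def by blast
  define \<Lambda> where "\<Lambda> X = (\<lambda>x\<in>carrier M. T (mmul I I J X (T' x)))" for X
  have \<Lambda>T: "\<Lambda> X (T Y) = T (mmul I I J X Y)" if "Y \<in> V" for X Y
    using that by (simp add: \<Lambda>_def im T'T)
  have \<Lambda>_eqI: "\<Lambda> X = h" if "h \<in> extensional (carrier M)" "\<And>Y. Y \<in> V \<Longrightarrow> T (mmul I I J X Y) = h (T Y)" for X h
    by (rule extensionalityI[of _ "carrier M"]) (use that in \<open>auto simp: \<Lambda>T im, auto simp: \<Lambda>_def im\<close>)
  have XA: "mmul I I J X (\<lambda>p\<in>I \<times> J. Y p \<oplus>\<^bsub>E\<^esub> Z p) = (\<lambda>p\<in>I \<times> J. mmul I I J X Y p \<oplus>\<^bsub>E\<^esub> mmul I I J X Z p)"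
    if "X \<in> mats I u I u" "Y \<in> V" "Z \<in> V" for X Y Z
    using that unfolding V_def by (rule mmul_add_right)
  have XS: "mmul I I J X (\<lambda>p\<in>I \<times> J. k \<odot>\<^bsub>E\<^esub> Y p) = (\<lambda>p\<in>I \<times> J. k \<odot>\<^bsub>E\<^esub> mmul I I J X Y p)"
    if "k \<in> carrier K" "X \<in> mats I u I u" "Y \<in> V" for k X Y
    using fin(1) that unfolding V_def by (rule mmul_smult(2))
  have XM: "mmul I I J X (mmul I J J Y b) = mmul I J J (mmul I I J X Y) b"
    if "X \<in> mats I u I u" "Y \<in> V" "b \<in> mats J w J w" for X Y b
    using fin that unfolding V_def by (rule mmul_assoc[symmetric])
  have closed: "\<Lambda> X \<in> carrier (End_algebra K S M)" if X: "X \<in> mats I u I u" for X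
    unfolding End_algebra_simps
  proof (intro conjI ballI linear_mapI)
    show "\<Lambda> X \<in> extensional (carrier M)"
      by (simp add: \<Lambda>_def)
    fix x assume "x \<in> carrier M"
    then obtain Y where Y: "Y \<in> V" "x = T Y"
      by (auto simp: im)
    show "\<Lambda> X x \<in> carrier M"
      using X Y by (auto simp: \<Lambda>T im V_mmul)
    show "\<Lambda> X (k \<odot>\<^bsub>M\<^esub> x) = k \<odot>\<^bsub>M\<^esub> \<Lambda> X x" if "k \<in> carrier K" for k
      using X Y that by (simp add: \<Lambda>T smult V_mmul V_smult XS)
    show "\<Lambda> X (x \<triangleleft>\<^bsub>M\<^esub> a) = \<Lambda> X x \<triangleleft>\<^bsub>M\<^esub> a" if "a \<in> carrier S" for a
    proof -
      obtain b where b: "b \<in> mats J w J w" "a = \<theta> b"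
        using \<open>a \<in> carrier S\<close> by (auto simp: S)
      show ?thesis
        using X Y b by (simp add: \<Lambda>T act[folded V_def, symmetric] V_mmul V_mmul_right XM)
    qed
    show "\<Lambda> X (x \<oplus>\<^bsub>M\<^esub> y) = \<Lambda> X x \<oplus>\<^bsub>M\<^esub> \<Lambda> X y" if "y \<in> carrier M" for y
    proof -
      obtain Z where "Z \<in> V" "y = T Z"
        using \<open>y \<in> carrier M\<close> by (auto simp: im)
      then show ?thesis
        using X Y by (simp add: \<Lambda>T add V_mmul V_add XA)
    qed
  qed
  note ex1 = right_linear_matrix_map_is_left_mult[OF fin w u]
  have inj_\<Lambda>: "X = X'" if X: "X \<in> mats I u I u" "X' \<in> mats I u I u" "\<Lambda> X = \<Lambda> X'" for X X'
  proof -
    have "mmul I I J X Y = mmul I I J X' Y" if "Y \<in> V" for Y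
      using \<Lambda>T[OF that, of X] \<Lambda>T[OF that, of X'] X that V_mmul inj by (auto simp: inj_on_def)
    \<comment> \<open>The uniqueness part, applied to left multiplication by \<open>X\<close>, gives
      injectivity.\<close>
    moreover have "\<exists>!Z. Z \<in> mats I u I u \<and> (\<forall>Y\<in>mats I u J w. mmul I I J X Y = mmul I I J Z Y)"
      using X by (intro ex1) (auto simp: linear_map_def V_def[symmetric] V_mmul XA XS XM)
    then obtain Z where "\<And>W. W \<in> mats I u I u \<Longrightarrow> \<forall>Y\<in>mats I u J w. mmul I I J X Y = mmul I I J W Y \<Longrightarrow> W = Z"
      by (elim ex1E) blast
    ultimately show ?thesis
      using X(1,2) unfolding V_def by metis
  qed
  have surj_\<Lambda>: "\<exists>X\<in>mats I u I u. \<Lambda> X = h" if h: "h \<in> carrier (End_algebra K S M)" for h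
  proof -
    \<comment> \<open>The endomorphism \<open>h\<close> read on matrices.\<close>
    define g where "g Y = T' (h (T Y))" for Y
    have Tg: "T (g Y) = h (T Y)" "g Y \<in> V" if "Y \<in> V" for Y
    proof -
      have "h (T Y) \<in> T ` V"
        using h that by (auto simp: End_algebra_simps linear_map_def im)
      then show "T (g Y) = h (T Y)" "g Y \<in> V"
        unfolding g_def T'_def using inj by (auto simp: f_the_inv_into_f the_inv_into_into)
    qed
    have g_eqI: "g Y = Z" if "Y \<in> V" "Z \<in> V" "T Z = h (T Y)" for Y Z
      unfolding g_def that(3)[symmetric] by (rule T'T[OF that(2)])
    have h_add: "h (T Y \<oplus>\<^bsub>M\<^esub> T Z) = h (T Y) \<oplus>\<^bsub>M\<^esub> h (T Z)" if "Y \<in> V" "Z \<in> V" for Y Z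
      using h that by (simp add: End_algebra_simps linear_map_def im)
    have h_smult: "h (k \<odot>\<^bsub>M\<^esub> T Y) = k \<odot>\<^bsub>M\<^esub> h (T Y)" if "k \<in> carrier K" "Y \<in> V" for Y k
      using h that by (simp add: End_algebra_simps linear_map_def im)
    have h_act: "h (T Y \<triangleleft>\<^bsub>M\<^esub> \<theta> b) = h (T Y) \<triangleleft>\<^bsub>M\<^esub> \<theta> b" if "Y \<in> V" "b \<in> mats J w J w" for Y b
      using h that by (simp add: End_algebra_simps im S)
    have "linear_map K (mat_space I u J w) (mat_space I u J w) g"
    proof (rule linear_mapI, unfold mat_space_simps V_def[symmetric])
      show "g (\<lambda>p\<in>I \<times> J. Y p \<oplus>\<^bsub>E\<^esub> Z p) = (\<lambda>p\<in>I \<times> J. g Y p \<oplus>\<^bsub>E\<^esub> g Z p)" if "Y \<in> V" "Z \<in> V" for Y Z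
        using that by (intro g_eqI) (simp_all add: V_add Tg h_add flip: add)
      show "g (\<lambda>p\<in>I \<times> J. k \<odot>\<^bsub>E\<^esub> Y p) = (\<lambda>p\<in>I \<times> J. k \<odot>\<^bsub>E\<^esub> g Y p)" if "k \<in> carrier K" "Y \<in> V" for Y k
        using that by (intro g_eqI) (simp_all add: V_smult Tg h_smult flip: smult)
    qed (rule Tg)
    moreover have "g (mmul I J J Y b) = mmul I J J (g Y) b" if "Y \<in> mats I u J w" "b \<in> mats J w J w" for Y b
      using that by (intro g_eqI) (simp_all add: V_mmul_right Tg h_act act flip: V_def)
    ultimately obtain X where X: "X \<in> mats I u I u" "\<And>Y. Y \<in> mats I u J w \<Longrightarrow> g Y = mmul I I J X Y"
      using ex1[of g] by blast
    have "\<Lambda> X = h"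
      by (rule \<Lambda>_eqI) (use h X Tg in \<open>auto simp: End_algebra_simps V_def[symmetric] simp flip: X(2)\<close>)
    with X(1) show ?thesis by blast
  qed
  have "bij_betw \<Lambda> (mats I u I u) (carrier (End_algebra K S M))"
    using closed inj_\<Lambda> surj_\<Lambda> by (auto simp: bij_betw_def inj_on_def image_iff) (metis)
  moreover have "linear_map K (mat_alg I u) (End_algebra K S M) \<Lambda>"
  proof (rule linear_mapI, unfold mat_space_simps End_algebra_simps(2-))
    fix X Y assume X: "X \<in> mats I u I u" and Y: "Y \<in> mats I u I u"
    show "\<Lambda> (\<lambda>p\<in>I \<times> I. X p \<oplus>\<^bsub>E\<^esub> Y p) = (\<lambda>x\<in>carrier M. \<Lambda> X x \<oplus>\<^bsub>M\<^esub> \<Lambda> Y x)"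
    proof (rule \<Lambda>_eqI)
      fix Z assume Z: "Z \<in> V"
      have "mmul I I J (\<lambda>p\<in>I \<times> I. X p \<oplus>\<^bsub>E\<^esub> Y p) Z = (\<lambda>p\<in>I \<times> J. mmul I I J X Z p \<oplus>\<^bsub>E\<^esub> mmul I I J Y Z p)"
        using X Y Z unfolding V_def by (rule mmul_add_left)
      then show "T (mmul I I J (\<lambda>p\<in>I \<times> I. X p \<oplus>\<^bsub>E\<^esub> Y p) Z) = (\<lambda>x\<in>carrier M. \<Lambda> X x \<oplus>\<^bsub>M\<^esub> \<Lambda> Y x) (T Z)"
        using X Y Z by (simp add: im \<Lambda>T add V_mmul)
    qed simp
  next
    fix k X assume k: "k \<in> carrier K" and X: "X \<in> mats I u I u"
    show "\<Lambda> (\<lambda>p\<in>I \<times> I. k \<odot>\<^bsub>E\<^esub> X p) = (\<lambda>x\<in>carrier M. k \<odot>\<^bsub>M\<^esub> \<Lambda> X x)"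
    proof (rule \<Lambda>_eqI)
      fix Z assume Z: "Z \<in> V"
      have "mmul I I J (\<lambda>p\<in>I \<times> I. k \<odot>\<^bsub>E\<^esub> X p) Z = (\<lambda>p\<in>I \<times> J. k \<odot>\<^bsub>E\<^esub> mmul I I J X Z p)"
        using fin(1) k X Z unfolding V_def by (rule mmul_smult(1))
      then show "T (mmul I I J (\<lambda>p\<in>I \<times> I. k \<odot>\<^bsub>E\<^esub> X p) Z) = (\<lambda>x\<in>carrier M. k \<odot>\<^bsub>M\<^esub> \<Lambda> X x) (T Z)"
        using X k Z by (simp add: im \<Lambda>T smult V_mmul)
    qed simp
  qed (rule closed)
  moreover have "\<Lambda> (mmul I I I X Y) = compose (carrier M) (\<Lambda> X) (\<Lambda> Y)"
    if X: "X \<in> mats I u I u" and Y: "Y \<in> mats I u I u" for X Y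
  proof (rule \<Lambda>_eqI)
    fix Z assume Z: "Z \<in> V"
    have "mmul I I J (mmul I I I X Y) Z = mmul I I J X (mmul I I J Y Z)"
      using fin(1) fin(1) X Y Z unfolding V_def by (rule mmul_assoc)
    then show "T (mmul I I J (mmul I I I X Y) Z) = compose (carrier M) (\<Lambda> X) (\<Lambda> Y) (T Z)"
      using X Y Z by (simp add: im \<Lambda>T V_mmul compose_def)
  qed (simp add: compose_def)
  moreover have "\<Lambda> \<one>\<^bsub>mat_alg I u\<^esub> = (\<lambda>x\<in>carrier M. x)"
  proof (rule \<Lambda>_eqI)
    show "T (mmul I I J \<one>\<^bsub>mat_alg I u\<^esub> Z) = (\<lambda>x\<in>carrier M. x) (T Z)" if "Z \<in> V" for Z
      using mmul_one(1)[OF that[unfolded V_def] fin(1)] that by (simp add: im del: mat_space_simps(3))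
  qed simp
  moreover have "\<Lambda> (\<lambda>p\<in>I \<times> I. \<zero>\<^bsub>E\<^esub>) = (\<lambda>x\<in>carrier M. \<zero>\<^bsub>M\<^esub>)"
  proof (rule \<Lambda>_eqI)
    show "T (mmul I I J (\<lambda>p\<in>I \<times> I. \<zero>\<^bsub>E\<^esub>) Z) = (\<lambda>x\<in>carrier M. \<zero>\<^bsub>M\<^esub>) (T Z)" if "Z \<in> V" for Z
      using mmul_zero(1)[OF that[unfolded V_def]] that by (simp add: im T0)
  qed simp
  ultimately show ?thesis
    unfolding alg_iso_def \<Lambda>_def T'_def V_def by (simp add: End_algebra_simps(2-))
qed

end

section \<open>An algebra plus its dual as a space of matrices\<close>

lemma dual_module_simps:
  "carrier (dual_module K A) = carrier (linear_hom K A (ground_space K))"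
  "\<zero>\<^bsub>dual_module K A\<^esub> = \<zero>\<^bsub>linear_hom K A (ground_space K)\<^esub>"
  "\<phi> \<oplus>\<^bsub>dual_module K A\<^esub> \<psi> = \<phi> \<oplus>\<^bsub>linear_hom K A (ground_space K)\<^esub> \<psi>"
  "k \<odot>\<^bsub>dual_module K A\<^esub> \<phi> = k \<odot>\<^bsub>linear_hom K A (ground_space K)\<^esub> \<phi>"
  "\<phi> \<triangleleft>\<^bsub>dual_module K A\<^esub> a = (\<lambda>x\<in>carrier A. \<phi> (a \<otimes>\<^bsub>A\<^esub> x))"
  by (simp_all add: dual_module_def Let_def)

lemma regular_module_simps:
  "carrier (regular_module A) = carrier A" "\<zero>\<^bsub>regular_module A\<^esub> = \<zero>\<^bsub>A\<^esub>"
  "x \<oplus>\<^bsub>regular_module A\<^esub> y = x \<oplus>\<^bsub>A\<^esub> y" "k \<odot>\<^bsub>regular_module A\<^esub> x = k \<odot>\<^bsub>A\<^esub> x"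
  "x \<triangleleft>\<^bsub>regular_module A\<^esub> a = x \<otimes>\<^bsub>A\<^esub> a"
  by (simp_all add: regular_module_def)

lemma direct_sum_simps:
  "carrier (direct_sum M N) = carrier M \<times> carrier N" "\<zero>\<^bsub>direct_sum M N\<^esub> = (\<zero>\<^bsub>M\<^esub>, \<zero>\<^bsub>N\<^esub>)"
  "(x, y) \<oplus>\<^bsub>direct_sum M N\<^esub> (x', y') = (x \<oplus>\<^bsub>M\<^esub> x', y \<oplus>\<^bsub>N\<^esub> y')"
  "k \<odot>\<^bsub>direct_sum M N\<^esub> (x, y) = (k \<odot>\<^bsub>M\<^esub> x, k \<odot>\<^bsub>N\<^esub> y)"
  "(x, y) \<triangleleft>\<^bsub>direct_sum M N\<^esub> a = (x \<triangleleft>\<^bsub>M\<^esub> a, y \<triangleleft>\<^bsub>N\<^esub> a)"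
  by (simp_all add: direct_sum_def)

context graded_algebra
begin

lemma single_linear:
  "linear_map K (E\<lparr>carrier := piece (u i) (w j)\<rparr>) (mat_space I u J w) (single I J i j)"
  by (rule linear_mapI) (auto simp: single_closed, auto simp: single_def)

end

context paired_graded_algebra
begin

text \<open>A matrix \<open>Y\<close> with rows in two copies of \<open>J\<close>, the second one with levels raised by one, is
  sent to its upper half and to the functional \<open>b \<mapsto> tr (Y b)\<close> given by its lower half.\<close>

lemma regular_plus_dual_as_matrices:
  fixes S :: "('k, 's, 'f) module_scheme"
  assumes S: "fd_algebra K S" and \<theta>: "alg_iso K (mat_alg {..<n} l) S \<theta>"
  defines "u \<equiv> \<lambda>p. if p < n then l p else Suc (l (p - n))"
    and "M \<equiv> direct_sum (regular_module S) (dual_module K S)"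
  obtains T where "bij_betw T (mats {..<n + n} u {..<n} l) (carrier M)"
    and "linear_map K (mat_space {..<n + n} u {..<n} l) M T"
    and "\<And>Y b. \<lbrakk>Y \<in> mats {..<n + n} u {..<n} l; b \<in> mats {..<n} l {..<n} l\<rbrakk> \<Longrightarrow>
      T (mmul {..<n + n} {..<n} {..<n} Y b) = T Y \<triangleleft>\<^bsub>M\<^esub> \<theta> b"
proof -
  define I where "I = {..<n + n}"
  define J where "J = {..<n}"
  define V where "V = mats I u J l"
  define B where "B = mats J l J l"
  have fin: "finite I" "finite J"
    by (auto simp: I_def J_def)
  have JI: "j \<in> I" "n + j \<in> I" "u j = l j" "u (n + j) = Suc (l j)" if "j \<in> J" for j
    using that by (auto simp: I_def J_def u_def)
  have I_cases: "i \<in> J \<or> (\<exists>j\<in>J. i = n + j)" if "i \<in> I" for i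
  proof -
    have "i \<in> J \<or> i - n \<in> J \<and> i = n + (i - n)"
      using that by (auto simp: I_def J_def)
    then show ?thesis by blast
  qed
  interpret S: fd_algebra K S by (rule S)
  note \<theta> = \<theta>[folded J_def]
  note th = alg_isoD[OF \<theta>, unfolded mat_space_simps, folded B_def]
  have G: "module K (ground_space K)"
    by (rule module_ground_space) (rule K.is_cring)
  have Sm: "module K S" ..
  define \<eta> where "\<eta> = the_inv_into B \<theta>"
  have "alg_iso K S (mat_alg J l) \<eta>"
    using alg_iso_inverse[OF fd_algebra_mat_alg[OF fin(2)] \<theta>] by (simp add: \<eta>_def B_def)
  note et = alg_isoD[OF this, unfolded mat_space_simps, folded B_def]
  have \<theta>\<eta>: "\<theta> (\<eta> s) = s" if "s \<in> carrier S" for s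
    unfolding \<eta>_def using f_the_inv_into_f_bij_betw[OF th(1)] that by simp
  have \<eta>\<theta>: "\<eta> (\<theta> b) = b" if "b \<in> B" for b
    unfolding \<eta>_def using the_inv_into_f_f th(1) that by (metis bij_betw_def)
  \<comment> \<open>The trace of the lower square block, whose row \<open>n + p\<close> has level
    \<open>l p + 1\<close>; on the diagonal of this block \<open>t\<close> is applied to entries at
    levels \<open>(l p + 1, l p)\<close>.\<close>
  define tr where "tr Y = t (\<Oplus>\<^bsub>E\<^esub>p\<in>J. Y (n + p, p))" for Y
  have diag: "Y (n + p, p) \<in> carrier E" if "Y \<in> V" "p \<in> J" for Y p
    using mats_closed[of Y I u J l "n + p" p] that JI by (simp add: V_def)
  have tr: "linear_map K (mat_space I u J l) (ground_space K) tr"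
  proof (rule linear_mapI, unfold mat_space_simps V_def[symmetric])
    show "tr Y \<in> carrier (ground_space K)" if "Y \<in> V" for Y
      using linear_map_closed[OF t_linear] diag[OF that] by (auto simp: tr_def intro!: E.finsum_closed)
    show "tr (\<lambda>p\<in>I \<times> J. Y p \<oplus>\<^bsub>E\<^esub> Z p) = tr Y \<oplus>\<^bsub>ground_space K\<^esub> tr Z" if Y: "Y \<in> V" and Z: "Z \<in> V" for Y Z
    proof -
      have "(\<Oplus>\<^bsub>E\<^esub>p\<in>J. (\<lambda>p\<in>I \<times> J. Y p \<oplus>\<^bsub>E\<^esub> Z p) (n + p, p)) = (\<Oplus>\<^bsub>E\<^esub>p\<in>J. Y (n + p, p) \<oplus>\<^bsub>E\<^esub> Z (n + p, p))"
        using diag Y Z JI by (intro E.finsum_cong') auto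
      also have "\<dots> = (\<Oplus>\<^bsub>E\<^esub>p\<in>J. Y (n + p, p)) \<oplus>\<^bsub>E\<^esub> (\<Oplus>\<^bsub>E\<^esub>p\<in>J. Z (n + p, p))"
        using diag Y Z by (intro E.finsum_addf) auto
      finally show ?thesis
        using diag Y Z by (simp add: tr_def linear_map_add[OF t_linear] E.finsum_closed Pi_iff)
    qed
    show "tr (\<lambda>p\<in>I \<times> J. k \<odot>\<^bsub>E\<^esub> Y p) = k \<odot>\<^bsub>ground_space K\<^esub> tr Y" if k: "k \<in> carrier K" and Y: "Y \<in> V" for k Y
    proof -
      have "(\<Oplus>\<^bsub>E\<^esub>p\<in>J. (\<lambda>p\<in>I \<times> J. k \<odot>\<^bsub>E\<^esub> Y p) (n + p, p)) = (\<Oplus>\<^bsub>E\<^esub>p\<in>J. k \<odot>\<^bsub>E\<^esub> Y (n + p, p))"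
        using diag Y k JI by (intro E.finsum_cong') auto
      also have "\<dots> = k \<odot>\<^bsub>E\<^esub> (\<Oplus>\<^bsub>E\<^esub>p\<in>J. Y (n + p, p))"
        using diag Y k fin by (intro E.finsum_smult_ldistr[symmetric]) auto
      finally show ?thesis
        using diag Y k by (simp add: tr_def linear_map_smult[OF t_linear] E.finsum_closed Pi_iff)
    qed
  qed
  have VB: "mmul I J J Y b \<in> V" if "Y \<in> V" "b \<in> B" for Y b
    using that mmul_closed unfolding V_def B_def by blast
  have trb: "linear_map K (mat_alg J l) (ground_space K) (\<lambda>b. tr (mmul I J J Y b))" if Y: "Y \<in> V" for Y
  proof (rule linear_map_compose[OF tr], rule linear_mapI, unfold mat_space_simps V_def[symmetric] B_def[symmetric])
    show "mmul I J J Y (\<lambda>p\<in>J \<times> J. b p \<oplus>\<^bsub>E\<^esub> c p) = (\<lambda>p\<in>I \<times> J. mmul I J J Y b p \<oplus>\<^bsub>E\<^esub> mmul I J J Y c p)"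
      if "b \<in> B" "c \<in> B" for b c
      using Y that unfolding V_def B_def by (rule mmul_add_right)
    show "mmul I J J Y (\<lambda>p\<in>J \<times> J. k \<odot>\<^bsub>E\<^esub> b p) = (\<lambda>p\<in>I \<times> J. k \<odot>\<^bsub>E\<^esub> mmul I J J Y b p)"
      if "k \<in> carrier K" "b \<in> B" for k b
      using fin(2) that(1) Y that(2) unfolding V_def B_def by (rule mmul_smult(2))
  qed (rule VB[OF Y])
  \<comment> \<open>Against a single entry the trace sees one lower entry of \<open>Y\<close>,
    paired with \<open>x\<close>. This reduces both injectivity and surjectivity of \<open>T\<close>
    to \<open>pairing\<close>.\<close>
  have tr_single: "tr (mmul I J J Y (single J J q p x)) = t (Y (n + p, q) \<otimes>\<^bsub>E\<^esub> x)"
    if Y: "Y \<in> V" and p: "p \<in> J" and q: "q \<in> J" and x: "x \<in> carrier E" for Y p q x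
  proof -
    have cl: "Y (n + p', q) \<in> carrier E" if "p' \<in> J" for p'
      using mats_closed[of Y I u J l "n + p'" q] Y q JI that by (simp add: V_def)
    have "(\<Oplus>\<^bsub>E\<^esub>p'\<in>J. mmul I J J Y (single J J q p x) (n + p', p')) =
        (\<Oplus>\<^bsub>E\<^esub>p'\<in>J. if p' = p then Y (n + p', q) \<otimes>\<^bsub>E\<^esub> x else \<zero>\<^bsub>E\<^esub>)"
      using mmul_single_right[OF fin(2) Y[unfolded V_def] q p x] cl x JI
      by (intro E.finsum_cong') auto
    also have "\<dots> = Y (n + p, q) \<otimes>\<^bsub>E\<^esub> x"
      using E.finsum_delta[OF fin(2) p, of "\<lambda>p'. Y (n + p', q) \<otimes>\<^bsub>E\<^esub> x"] cl[OF p] x by simp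
    finally show ?thesis
      by (simp add: tr_def)
  qed
  define top where "top Y = restrict Y (J \<times> J)" for Y :: "nat \<times> nat \<Rightarrow> 'a"
  have top_B: "top Y \<in> B" if "Y \<in> V" for Y
    unfolding top_def B_def restrict_mats using that JI mats_piece[of Y I u J l] by (metis V_def)
  \<comment> \<open>\<open>\<eta> s\<close> is the matrix of \<open>s\<close>, so the second
    component is the trace functional of \<open>Y\<close> on \<open>S\<close>.\<close>
  define T where "T Y = (\<theta> (top Y), \<lambda>s\<in>carrier S. tr (mmul I J J Y (\<eta> s)))" for Y
  note M_simps = M_def direct_sum_simps regular_module_simps dual_module_simps linear_hom_simps
  have functional: "linear_map K S (ground_space K) (\<lambda>s. tr (mmul I J J Y (\<eta> s)))" if "Y \<in> V" for Y
    by (rule linear_map_compose[OF trb[OF that] et(2)])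
  have T_lin: "linear_map K (mat_space I u J l) M T"
  proof (rule linear_mapI, unfold mat_space_simps V_def[symmetric])
    show "T Y \<in> carrier M" if "Y \<in> V" for Y
      using functional[OF that] top_B[OF that] th(3)
      by (simp add: T_def M_simps linear_map_restrict[OF Sm])
    show "T (\<lambda>p\<in>I \<times> J. Y p \<oplus>\<^bsub>E\<^esub> Z p) = T Y \<oplus>\<^bsub>M\<^esub> T Z" if Y: "Y \<in> V" and Z: "Z \<in> V" for Y Z
    proof -
      have "top (\<lambda>p\<in>I \<times> J. Y p \<oplus>\<^bsub>E\<^esub> Z p) = (\<lambda>p\<in>J \<times> J. top Y p \<oplus>\<^bsub>E\<^esub> top Z p)"
        using JI by (auto simp: top_def fun_eq_iff)
      moreover have "tr (mmul I J J (\<lambda>p\<in>I \<times> J. Y p \<oplus>\<^bsub>E\<^esub> Z p) b) = tr (mmul I J J Y b) \<oplus>\<^bsub>K\<^esub> tr (mmul I J J Z b)"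
        if b: "b \<in> B" for b
        using mmul_add_left[OF Y[unfolded V_def] Z[unfolded V_def] b[unfolded B_def]]
          linear_map_add[OF tr, of "mmul I J J Y b" "mmul I J J Z b"] VB[OF Y b] VB[OF Z b] by (simp add: V_def)
      ultimately show ?thesis
        using th(4)[OF top_B[OF Y] top_B[OF Z]] et(3) by (auto simp: T_def M_simps intro!: restrict_ext)
    qed
    show "T (\<lambda>p\<in>I \<times> J. k \<odot>\<^bsub>E\<^esub> Y p) = k \<odot>\<^bsub>M\<^esub> T Y" if k: "k \<in> carrier K" and Y: "Y \<in> V" for k Y
    proof -
      have "top (\<lambda>p\<in>I \<times> J. k \<odot>\<^bsub>E\<^esub> Y p) = (\<lambda>p\<in>J \<times> J. k \<odot>\<^bsub>E\<^esub> top Y p)"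
        using JI by (auto simp: top_def fun_eq_iff)
      moreover have "tr (mmul I J J (\<lambda>p\<in>I \<times> J. k \<odot>\<^bsub>E\<^esub> Y p) b) = k \<otimes>\<^bsub>K\<^esub> tr (mmul I J J Y b)"
        if b: "b \<in> B" for b
        using mmul_smult(1)[OF fin(2) k Y[unfolded V_def] b[unfolded B_def]]
          linear_map_smult[OF tr k, of "mmul I J J Y b"] VB[OF Y b] by (simp add: V_def)
      ultimately show ?thesis
        using th(5)[OF k top_B[OF Y]] et(3) by (auto simp: T_def M_simps intro!: restrict_ext)
    qed
  qed
  have T_act: "T (mmul I J J Y b) = T Y \<triangleleft>\<^bsub>M\<^esub> \<theta> b" if Y: "Y \<in> V" and b: "b \<in> B" for Y b
  proof -
    have "top (mmul I J J Y b) = mmul J J J (top Y) b"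
    proof (rule mats_eqI[where I = J and J = J])
      fix i j assume i: "i \<in> J" and j: "j \<in> J"
      show "top (mmul I J J Y b) (i, j) = mmul J J J (top Y) b (i, j)"
        using i j JI mats_closed[of Y I u J l i] mats_closed[of b J l J l] Y b
        by (auto simp: top_def mmul_apply V_def B_def intro!: E.finsum_cong')
    qed (simp_all add: top_def mmul_extensional)
    \<comment> \<open>The right action on the dual precomposes with left multiplication by
      \<open>\<theta> b\<close>, so the second component is a matter of associativity.\<close>
    moreover have "mmul I J J (mmul I J J Y b) (\<eta> s) = mmul I J J Y (\<eta> (\<theta> b \<otimes>\<^bsub>S\<^esub> s))" if s: "s \<in> carrier S" for s
      using mmul_assoc[OF fin(2,2) Y[unfolded V_def] b[unfolded B_def] et(3)[OF s, unfolded B_def]] b s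
      by (simp add: et(6) th(3) \<eta>\<theta>)
    ultimately show ?thesis
      using th(6)[OF top_B[OF Y] b] th(3)[OF b] by (auto simp: T_def M_simps intro!: restrict_ext)
  qed
  have T_bij: "bij_betw T V (carrier M)"
  proof (rule bij_betw_imageI)
    show "inj_on T V"
    proof (rule inj_onI)
      fix Y Z assume Y: "Y \<in> V" and Z: "Z \<in> V" and eq: "T Y = T Z"
      have "top Y = top Z"
        using eq top_B Y Z th(1) by (auto simp: T_def bij_betw_def inj_on_def)
      then have upper: "Y (i, j) = Z (i, j)" if "i \<in> J" "j \<in> J" for i j
        using that by (auto simp: top_def dest!: fun_cong[of _ _ "(i, j)"])
      have tr_eq: "tr (mmul I J J Y b) = tr (mmul I J J Z b)" if "b \<in> B" for b
        using eq th(3)[OF that] \<eta>\<theta>[OF that] by (auto simp: T_def dest!: fun_cong[of _ _ "\<theta> b"])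
      have lower: "Y (n + p, q) = Z (n + p, q)" if p: "p \<in> J" and q: "q \<in> J" for p q
      proof (rule pairing_unique[of _ "l p" "l q"])
        show "Y (n + p, q) \<in> piece (Suc (l p)) (l q)" "Z (n + p, q) \<in> piece (Suc (l p)) (l q)"
          using mats_piece[of _ I u J l "n + p" q] Y Z JI[OF p] q by (auto simp: V_def)
        fix x assume x: "x \<in> piece (l q) (l p)"
        show "t (Y (n + p, q) \<otimes>\<^bsub>E\<^esub> x) = t (Z (n + p, q) \<otimes>\<^bsub>E\<^esub> x)"
          using tr_eq[of "single J J q p x"] single_closed[of x l q l p J J] x
            tr_single[OF Y p q piece_closed[OF x]] tr_single[OF Z p q piece_closed[OF x]] by (simp add: B_def)
      qed
      have "Y (i, j) = Z (i, j)" if "i \<in> I" "j \<in> J" for i j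
        using I_cases[OF that(1)] that(2) upper lower by auto
      then show "Y = Z"
        using Y Z by (intro mats_eqI[where I = I and J = J]) (auto simp: V_def mats_extensional)
    qed
    have "z \<in> T ` V" if z: "z \<in> carrier M" for z
    proof -
      obtain s \<psi> where z: "z = (s, \<psi>)" "s \<in> carrier S" "linear_map K S (ground_space K) \<psi>"
          "\<psi> \<in> extensional (carrier S)"
        using z by (auto simp: M_simps)
      have lin\<psi>: "linear_map K (mat_alg J l) (ground_space K) (\<lambda>b. \<psi> (\<theta> b))"
        by (rule linear_map_compose[OF z(3) th(2)])
      \<comment> \<open>\<open>R p q y\<close> says that \<open>y\<close> represents the given
        functional on matrices concentrated at \<open>(q, p)\<close>. Such a \<open>y\<close> is the
        candidate for the lower entry at \<open>(n + p, q)\<close>: the trace swaps the two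
        indices.\<close>
      define R where "R p q y \<longleftrightarrow> y \<in> piece (Suc (l p)) (l q) \<and>
          (\<forall>x\<in>piece (l q) (l p). \<psi> (\<theta> (single J J q p x)) = t (y \<otimes>\<^bsub>E\<^esub> x))" for p q y
      have "\<exists>y. R p q y" for p q
        unfolding R_def using pairing[OF linear_map_compose[OF lin\<psi> single_linear]] by blast
      then obtain y where y: "\<And>p q. R p q (y p q)"
        by metis
      define Y where "Y = (\<lambda>p\<in>I \<times> J. if fst p \<in> J then \<eta> s p else y (fst p - n) (snd p))"
      have nJ: "n + p \<notin> J" for p
        by (simp add: J_def)
      have "\<eta> s \<in> B"
        using et(3) z(2) .
      then have Y: "Y \<in> V"
        unfolding Y_def V_def restrict_mats
      proof (intro ballI)
        fix i j assume i: "i \<in> I" and j: "j \<in> J"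
        show "(if fst (i, j) \<in> J then \<eta> s (i, j) else y (fst (i, j) - n) (snd (i, j))) \<in> piece (u i) (l j)"
          using I_cases[OF i]
        proof (elim disjE bexE)
          assume "i \<in> J"
          then show ?thesis
            using mats_piece[of "\<eta> s" J l J l i j] \<open>\<eta> s \<in> B\<close> j JI by (simp add: B_def)
        next
          fix p assume "p \<in> J" "i = n + p"
          then show ?thesis
            using y[of p j] nJ JI by (simp add: R_def)
        qed
      qed
      have "top Y = \<eta> s"
        using mats_extensional[of "\<eta> s" J l J l] \<open>\<eta> s \<in> B\<close> JI
        by (intro mats_eqI[where I = J and J = J]) (auto simp: top_def Y_def B_def)
      then have "\<theta> (top Y) = s"
        using \<theta>\<eta> z(2) by simp
      \<comment> \<open>Both sides are linear in \<open>b\<close> and agree on single entries by the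
        choice of \<open>y\<close>.\<close>
      moreover have "tr (mmul I J J Y b) = \<psi> (\<theta> b)" if "b \<in> B" for b
        using fin(2,2) that[unfolded B_def]
      proof (induction rule: mats_induct)
        case zero
        show ?case
          using linear_map_zero[OF module_mat_space G trb[OF Y]] linear_map_zero[OF module_mat_space G lin\<psi>]
          by (simp only: mat_space_simps ground_space_simps)
      next
        case (single q p x)
        have "Y (n + p, q) = y p q"
          using JI single nJ by (simp add: Y_def)
        then show ?case
          using tr_single[OF Y single(2,1) piece_closed[OF single(3)]] y[of p q] single(3) by (simp add: R_def)
      next
        case (add b c)
        then show ?case
          using linear_map_add[OF trb[OF Y], of b c] linear_map_add[OF lin\<psi>, of b c]
          by (simp only: mat_space_simps)
      qed
      then have "(\<lambda>s\<in>carrier S. tr (mmul I J J Y (\<eta> s))) = \<psi>"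
        using z(4) et(3) \<theta>\<eta> by (auto simp: fun_eq_iff extensional_def)
      ultimately have "T Y = z"
        by (simp add: T_def z(1))
      with Y show ?thesis by blast
    qed
    then show "T ` V = carrier M"
      using linear_map_closed[OF T_lin] by (auto simp: V_def)
  qed
  show thesis
    by (rule that[of T]) (use T_bij T_lin T_act in \<open>simp_all add: V_def B_def I_def J_def\<close>)
qed

text \<open>The induction step. The second copy of the indices carries the levels
  \<open>1, ..., m + 1\<close>, so the levels again fill an initial segment, as the next step
  requires.\<close>

lemma End_algebra_regular_plus_dual:
  fixes S :: "('k, 's, 'f) module_scheme"
  assumes S: "fd_algebra K S" and \<theta>: "alg_iso K (mat_alg {..<n} l) S \<theta>" and l: "l ` {..<n} = {..m}"
  defines "u \<equiv> \<lambda>p. if p < n then l p else Suc (l (p - n))"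
  shows "u ` {..<n + n} = {..Suc m}"
    and "\<exists>\<Lambda>. alg_iso K (mat_alg {..<n + n} u) (End_algebra K S (direct_sum (regular_module S) (dual_module K S))) \<Lambda>"
proof -
  have split: "{..<n + n} = {..<n} \<union> (+) n ` {..<n}"
    unfolding lessThan_atLeast0 image_add_atLeastLessThan by auto
  have "u ` {..<n + n} = u ` {..<n} \<union> (\<lambda>p. u (n + p)) ` {..<n}"
    unfolding split image_Un image_image ..
  also have "\<dots> = l ` {..<n} \<union> Suc ` l ` {..<n}"
    unfolding image_image by (intro arg_cong2[where f = "(\<union>)"] image_cong) (simp_all add: u_def)
  also have "\<dots> = {..Suc m}"
    unfolding l by (subst image_Suc_atMost) auto
  finally show u: "u ` {..<n + n} = {..Suc m}" .
  \<comment> \<open>The direct sum is not set up as a module here, so its zero is reached by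
    multiplying both components by the scalar zero.\<close>
  have T0: "T (\<lambda>p\<in>{..<n + n} \<times> {..<n}. \<zero>\<^bsub>E\<^esub>) = \<zero>\<^bsub>direct_sum (regular_module S) (dual_module K S)\<^esub>"
    if "linear_map K (mat_space {..<n + n} u {..<n} l) (direct_sum (regular_module S) (dual_module K S)) T" for T
  proof -
    interpret S: fd_algebra K S by (rule S)
    interpret V: module K "mat_space {..<n + n} u {..<n} l" by (rule module_mat_space)
    have D: "module K (linear_hom K S (ground_space K))"
      by (intro module_linear_hom module_ground_space S.module_axioms K.is_cring)
    interpret D: module K "linear_hom K S (ground_space K)" by (rule D)
    let ?z = "\<zero>\<^bsub>mat_space {..<n + n} u {..<n} l\<^esub>"
    have "T ?z = T (\<zero>\<^bsub>K\<^esub> \<odot>\<^bsub>mat_space {..<n + n} u {..<n} l\<^esub> ?z)"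
      using V.smult_l_null[OF V.zero_closed] by (simp only:)
    also have "\<dots> = \<zero>\<^bsub>K\<^esub> \<odot>\<^bsub>direct_sum (regular_module S) (dual_module K S)\<^esub> T ?z"
      by (rule linear_map_smult[OF that K.zero_closed V.zero_closed])
    also have "\<dots> = \<zero>\<^bsub>direct_sum (regular_module S) (dual_module K S)\<^esub>"
      using linear_map_closed[OF that V.zero_closed]
      by (cases "T ?z") (simp only: direct_sum_simps regular_module_simps dual_module_simps mem_Times_iff
          fst_conv snd_conv S.smult_l_null D.smult_l_null)
    finally show ?thesis by simp
  qed
  obtain T where T: "bij_betw T (mats {..<n + n} u {..<n} l) (carrier (direct_sum (regular_module S) (dual_module K S)))"
      "linear_map K (mat_space {..<n + n} u {..<n} l) (direct_sum (regular_module S) (dual_module K S)) T"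
      "\<And>Y b. \<lbrakk>Y \<in> mats {..<n + n} u {..<n} l; b \<in> mats {..<n} l {..<n} l\<rbrakk> \<Longrightarrow>
        T (mmul {..<n + n} {..<n} {..<n} Y b) = T Y \<triangleleft>\<^bsub>direct_sum (regular_module S) (dual_module K S)\<^esub> \<theta> b"
    by (rule regular_plus_dual_as_matrices[OF S \<theta>, folded u_def]) (rule that)
  show "\<exists>\<Lambda>. alg_iso K (mat_alg {..<n + n} u) (End_algebra K S (direct_sum (regular_module S) (dual_module K S))) \<Lambda>"
    by (rule exI, rule End_algebra_iso[OF finite_lessThan finite_lessThan l eq_refl[OF u] \<theta> T(1,2) T0[OF T(2)] T(3)])
qed

end

section \<open>The entry algebra\<close>

text \<open>The trace form of the trivial extension of \<open>A\<close> by \<open>DA\<close>: the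
  product of \<open>(a, \<phi>)\<close> and \<open>(b, \<psi>)\<close> has trace
  \<open>\<psi> a + \<phi> b\<close>, which is symmetric in the two factors.\<close>

definition entry_trace :: "('k, 'a, 'e) module_scheme \<Rightarrow> 'a \<times> ('a \<Rightarrow> 'k) \<Rightarrow> 'k" where
  "entry_trace A x = snd x \<one>\<^bsub>A\<^esub>"

locale field_fd_algebra = K: field K + A: fd_algebra K A
  for K :: "('k, 'z) ring_scheme" (structure) and A :: "('k, 'a, 'e) module_scheme"
begin

abbreviation D :: "('k, 'a \<Rightarrow> 'k) module" where "D \<equiv> linear_hom K A (ground_space K)"

abbreviation E :: "('k, 'a \<times> ('a \<Rightarrow> 'k)) module" where "E \<equiv> entry_algebra K A"

lemma module_D: "module K D"
  by (intro module_linear_hom module_ground_space A.module_axioms K.is_cring)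

lemma finite_dimensional_D: "finite_dimensional K D"
  by (intro finite_dimensional_linear_hom K.field_axioms A.module_axioms module_ground_space K.is_cring
      A.finite_dim finite_dimensional_ground_space)

sublocale D: module K D
  by (rule module_D)

lemma D_simps:
  "f \<in> carrier D \<longleftrightarrow> linear_map K A (ground_space K) f \<and> f \<in> extensional (carrier A)"
  "\<zero>\<^bsub>D\<^esub> = (\<lambda>x\<in>carrier A. \<zero>)"
  "f \<oplus>\<^bsub>D\<^esub> g = (\<lambda>x\<in>carrier A. f x \<oplus> g x)"
  "k \<odot>\<^bsub>D\<^esub> f = (\<lambda>x\<in>carrier A. k \<otimes> f x)"
  by (simp_all add: linear_hom_simps)

lemma D_apply:
  assumes "f \<in> carrier D"
  shows "x \<in> carrier A \<Longrightarrow> f x \<in> carrier K"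
    and "\<lbrakk>x \<in> carrier A; y \<in> carrier A\<rbrakk> \<Longrightarrow> f (x \<oplus>\<^bsub>A\<^esub> y) = f x \<oplus> f y"
    and "\<lbrakk>k \<in> carrier K; x \<in> carrier A\<rbrakk> \<Longrightarrow> f (k \<odot>\<^bsub>A\<^esub> x) = k \<otimes> f x"
    and "f \<zero>\<^bsub>A\<^esub> = \<zero>"
proof -
  have lin: "linear_map K A (ground_space K) f"
    using assms by (simp add: D_simps(1))
  show "x \<in> carrier A \<Longrightarrow> f x \<in> carrier K"
    "\<lbrakk>x \<in> carrier A; y \<in> carrier A\<rbrakk> \<Longrightarrow> f (x \<oplus>\<^bsub>A\<^esub> y) = f x \<oplus> f y"
    "\<lbrakk>k \<in> carrier K; x \<in> carrier A\<rbrakk> \<Longrightarrow> f (k \<odot>\<^bsub>A\<^esub> x) = k \<otimes> f x"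
    using linear_map_closed[OF lin] linear_map_add[OF lin] linear_map_smult[OF lin] by simp_all
  show "f \<zero>\<^bsub>A\<^esub> = \<zero>"
    using linear_map_zero[OF A.module_axioms module_ground_space[OF K.is_cring] lin] by simp
qed

lemma D_eqI: "\<lbrakk>f \<in> carrier D; g \<in> carrier D; \<And>x. x \<in> carrier A \<Longrightarrow> f x = g x\<rbrakk> \<Longrightarrow> f = g"
  by (rule extensionalityI[of _ "carrier A"]) (simp_all add: D_simps(1))

text \<open>The two actions on \<open>DA\<close> are restated for \<open>linear_hom\<close>, so that
  one record of the dual space suffices in this section.\<close>

definition lact :: "'a \<Rightarrow> ('a \<Rightarrow> 'k) \<Rightarrow> 'a \<Rightarrow> 'k" where
  "lact a \<phi> = (\<lambda>x\<in>carrier A. \<phi> (x \<otimes>\<^bsub>A\<^esub> a))"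

definition ract :: "('a \<Rightarrow> 'k) \<Rightarrow> 'a \<Rightarrow> 'a \<Rightarrow> 'k" where
  "ract \<phi> a = (\<lambda>x\<in>carrier A. \<phi> (a \<otimes>\<^bsub>A\<^esub> x))"

lemma lact_closed: "\<lbrakk>a \<in> carrier A; \<phi> \<in> carrier D\<rbrakk> \<Longrightarrow> lact a \<phi> \<in> carrier D"
  by (auto simp: D_simps(1) lact_def linear_map_restrict[OF A.module_axioms] A.l_distr A.smult_mult_left
      linear_map_add linear_map_smult linear_map_closed[of K A "ground_space K", simplified]
      intro!: linear_mapI)

lemma ract_closed: "\<lbrakk>a \<in> carrier A; \<phi> \<in> carrier D\<rbrakk> \<Longrightarrow> ract \<phi> a \<in> carrier D"
  by (auto simp: D_simps(1) ract_def linear_map_restrict[OF A.module_axioms] A.r_distr A.smult_mult_right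
      linear_map_add linear_map_smult linear_map_closed[of K A "ground_space K", simplified]
      intro!: linear_mapI)

lemma act_zero:
  "a \<in> carrier A \<Longrightarrow> lact a \<zero>\<^bsub>D\<^esub> = \<zero>\<^bsub>D\<^esub>" "a \<in> carrier A \<Longrightarrow> ract \<zero>\<^bsub>D\<^esub> a = \<zero>\<^bsub>D\<^esub>"
  "\<phi> \<in> carrier D \<Longrightarrow> lact \<zero>\<^bsub>A\<^esub> \<phi> = \<zero>\<^bsub>D\<^esub>" "\<phi> \<in> carrier D \<Longrightarrow> ract \<phi> \<zero>\<^bsub>A\<^esub> = \<zero>\<^bsub>D\<^esub>"
  by (auto simp: lact_def ract_def D_simps(2) D_apply(4) intro!: restrict_ext)

lemma entry_simps [simp]:
  "carrier E = carrier A \<times> carrier D" "\<one>\<^bsub>E\<^esub> = (\<one>\<^bsub>A\<^esub>, \<zero>\<^bsub>D\<^esub>)" "\<zero>\<^bsub>E\<^esub> = (\<zero>\<^bsub>A\<^esub>, \<zero>\<^bsub>D\<^esub>)"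
  "(a, \<phi>) \<oplus>\<^bsub>E\<^esub> (b, \<psi>) = (a \<oplus>\<^bsub>A\<^esub> b, \<phi> \<oplus>\<^bsub>D\<^esub> \<psi>)"
  "k \<odot>\<^bsub>E\<^esub> (a, \<phi>) = (k \<odot>\<^bsub>A\<^esub> a, k \<odot>\<^bsub>D\<^esub> \<phi>)"
  "(a, \<phi>) \<otimes>\<^bsub>E\<^esub> (b, \<psi>) = (a \<otimes>\<^bsub>A\<^esub> b, lact a \<psi> \<oplus>\<^bsub>D\<^esub> ract \<phi> b)"
  by (simp_all add: entry_algebra_def Let_def dual_module_simps lact_def ract_def dual_left_act_def)

text \<open>The three cases of \<open>entry_set\<close> become one vanishing condition per
  component, a form in which products and sums can be checked uniformly.\<close>

lemma entry_set_iff: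
  "(a, \<phi>) \<in> entry_set K A (i, j) \<longleftrightarrow> a \<in> carrier A \<and> \<phi> \<in> carrier D \<and>
    (i \<noteq> j \<longrightarrow> a = \<zero>\<^bsub>A\<^esub>) \<and> (i \<noteq> Suc j \<longrightarrow> \<phi> = \<zero>\<^bsub>D\<^esub>)"
  by (auto simp: entry_set_def dual_module_simps)

lemma module_E: "module K E"
  by (rule moduleI_smult[OF K.is_cring])
    (auto simp: A.a_ac D.a_ac A.smult_l_distr A.smult_r_distr A.smult_assoc1
      D.smult_l_distr D.smult_r_distr D.smult_assoc1)

text \<open>Separating functionals of \<open>A\<close> and of \<open>DA\<close>, each composed with
  a projection, separate the pairs.\<close>

lemma finite_dimensional_E: "finite_dimensional K E"
proof -
  obtain \<Phi> where \<Phi>: "finite \<Phi>" "\<And>\<phi>. \<phi> \<in> \<Phi> \<Longrightarrow> linear_map K A (ground_space K) \<phi>"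
    "\<And>x. \<lbrakk>x \<in> carrier A; \<And>\<phi>. \<phi> \<in> \<Phi> \<Longrightarrow> \<phi> x = \<zero>\<rbrakk> \<Longrightarrow> x = \<zero>\<^bsub>A\<^esub>"
    using separating_functionals[OF A.module_axioms A.finite_dim] by metis
  obtain \<Psi> where \<Psi>: "finite \<Psi>" "\<And>\<psi>. \<psi> \<in> \<Psi> \<Longrightarrow> linear_map K D (ground_space K) \<psi>"
    "\<And>x. \<lbrakk>x \<in> carrier D; \<And>\<psi>. \<psi> \<in> \<Psi> \<Longrightarrow> \<psi> x = \<zero>\<rbrakk> \<Longrightarrow> x = \<zero>\<^bsub>D\<^esub>"
    using separating_functionals[OF module_D finite_dimensional_D] by metis
  define F where "F = (\<lambda>\<phi> x. \<phi> (fst x)) ` \<Phi> \<union> (\<lambda>\<psi> x. \<psi> (snd x)) ` \<Psi>"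
  have proj: "linear_map K E A fst" "linear_map K E D snd"
    by (auto simp: linear_map_def)
  show ?thesis
  proof (rule finite_dimensional_if_separated_by_maps[OF K.field_axioms module_E
        module_ground_space[OF K.is_cring] finite_dimensional_ground_space[OF K.field_axioms]])
    show "finite F"
      using \<Phi>(1) \<Psi>(1) by (simp add: F_def)
    show "linear_map K E (ground_space K) f" if "f \<in> F" for f
      using that linear_map_compose[OF \<Phi>(2) proj(1)] linear_map_compose[OF \<Psi>(2) proj(2)]
      by (auto simp: F_def)
    fix x assume x: "x \<in> carrier E" and 0: "\<And>f. f \<in> F \<Longrightarrow> f x = \<zero>\<^bsub>ground_space K\<^esub>"
    have "fst x = \<zero>\<^bsub>A\<^esub>"
    proof (rule \<Phi>(3))
      show "\<phi> (fst x) = \<zero>" if "\<phi> \<in> \<Phi>" for \<phi>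
        using 0[of "\<lambda>x. \<phi> (fst x)"] that by (simp add: F_def)
    qed (use x in auto)
    moreover have "snd x = \<zero>\<^bsub>D\<^esub>"
    proof (rule \<Psi>(3))
      show "\<psi> (snd x) = \<zero>" if "\<psi> \<in> \<Psi>" for \<psi>
        using 0[of "\<lambda>x. \<psi> (snd x)"] that by (simp add: F_def)
    qed (use x in auto)
    ultimately show "x = \<zero>\<^bsub>E\<^esub>"
      by (simp add: prod_eq_iff)
  qed
qed

lemma act_distr:
  shows "\<lbrakk>a \<in> carrier A; \<phi> \<in> carrier D; \<psi> \<in> carrier D\<rbrakk> \<Longrightarrow> lact a (\<phi> \<oplus>\<^bsub>D\<^esub> \<psi>) = lact a \<phi> \<oplus>\<^bsub>D\<^esub> lact a \<psi>"
    and "\<lbrakk>a \<in> carrier A; \<phi> \<in> carrier D; \<psi> \<in> carrier D\<rbrakk> \<Longrightarrow> ract (\<phi> \<oplus>\<^bsub>D\<^esub> \<psi>) a = ract \<phi> a \<oplus>\<^bsub>D\<^esub> ract \<psi> a"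
    and "\<lbrakk>a \<in> carrier A; b \<in> carrier A; \<phi> \<in> carrier D\<rbrakk> \<Longrightarrow> lact (a \<oplus>\<^bsub>A\<^esub> b) \<phi> = lact a \<phi> \<oplus>\<^bsub>D\<^esub> lact b \<phi>"
    and "\<lbrakk>a \<in> carrier A; b \<in> carrier A; \<phi> \<in> carrier D\<rbrakk> \<Longrightarrow> ract \<phi> (a \<oplus>\<^bsub>A\<^esub> b) = ract \<phi> a \<oplus>\<^bsub>D\<^esub> ract \<phi> b"
  by (auto simp: lact_def ract_def D_simps(3,4) D_apply A.r_distr A.l_distr intro!: restrict_ext)

lemma act_assoc:
  shows "\<lbrakk>a \<in> carrier A; b \<in> carrier A; \<phi> \<in> carrier D\<rbrakk> \<Longrightarrow> lact (a \<otimes>\<^bsub>A\<^esub> b) \<phi> = lact a (lact b \<phi>)"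
    and "\<lbrakk>a \<in> carrier A; b \<in> carrier A; \<phi> \<in> carrier D\<rbrakk> \<Longrightarrow> ract \<phi> (a \<otimes>\<^bsub>A\<^esub> b) = ract (ract \<phi> a) b"
    and "\<lbrakk>a \<in> carrier A; b \<in> carrier A; \<phi> \<in> carrier D\<rbrakk> \<Longrightarrow> lact a (ract \<phi> b) = ract (lact a \<phi>) b"
  by (auto simp: lact_def ract_def A.m_assoc intro!: restrict_ext)

lemma act_one:
  assumes "\<phi> \<in> carrier D"
  shows "lact \<one>\<^bsub>A\<^esub> \<phi> = \<phi>" "ract \<phi> \<one>\<^bsub>A\<^esub> = \<phi>"
  using assms by (auto intro!: D_eqI lact_closed ract_closed) (auto simp: lact_def ract_def)

lemma act_smult:
  assumes "k \<in> carrier K" "a \<in> carrier A" "\<phi> \<in> carrier D"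
  shows "lact a (k \<odot>\<^bsub>D\<^esub> \<phi>) = k \<odot>\<^bsub>D\<^esub> lact a \<phi>" "ract (k \<odot>\<^bsub>D\<^esub> \<phi>) a = k \<odot>\<^bsub>D\<^esub> ract \<phi> a"
    and "lact (k \<odot>\<^bsub>A\<^esub> a) \<phi> = k \<odot>\<^bsub>D\<^esub> lact a \<phi>" "ract \<phi> (k \<odot>\<^bsub>A\<^esub> a) = k \<odot>\<^bsub>D\<^esub> ract \<phi> a"
  using assms by (auto simp: lact_def ract_def D_simps(3,4) D_apply A.smult_mult_left A.smult_mult_right
      intro!: restrict_ext)

lemma fd_algebra_E: "fd_algebra K E"
proof -
  have "monoid E"
  proof (rule monoidI)
    fix x y z assume "x \<in> carrier E" "y \<in> carrier E" "z \<in> carrier E"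
    then show "x \<otimes>\<^bsub>E\<^esub> y \<otimes>\<^bsub>E\<^esub> z = x \<otimes>\<^bsub>E\<^esub> (y \<otimes>\<^bsub>E\<^esub> z)"
      by (cases x; cases y; cases z)
        (simp add: A.m_assoc act_distr act_assoc lact_closed ract_closed D.a_assoc)
  qed (auto simp: lact_closed ract_closed act_one act_zero)
  moreover have "(x \<oplus>\<^bsub>E\<^esub> y) \<otimes>\<^bsub>E\<^esub> z = x \<otimes>\<^bsub>E\<^esub> z \<oplus>\<^bsub>E\<^esub> y \<otimes>\<^bsub>E\<^esub> z"
    "z \<otimes>\<^bsub>E\<^esub> (x \<oplus>\<^bsub>E\<^esub> y) = z \<otimes>\<^bsub>E\<^esub> x \<oplus>\<^bsub>E\<^esub> z \<otimes>\<^bsub>E\<^esub> y"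
    if "x \<in> carrier E" "y \<in> carrier E" "z \<in> carrier E" for x y z
    using that by (cases x; cases y; cases z;
        simp add: A.l_distr A.r_distr act_distr lact_closed ract_closed D.a_ac)+
  ultimately have "ring E"
    by (intro ringI module.axioms(2)[OF module_E])
  moreover have "(k \<odot>\<^bsub>E\<^esub> x) \<otimes>\<^bsub>E\<^esub> y = k \<odot>\<^bsub>E\<^esub> (x \<otimes>\<^bsub>E\<^esub> y)" "x \<otimes>\<^bsub>E\<^esub> (k \<odot>\<^bsub>E\<^esub> y) = k \<odot>\<^bsub>E\<^esub> (x \<otimes>\<^bsub>E\<^esub> y)"
    if "k \<in> carrier K" "x \<in> carrier E" "y \<in> carrier E" for k x y
    using that by (cases x; cases y;
        simp add: A.smult_mult_left A.smult_mult_right act_smult lact_closed ract_closed D.smult_r_distr)+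
  ultimately show ?thesis
    by (intro fd_algebra.intro fd_algebra_axioms.intro module_E finite_dimensional_E)
qed

lemma graded_algebra_E: "graded_algebra K E (\<lambda>i j. entry_set K A (i, j))"
proof (intro graded_algebra.intro graded_algebra_axioms.intro K.field_axioms fd_algebra_E)
  fix i j l and x y :: "'a \<times> ('a \<Rightarrow> 'k)" and k
  show "entry_set K A (i, j) \<subseteq> carrier E"
    by (auto simp: entry_set_iff)
  show "\<zero>\<^bsub>E\<^esub> \<in> entry_set K A (i, j)" "\<one>\<^bsub>E\<^esub> \<in> entry_set K A (i, i)"
    by (auto simp: entry_set_iff)
  assume x: "x \<in> entry_set K A (i, j)"
  show "k \<odot>\<^bsub>E\<^esub> x \<in> entry_set K A (i, j)" if "k \<in> carrier K"
    using x that by (cases x) (auto simp: entry_set_iff)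
  show "x \<oplus>\<^bsub>E\<^esub> y \<in> entry_set K A (i, j)" if "y \<in> entry_set K A (i, j)"
    using x that by (cases x; cases y) (auto simp: entry_set_iff)
  show "x \<otimes>\<^bsub>E\<^esub> y \<in> entry_set K A (i, l)" if "y \<in> entry_set K A (j, l)"
    using x that
    by (cases x; cases y; cases "i = j"; cases "i = Suc j"; cases "j = l"; cases "j = Suc l")
      (auto simp: entry_set_iff lact_closed ract_closed act_zero)
qed

text \<open>The functional \<open>(a, \<phi>) \<mapsto> \<phi> 1\<close> pairs \<open>A\<close> with \<open>DA\<close> by evaluation.\<close>

lemma paired_graded_algebra_E:
  assumes hom: "carrier (module_hom K A (dual_module K A) (regular_module A))
           = {\<lambda>\<phi>\<in>carrier (dual_module K A). \<zero>\<^bsub>A\<^esub>}"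
  shows "paired_graded_algebra K E (\<lambda>i j. entry_set K A (i, j)) (entry_trace A)"
proof (intro paired_graded_algebra.intro paired_graded_algebra_axioms.intro graded_algebra_E)
  show "linear_map K E (ground_space K) (entry_trace A)"
    by (auto simp: linear_map_def entry_trace_def D_apply D_simps(3,4))
  show "entry_set K A (i, j) = {\<zero>\<^bsub>E\<^esub>}" if "i \<noteq> j" "i \<noteq> Suc j" for i j
    using that by (auto simp: entry_set_iff)
  show "\<exists>!y. y \<in> entry_set K A (Suc j, i) \<and> (\<forall>x\<in>entry_set K A (i, j). \<psi> x = entry_trace A (y \<otimes>\<^bsub>E\<^esub> x))"
    if \<psi>: "linear_map K (E\<lparr>carrier := entry_set K A (i, j)\<rparr>) (ground_space K) \<psi>" for i j \<psi>
  proof -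
    consider (same) "i = j" | (suc) "i = Suc j" | (none) "i \<noteq> j" "i \<noteq> Suc j"
      by blast
    then show ?thesis
    proof cases
      case same
      \<comment> \<open>The piece is \<open>A\<close>, so the functional itself is the representing
        element of \<open>DA\<close>.\<close>
      define \<phi> where "\<phi> = (\<lambda>a\<in>carrier A. \<psi> (a, \<zero>\<^bsub>D\<^esub>))"
      have "linear_map K A (E\<lparr>carrier := entry_set K A (i, j)\<rparr>) (\<lambda>a. (a, \<zero>\<^bsub>D\<^esub>))"
        using same by (auto simp: linear_map_def entry_set_iff)
      then have \<phi>: "\<phi> \<in> carrier D"
        using linear_map_compose[OF \<psi>] by (auto simp: \<phi>_def D_simps(1) linear_map_restrict[OF A.module_axioms])
      have tr: "entry_trace A ((\<zero>\<^bsub>A\<^esub>, \<chi>) \<otimes>\<^bsub>E\<^esub> (a, \<zero>\<^bsub>D\<^esub>)) = \<chi> a" if "\<chi> \<in> carrier D" "a \<in> carrier A" for \<chi> a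
        using that ract_closed[OF that(2,1)] by (simp add: entry_trace_def act_zero) (simp add: ract_def)
      show ?thesis
      proof (rule ex1I[of _ "(\<zero>\<^bsub>A\<^esub>, \<phi>)"])
        show "(\<zero>\<^bsub>A\<^esub>, \<phi>) \<in> entry_set K A (Suc j, i) \<and>
            (\<forall>x\<in>entry_set K A (i, j). \<psi> x = entry_trace A ((\<zero>\<^bsub>A\<^esub>, \<phi>) \<otimes>\<^bsub>E\<^esub> x))"
          using same \<phi> tr[OF \<phi>] by (auto simp: entry_set_iff \<phi>_def simp del: entry_simps(6))
        fix y assume y: "y \<in> entry_set K A (Suc j, i) \<and>
            (\<forall>x\<in>entry_set K A (i, j). \<psi> x = entry_trace A (y \<otimes>\<^bsub>E\<^esub> x))"
        obtain b \<chi> where b: "y = (b, \<chi>)"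
          by (cases y)
        then have \<chi>: "b = \<zero>\<^bsub>A\<^esub>" "\<chi> \<in> carrier D"
          using y same by (auto simp: entry_set_iff)
        have "\<chi> a = \<phi> a" if a: "a \<in> carrier A" for a
          using y a same tr[OF \<chi>(2) a] unfolding b \<chi>(1) by (auto simp: \<phi>_def entry_set_iff simp del: entry_simps(6))
        then show "y = (\<zero>\<^bsub>A\<^esub>, \<phi>)"
          using b \<chi> \<phi> D_eqI by simp
      qed
    next
      case suc
      \<comment> \<open>The piece is \<open>DA\<close>, and reflexivity represents the functional by
        an element of \<open>A\<close>.\<close>
      have "linear_map K D (E\<lparr>carrier := entry_set K A (i, j)\<rparr>) (\<lambda>\<phi>. (\<zero>\<^bsub>A\<^esub>, \<phi>))"
        using suc by (auto simp: linear_map_def entry_set_iff)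
      then have lin: "linear_map K D (ground_space K) (\<lambda>\<phi>. \<psi> (\<zero>\<^bsub>A\<^esub>, \<phi>))"
        by (rule linear_map_compose[OF \<psi>])
      obtain v where v: "v \<in> carrier A" "\<And>\<phi>. \<phi> \<in> carrier D \<Longrightarrow> \<psi> (\<zero>\<^bsub>A\<^esub>, \<phi>) = \<phi> v"
        using double_dual[OF K.field_axioms A.module_axioms A.finite_dim lin] by blast
      have tr: "entry_trace A ((a, \<zero>\<^bsub>D\<^esub>) \<otimes>\<^bsub>E\<^esub> (\<zero>\<^bsub>A\<^esub>, \<phi>)) = \<phi> a" if "\<phi> \<in> carrier D" "a \<in> carrier A" for \<phi> a
        using that lact_closed[OF that(2,1)] by (simp add: entry_trace_def act_zero) (simp add: lact_def)
      show ?thesis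
      proof (rule ex1I[of _ "(v, \<zero>\<^bsub>D\<^esub>)"])
        show "(v, \<zero>\<^bsub>D\<^esub>) \<in> entry_set K A (Suc j, i) \<and>
            (\<forall>x\<in>entry_set K A (i, j). \<psi> x = entry_trace A ((v, \<zero>\<^bsub>D\<^esub>) \<otimes>\<^bsub>E\<^esub> x))"
          using suc v tr by (auto simp: entry_set_iff simp del: entry_simps(6))
        fix y assume y: "y \<in> entry_set K A (Suc j, i) \<and>
            (\<forall>x\<in>entry_set K A (i, j). \<psi> x = entry_trace A (y \<otimes>\<^bsub>E\<^esub> x))"
        obtain b \<chi> where b: "y = (b, \<chi>)"
          by (cases y)
        then have \<chi>: "\<chi> = \<zero>\<^bsub>D\<^esub>" "b \<in> carrier A"
          using y suc by (auto simp: entry_set_iff)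
        have eq: "\<phi> b = \<phi> v" if \<phi>: "\<phi> \<in> carrier D" for \<phi>
        proof -
          have "(\<zero>\<^bsub>A\<^esub>, \<phi>) \<in> entry_set K A (i, j)"
            using suc \<phi> by (simp add: entry_set_iff)
          then have "\<psi> (\<zero>\<^bsub>A\<^esub>, \<phi>) = entry_trace A ((b, \<zero>\<^bsub>D\<^esub>) \<otimes>\<^bsub>E\<^esub> (\<zero>\<^bsub>A\<^esub>, \<phi>))"
            using y unfolding b \<chi>(1) by blast
          then show ?thesis
            using tr[OF \<phi> \<chi>(2)] v(2)[OF \<phi>] by (simp only:)
        qed
        \<comment> \<open>Uniqueness: functionals separate the elements of \<open>A\<close>. The
          difference of \<open>b\<close> and \<open>v\<close> is written with the scalar -1 to make
          their linearity apply directly.\<close>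
        obtain \<Phi> where \<Phi>: "\<And>\<phi>. \<phi> \<in> \<Phi> \<Longrightarrow> linear_map K A (ground_space K) \<phi>"
          "\<And>x. \<lbrakk>x \<in> carrier A; \<And>\<phi>. \<phi> \<in> \<Phi> \<Longrightarrow> \<phi> x = \<zero>\<rbrakk> \<Longrightarrow> x = \<zero>\<^bsub>A\<^esub>"
          using separating_functionals[OF A.module_axioms A.finite_dim] by metis
        have "b \<oplus>\<^bsub>A\<^esub> (\<ominus> \<one>) \<odot>\<^bsub>A\<^esub> v = \<zero>\<^bsub>A\<^esub>"
        proof (rule \<Phi>(2))
          fix \<phi> assume "\<phi> \<in> \<Phi>"
          then have \<phi>: "restrict \<phi> (carrier A) \<in> carrier D"
            using \<Phi>(1) by (simp add: D_simps(1) linear_map_restrict[OF A.module_axioms])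
          have "restrict \<phi> (carrier A) (b \<oplus>\<^bsub>A\<^esub> (\<ominus> \<one>) \<odot>\<^bsub>A\<^esub> v) = \<zero>"
            using v(1) \<chi>(2) eq[OF \<phi>] D_apply[OF \<phi>]
            by (simp add: D_apply(2,3)[OF \<phi>] K.r_neg K.l_minus del: restrict_apply restrict_apply')
          then show "\<phi> (b \<oplus>\<^bsub>A\<^esub> (\<ominus> \<one>) \<odot>\<^bsub>A\<^esub> v) = \<zero>"
            using v(1) \<chi>(2) by simp
        qed (use v(1) \<chi>(2) in simp)
        then have "b = v"
          using v(1) \<chi>(2) by (simp add: A.smult_l_minus A.M.minus_equality A.a_comm A.add.inv_solve_right')
        then show "y = (v, \<zero>\<^bsub>D\<^esub>)"
          by (simp add: b \<chi>(1))
      qed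
    next
      case none
      \<comment> \<open>Both pieces are zero, so it remains to see that \<open>\<psi>\<close> and
        the trace vanish at zero.\<close>
      have "\<psi> (\<zero>\<^bsub>E\<^esub>) = \<psi> (\<zero> \<odot>\<^bsub>E\<^esub> \<zero>\<^bsub>E\<^esub>)"
        by simp
      also have "\<dots> = \<zero>"
        using linear_map_smult[OF \<psi>, of \<zero> "\<zero>\<^bsub>E\<^esub>"] linear_map_closed[OF \<psi>, of "\<zero>\<^bsub>E\<^esub>"]
        by (simp add: entry_set_iff)
      finally have "\<psi> \<zero>\<^bsub>E\<^esub> = \<zero>" .
      moreover have "entry_trace A (\<zero>\<^bsub>E\<^esub> \<otimes>\<^bsub>E\<^esub> \<zero>\<^bsub>E\<^esub>) = \<zero>"
        by (simp add: entry_trace_def act_zero) (simp add: D_simps(2))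
      moreover have "entry_set K A (i, j) = {\<zero>\<^bsub>E\<^esub>}" "entry_set K A (Suc j, i) = {\<zero>\<^bsub>E\<^esub>}"
        using none by (auto simp: entry_set_iff)
      ultimately show ?thesis
        by (intro ex1I[of _ "\<zero>\<^bsub>E\<^esub>"]) (auto simp del: entry_simps)
    qed
  qed
  show "f x = \<zero>\<^bsub>E\<^esub>"
    if f: "linear_map K (E\<lparr>carrier := entry_set K A (Suc i, i)\<rparr>) (E\<lparr>carrier := entry_set K A (i, i)\<rparr>) f"
      and right: "\<And>x a. \<lbrakk>x \<in> entry_set K A (Suc i, i); a \<in> entry_set K A (i, i)\<rbrakk> \<Longrightarrow> f (x \<otimes>\<^bsub>E\<^esub> a) = f x \<otimes>\<^bsub>E\<^esub> a"
      and x: "x \<in> entry_set K A (Suc i, i)" for i f x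
  proof -
    \<comment> \<open>The map from \<open>DA\<close> to \<open>A\<close> underlying
      \<open>f\<close>, to which the hypothesis on \<open>Hom_A(DA, A)\<close> applies.\<close>
    define h where "h = (\<lambda>\<phi>\<in>carrier D. fst (f (\<zero>\<^bsub>A\<^esub>, \<phi>)))"
    have dom: "(\<zero>\<^bsub>A\<^esub>, \<phi>) \<in> entry_set K A (Suc i, i)" if "\<phi> \<in> carrier D" for \<phi>
      using that by (simp add: entry_set_iff)
    have fh: "f (\<zero>\<^bsub>A\<^esub>, \<phi>) = (h \<phi>, \<zero>\<^bsub>D\<^esub>)" and h_cl: "h \<phi> \<in> carrier A" if "\<phi> \<in> carrier D" for \<phi>
      using linear_map_closed[OF f, of "(\<zero>\<^bsub>A\<^esub>, \<phi>)"] dom[OF that] that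
      by (cases "f (\<zero>\<^bsub>A\<^esub>, \<phi>)"; simp add: h_def entry_set_iff)+
    have "linear_map K D A h"
    proof (rule linear_mapI)
      show "h (\<phi> \<oplus>\<^bsub>D\<^esub> \<psi>) = h \<phi> \<oplus>\<^bsub>A\<^esub> h \<psi>" if "\<phi> \<in> carrier D" "\<psi> \<in> carrier D" for \<phi> \<psi>
        using linear_map_add[OF f, of "(\<zero>\<^bsub>A\<^esub>, \<phi>)" "(\<zero>\<^bsub>A\<^esub>, \<psi>)"] dom that by (simp add: fh h_cl)
      show "h (k \<odot>\<^bsub>D\<^esub> \<phi>) = k \<odot>\<^bsub>A\<^esub> h \<phi>" if "k \<in> carrier K" "\<phi> \<in> carrier D" for k \<phi>
        using linear_map_smult[OF f, of k "(\<zero>\<^bsub>A\<^esub>, \<phi>)"] dom that by (simp add: fh h_cl)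
    qed (rule h_cl)
    moreover have "h (ract \<phi> a) = h \<phi> \<otimes>\<^bsub>A\<^esub> a" if "\<phi> \<in> carrier D" "a \<in> carrier A" for \<phi> a
      using right[OF dom[OF that(1)], of "(a, \<zero>\<^bsub>D\<^esub>)"] that ract_closed[OF that(2,1)]
      by (simp add: entry_set_iff fh h_cl act_zero)
    ultimately have "h \<in> carrier (module_hom K A (dual_module K A) (regular_module A))"
      by (auto simp: module_hom_simps linear_map_def dual_module_simps regular_module_simps ract_def)
        (auto simp: h_def)
    then have "h \<phi> = \<zero>\<^bsub>A\<^esub>" if "\<phi> \<in> carrier D" for \<phi>
      unfolding hom using that by (simp add: dual_module_simps)
    moreover obtain \<phi> where "x = (\<zero>\<^bsub>A\<^esub>, \<phi>)" "\<phi> \<in> carrier D"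
      using x by (cases x) (auto simp: entry_set_iff)
    ultimately show ?thesis
      using fh by simp
  qed
qed

end

section \<open>SGC extensions as matrix algebras\<close>

context graded_algebra
begin

lemma Morita_equivalent_mat_alg:
  fixes S :: "('k, 's, 'f) module_scheme"
  assumes S: "fd_algebra K S" and \<theta>: "alg_iso K (mat_alg J l) S \<theta>"
    and J: "finite J" and l: "l ` J = {..m}"
  shows "Morita_equivalent K S (mat_alg {..m} (\<lambda>i. i))"
proof -
  interpret S: fd_algebra K S by (rule S)
  define B where "B = mats J l J l"
  define R where "R = mats {..m} (\<lambda>i. i) {..m} (\<lambda>i. i)"
  note th = alg_isoD[OF \<theta>, unfolded mat_space_simps, folded B_def]
  have "\<forall>i\<in>{..m}. \<exists>p\<in>J. l p = i"
    using l by (metis imageE)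
  then obtain s where s: "\<And>i. i \<le> m \<Longrightarrow> s i \<in> J" "\<And>i. i \<le> m \<Longrightarrow> l (s i) = i"
    by (metis atMost_iff)
  have lm: "l p \<le> m" if "p \<in> J" for p
    using that l by auto
  \<comment> \<open>Extension by zero; \<open>p = s (l p)\<close> says that \<open>p\<close> is the
    index chosen for its level.\<close>
  define emb where "emb Z = (\<lambda>(p, q)\<in>J \<times> J. if p = s (l p) \<and> q = s (l q) then Z (l p, l q) else \<zero>\<^bsub>E\<^esub>)"
    for Z :: "nat \<times> nat \<Rightarrow> 'a"
  have emb_apply: "emb Z (p, q) = (if p = s (l p) \<and> q = s (l q) then Z (l p, l q) else \<zero>\<^bsub>E\<^esub>)"
    if "p \<in> J" "q \<in> J" for Z p q
    using that by (simp add: emb_def)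
  have emb_ext: "emb Z \<in> extensional (J \<times> J)" for Z
    by (simp add: emb_def)
  have emb_B: "emb Z \<in> B" if "Z \<in> R" for Z
    unfolding emb_def B_def restrict_mats
    using mats_piece[OF that[unfolded R_def]] lm by auto
  have RR: "mmul {..m} {..m} {..m} Z W \<in> R" if "Z \<in> R" "W \<in> R" for Z W
    using that mmul_closed unfolding R_def by blast
  have emb_mult: "emb (mmul {..m} {..m} {..m} Z W) = mmul J J J (emb Z) (emb W)"
    if Z: "Z \<in> R" and W: "W \<in> R" for Z W
  proof (rule mats_eqI[where I = J and J = J])
    fix p q assume p: "p \<in> J" and q: "q \<in> J"
    have Zc: "Z (i, j) \<in> carrier E" and Wc: "W (i, j) \<in> carrier E" if "i \<le> m" "j \<le> m" for i j
      using mats_closed[OF Z[unfolded R_def], of i j] mats_closed[OF W[unfolded R_def], of i j] that by auto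
    show "emb (mmul {..m} {..m} {..m} Z W) (p, q) = mmul J J J (emb Z) (emb W) (p, q)"
    proof (cases "p = s (l p) \<and> q = s (l q)")
      case True
      have "mmul J J J (emb Z) (emb W) (p, q) = (\<Oplus>\<^bsub>E\<^esub>k\<in>J. emb Z (p, k) \<otimes>\<^bsub>E\<^esub> emb W (k, q))"
        by (rule mmul_apply[OF p q])
      \<comment> \<open>Terms at indices that are not chosen vanish, and \<open>s\<close> then
        reindexes the sum by levels.\<close>
      also have "\<dots> = (\<Oplus>\<^bsub>E\<^esub>k\<in>s ` {..m}. Z (l p, l k) \<otimes>\<^bsub>E\<^esub> W (l k, l q))"
        using True s lm[OF p] lm[OF q] lm J p q Zc Wc
        by (intro E.add.finprod_mono_neutral_cong_right) (auto simp: emb_apply image_iff)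
      also have "\<dots> = (\<Oplus>\<^bsub>E\<^esub>i\<in>{..m}. Z (l p, l (s i)) \<otimes>\<^bsub>E\<^esub> W (l (s i), l q))"
        using s lm[OF p] lm[OF q] Zc Wc
        by (intro E.finsum_reindex) (auto simp: Pi_iff intro!: inj_onI, metis)
      also have "\<dots> = (\<Oplus>\<^bsub>E\<^esub>i\<in>{..m}. Z (l p, i) \<otimes>\<^bsub>E\<^esub> W (i, l q))"
        using s lm[OF p] lm[OF q] Zc Wc by (intro E.finsum_cong') auto
      also have "\<dots> = emb (mmul {..m} {..m} {..m} Z W) (p, q)"
        using p q lm True by (simp add: emb_apply mmul_apply)
      finally show ?thesis ..
    next
      case False
      have "emb Z (p, k) \<otimes>\<^bsub>E\<^esub> emb W (k, q) = \<zero>\<^bsub>E\<^esub>" if "k \<in> J" for k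
        using False p q that lm Zc Wc by (auto simp: emb_apply)
      then have "mmul J J J (emb Z) (emb W) (p, q) = \<zero>\<^bsub>E\<^esub>"
        unfolding mmul_apply[OF p q] by (rule E.add.finprod_one_eqI)
      then show ?thesis
        using False p q by (auto simp: emb_apply)
    qed
  qed (simp_all add: emb_ext mmul_extensional)
  define e where "e = emb \<one>\<^bsub>mat_alg {..m} (\<lambda>i. i)\<^esub>"
  have one_R: "\<one>\<^bsub>mat_alg {..m} (\<lambda>i. i)\<^esub> \<in> R"
    using fd_algebra_mat_alg[of "{..m}" "\<lambda>i. i"] by (auto simp: R_def restrict_mats)
  have e_B: "e \<in> B"
    unfolding e_def by (rule emb_B[OF one_R])
  have e_apply: "e (p, q) = (if p = q \<and> p = s (l p) then \<one>\<^bsub>E\<^esub> else \<zero>\<^bsub>E\<^esub>)" if "p \<in> J" "q \<in> J" for p q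
    using that lm[OF that(1)] lm[OF that(2)] by (auto simp: e_def emb_apply)
  have BB: "mmul J J J X Y \<in> B" if "X \<in> B" "Y \<in> B" for X Y
    using that mmul_closed unfolding B_def by blast
  have eX: "mmul J J J e X (p, q) = (if p = s (l p) then X (p, q) else \<zero>\<^bsub>E\<^esub>)"
    and Xe: "mmul J J J X e (p, q) = (if q = s (l q) then X (p, q) else \<zero>\<^bsub>E\<^esub>)"
    if X: "X \<in> B" and p: "p \<in> J" and q: "q \<in> J" for X p q
  proof -
    have cl: "X (a, b) \<in> carrier E" if "a \<in> J" "b \<in> J" for a b
      using mats_closed[OF X[unfolded B_def]] that by auto
    have "mmul J J J e X (p, q) = (\<Oplus>\<^bsub>E\<^esub>k\<in>J. if k = p then (if p = s (l p) then X (k, q) else \<zero>\<^bsub>E\<^esub>) else \<zero>\<^bsub>E\<^esub>)"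
      unfolding mmul_apply[OF p q] using p q cl by (intro E.finsum_cong') (auto simp: e_apply)
    then show "mmul J J J e X (p, q) = (if p = s (l p) then X (p, q) else \<zero>\<^bsub>E\<^esub>)"
      using E.finsum_delta[OF J p, of "\<lambda>k. if p = s (l p) then X (k, q) else \<zero>\<^bsub>E\<^esub>"] cl p q by simp
    have "mmul J J J X e (p, q) = (\<Oplus>\<^bsub>E\<^esub>k\<in>J. if k = q then (if q = s (l q) then X (p, k) else \<zero>\<^bsub>E\<^esub>) else \<zero>\<^bsub>E\<^esub>)"
      unfolding mmul_apply[OF p q] using p q cl by (intro E.finsum_cong') (auto simp: e_apply)
    then show "mmul J J J X e (p, q) = (if q = s (l q) then X (p, q) else \<zero>\<^bsub>E\<^esub>)"
      using E.finsum_delta[OF J q, of "\<lambda>k. if q = s (l q) then X (p, k) else \<zero>\<^bsub>E\<^esub>"] cl p q by simp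
  qed
  have emb_linear: "linear_map K (mat_alg {..m} (\<lambda>i. i)) (mat_alg J l) emb"
    using emb_B lm by (auto simp: linear_map_def emb_def B_def R_def intro!: restrict_ext)
  have "full_corner K S (mat_alg {..m} (\<lambda>i. i)) (\<lambda>Z. \<theta> (emb Z)) (\<theta> e)"
  proof (intro full_corner.intro full_corner_axioms.intro K.field_axioms S fd_algebra_mat_alg finite_atMost,
      unfold mat_space_simps R_def[symmetric])
    show "linear_map K (mat_alg {..m} (\<lambda>i. i)) S (\<lambda>Z. \<theta> (emb Z))"
      by (rule linear_map_compose[OF th(2) emb_linear])
    show "\<theta> (emb (mmul {..m} {..m} {..m} Z W)) = \<theta> (emb Z) \<otimes>\<^bsub>S\<^esub> \<theta> (emb W)" if "Z \<in> R" "W \<in> R" for Z W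
      using that emb_B th(6) by (simp add: emb_mult)
    show "\<theta> (emb (\<lambda>(i, j)\<in>{..m} \<times> {..m}. if i = j then \<one>\<^bsub>E\<^esub> else \<zero>\<^bsub>E\<^esub>)) = \<theta> e"
      by (simp add: e_def)
    show "inj_on (\<lambda>Z. \<theta> (emb Z)) R"
    proof (rule inj_onI)
      fix Z W assume Z: "Z \<in> R" and W: "W \<in> R" and eq: "\<theta> (emb Z) = \<theta> (emb W)"
      have eq: "emb Z = emb W"
        using eq th(1) emb_B[OF Z] emb_B[OF W] by (auto simp: bij_betw_def inj_on_def)
      show "Z = W"
      proof (rule mats_eqI)
        show "Z (i, j) = W (i, j)" if "i \<in> {..m}" "j \<in> {..m}" for i j
          using fun_cong[OF eq, of "(s i, s j)"] s that by (simp add: emb_apply)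
      qed (use Z W in \<open>auto simp: R_def intro: mats_extensional\<close>)
    qed
    have full_B: "\<exists>X\<in>B. x = \<theta> X" if "x \<in> carrier S" for x
      using that th(1) by (metis bij_betw_imp_surj_on imageE)
    show "\<theta> e \<otimes>\<^bsub>S\<^esub> x \<otimes>\<^bsub>S\<^esub> \<theta> e \<in> (\<lambda>Z. \<theta> (emb Z)) ` R" if x: "x \<in> carrier S" for x
    proof -
      obtain X where X: "X \<in> B" "x = \<theta> X"
        using full_B[OF x] by blast
      define Y where "Y = mmul J J J (mmul J J J e X) e"
      have Y: "Y \<in> B" "\<theta> e \<otimes>\<^bsub>S\<^esub> x \<otimes>\<^bsub>S\<^esub> \<theta> e = \<theta> Y"
        using X e_B BB by (simp_all add: Y_def th(6))
      have Y_apply: "Y (p, q) = (if p = s (l p) \<and> q = s (l q) then X (p, q) else \<zero>\<^bsub>E\<^esub>)" if "p \<in> J" "q \<in> J" for p q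
        using that X(1) e_B BB by (simp add: Y_def eX Xe)
      \<comment> \<open>The preimage of \<open>e X e\<close> keeps the entries of \<open>X\<close>
        at chosen positions.\<close>
      define Z where "Z = (\<lambda>p\<in>{..m} \<times> {..m}. X (s (fst p), s (snd p)))"
      have "X (s i, s j) \<in> piece i j" if "i \<le> m" "j \<le> m" for i j
        using mats_piece[OF X(1)[unfolded B_def] s(1)[OF that(1)] s(1)[OF that(2)]] s(2) that by simp
      then have "Z \<in> R"
        unfolding Z_def R_def restrict_mats by simp
      moreover have "emb Z = Y"
      proof (rule mats_eqI[OF emb_ext])
        show "emb Z (p, q) = Y (p, q)" if "p \<in> J" "q \<in> J" for p q
          using that lm by (auto simp: emb_apply Y_apply Z_def)
      qed (use Y(1) in \<open>auto simp: B_def intro: mats_extensional\<close>)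
      ultimately show ?thesis
        using Y(2) by (metis imageI)
    qed
    show "P \<one>\<^bsub>S\<^esub>"
      if P_add: "\<And>x y. \<lbrakk>x \<in> carrier S; y \<in> carrier S; P x; P y\<rbrakk> \<Longrightarrow> P (x \<oplus>\<^bsub>S\<^esub> y)"
        and mult: "\<And>u v. \<lbrakk>u \<in> carrier S; v \<in> carrier S; u \<otimes>\<^bsub>S\<^esub> \<theta> e = u; \<theta> e \<otimes>\<^bsub>S\<^esub> v = v\<rbrakk> \<Longrightarrow> P (u \<otimes>\<^bsub>S\<^esub> v)" for P
    proof -
      have "P (\<theta> X)" if "X \<in> B" for X
        using J J that[unfolded B_def]
      proof (induction rule: mats_induct)
        case zero
        have "P (\<zero>\<^bsub>S\<^esub> \<otimes>\<^bsub>S\<^esub> \<zero>\<^bsub>S\<^esub>)"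
          by (rule mult) (simp_all add: th(3) e_B)
        then show ?case
          by (simp only: th(8) S.l_null S.zero_closed)
      next
        case (single p q x)
        \<comment> \<open>The entry at \<open>(p, q)\<close> is factored through the chosen index
          \<open>c\<close> of the level of \<open>p\<close>: the entry 1 at \<open>(p, c)\<close>
          times \<open>x\<close> at \<open>(c, q)\<close>.\<close>
        define c where "c = s (l p)"
        have c: "c \<in> J" "l c = l p" "s (l c) = c"
          using s lm[OF single(1)] by (auto simp: c_def)
        define U where "U = single J J p c \<one>\<^bsub>E\<^esub>"
        define W where "W = single J J c q x"
        have U: "U \<in> B"
          unfolding U_def B_def using c(2) by (intro single_closed) simp
        have W: "W \<in> B"
          unfolding W_def B_def using single(3) c(2) by (intro single_closed) simp
        have "mmul J J J U e = U"
        proof (rule mats_eqI[OF mmul_extensional])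
          show "mmul J J J U e (i, j) = U (i, j)" if "i \<in> J" "j \<in> J" for i j
            using that c(3) by (auto simp: Xe[OF U]) (auto simp: U_def single_apply)
        qed (simp add: U_def single_def)
        moreover have "mmul J J J e W = W"
        proof (rule mats_eqI[OF mmul_extensional])
          show "mmul J J J e W (i, j) = W (i, j)" if "i \<in> J" "j \<in> J" for i j
            using that c(3) by (auto simp: eX[OF W]) (auto simp: W_def single_apply)
        qed (simp add: W_def single_def)
        moreover have "mmul J J J U W = single J J p q x"
          using mmul_single_single[OF J single(1) c(1) single(2) E.one_closed piece_closed[OF single(3)]]
            piece_closed[OF single(3)] by (simp add: U_def W_def)
        ultimately show ?case
          using mult[of "\<theta> U" "\<theta> W"] th(3,6) U W e_B by metis
      next
        case (add X Y)
        then show ?case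
          using th(4)[of X Y] P_add[of "\<theta> X" "\<theta> Y"] th(3) by (simp only: B_def)
      qed
      moreover have "\<one>\<^bsub>mat_alg J l\<^esub> \<in> B"
        unfolding B_def by (auto simp: restrict_mats)
      ultimately show ?thesis
        using th(7) by (metis mat_space_simps(3))
    qed
  qed
  then interpret full_corner K S "mat_alg {..m} (\<lambda>i. i)" "\<lambda>Z. \<theta> (emb Z)" "\<theta> e" .
  show ?thesis
    by (rule Morita_equivalent_corner)
qed

end

section \<open>Induction over the SGC extensions\<close>

context field_fd_algebra
begin

interpretation G: graded_algebra K E "\<lambda>i j. entry_set K A (i, j)"
  by (rule graded_algebra_E)

text \<open>If every level occurs once and serves as its own index, both sides unfold to the same
  record.\<close>

lemma replicated_algebra_eq: "replicated_algebra K A m = G.mat_alg {..m} (\<lambda>i. i)"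
  by (simp add: replicated_algebra_def G.mat_space_def G.mats_def G.mmul_def[abs_def] Let_def)

text \<open>The start of the induction: one index of level 0, whose only entry lies in the copy of
  \<open>A\<close> in \<open>E\<close>.\<close>

lemma one_by_one_matrices: "alg_iso K (G.mat_alg {..<1} (\<lambda>_. 0)) A (\<lambda>X. fst (X (0, 0)))"
proof -
  let ?J = "{..<1::nat}" and ?l = "\<lambda>_. 0 :: nat"
  have piece: "X (0, 0) \<in> entry_set K A (0, 0)" if "X \<in> G.mats ?J ?l ?J ?l" for X
    using G.mats_piece[OF that, of 0 0] by simp
  have fst_closed: "fst (X (0, 0)) \<in> carrier A" and snd_zero: "snd (X (0, 0)) = \<zero>\<^bsub>D\<^esub>"
    if "X \<in> G.mats ?J ?l ?J ?l" for X
    using piece[OF that] entry_set_iff[of "fst (X (0, 0))" "snd (X (0, 0))" 0 0] by simp_all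
  have eq: "X (0, 0) = (fst (X (0, 0)), \<zero>\<^bsub>D\<^esub>)" if "X \<in> G.mats ?J ?l ?J ?l" for X
    using snd_zero[OF that] by (metis prod.collapse)
  have "bij_betw (\<lambda>X. fst (X (0, 0))) (G.mats ?J ?l ?J ?l) (carrier A)"
  proof (rule bij_betw_imageI)
    show "inj_on (\<lambda>X. fst (X (0, 0))) (G.mats ?J ?l ?J ?l)"
    proof (rule inj_onI)
      fix X Y assume X: "X \<in> G.mats ?J ?l ?J ?l" and Y: "Y \<in> G.mats ?J ?l ?J ?l"
        and "fst (X (0, 0)) = fst (Y (0, 0))"
      then have "X (0, 0) = Y (0, 0)"
        using eq[OF X] eq[OF Y] by simp
      then show "X = Y"
        using X Y by (intro G.mats_eqI[where I = ?J and J = ?J]) (auto intro: G.mats_extensional)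
    qed
    have "a \<in> (\<lambda>X. fst (X (0, 0))) ` G.mats ?J ?l ?J ?l" if "a \<in> carrier A" for a
      by (rule image_eqI[of _ _ "\<lambda>p\<in>?J \<times> ?J. (a, \<zero>\<^bsub>D\<^esub>)"])
        (use that in \<open>auto simp: G.restrict_mats entry_set_iff\<close>)
    then show "(\<lambda>X. fst (X (0, 0))) ` G.mats ?J ?l ?J ?l = carrier A"
      using fst_closed by auto
  qed
  moreover have "linear_map K (G.mat_alg ?J ?l) A (\<lambda>X. fst (X (0, 0)))"
  proof (rule linear_mapI, unfold G.mat_space_simps)
    show "fst ((\<lambda>p\<in>?J \<times> ?J. X p \<oplus>\<^bsub>E\<^esub> Y p) (0, 0)) = fst (X (0, 0)) \<oplus>\<^bsub>A\<^esub> fst (Y (0, 0))" for X Y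
      by (cases "X (0, 0)"; cases "Y (0, 0)") simp
    show "fst ((\<lambda>p\<in>?J \<times> ?J. k \<odot>\<^bsub>E\<^esub> X p) (0, 0)) = k \<odot>\<^bsub>A\<^esub> fst (X (0, 0))" for k X
      by (cases "X (0, 0)") simp
  qed (rule fst_closed)
  moreover have "fst (G.mmul ?J ?J ?J X Y (0, 0)) = fst (X (0, 0)) \<otimes>\<^bsub>A\<^esub> fst (Y (0, 0))"
    if X: "X \<in> G.mats ?J ?l ?J ?l" and Y: "Y \<in> G.mats ?J ?l ?J ?l" for X Y
  proof -
    have "G.mmul ?J ?J ?J X Y (0, 0) = (\<Oplus>\<^bsub>E\<^esub>k\<in>{0}. X (0, k) \<otimes>\<^bsub>E\<^esub> Y (k, 0))"
      using G.mmul_apply[of 0 ?J 0 ?J ?J X Y] by (simp add: lessThan_Suc)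
    also have "\<dots> = X (0, 0) \<otimes>\<^bsub>E\<^esub> Y (0, 0)"
      using G.mats_closed[OF X, of 0 0] G.mats_closed[OF Y, of 0 0]
      by (subst G.E.finsum_insert) (simp_all add: G.E.finsum_empty del: entry_simps)
    finally show ?thesis
      by (cases "X (0, 0)"; cases "Y (0, 0)") simp
  qed
  ultimately show ?thesis
    by (simp add: alg_iso_def)
qed

text \<open>The index set produced here has \<open>2 ^ m\<close> elements, and level
  \<open>j\<close> occurs \<open>m choose j\<close> times. Of this only surjectivity onto the levels
  up to \<open>m\<close> is recorded, since both the next step and the choice of a full idempotent
  rely on it.\<close>

lemma SGC_as_matrices:
  assumes hom: "carrier (module_hom K A (dual_module K A) (regular_module A))
           = {\<lambda>\<phi>\<in>carrier (dual_module K A). \<zero>\<^bsub>A\<^esub>}"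
  shows "\<exists>n l \<theta>. l ` {..<n} = {..m} \<and> fd_algebra K (SGC K A m) \<and> alg_iso K (G.mat_alg {..<n} l) (SGC K A m) \<theta>"
proof (induction m)
  case 0
  have "alg_iso K (G.mat_alg {..<1} (\<lambda>_. 0)) (SGC K A 0) (to_coords K A \<circ> (\<lambda>X. fst (X (0, 0))))"
    unfolding SGC.simps by (rule alg_iso_trans[OF one_by_one_matrices alg_iso_coordinate_copy[OF A.fd_algebra_axioms]])
  moreover have "fd_algebra K (SGC K A 0)"
    unfolding SGC.simps
    by (rule fd_algebra_transport[OF A.fd_algebra_axioms alg_iso_coordinate_copy[OF A.fd_algebra_axioms]])
  moreover have "(\<lambda>_. 0) ` {..<1::nat} = {..0::nat}"
    by auto
  ultimately show ?case
    by blast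
next
  case (Suc m)
  interpret P: paired_graded_algebra K E "\<lambda>i j. entry_set K A (i, j)" "entry_trace A"
    by (rule paired_graded_algebra_E[OF hom])
  obtain n l \<theta> where l: "l ` {..<n} = {..m}" and S: "fd_algebra K (SGC K A m)"
    and \<theta>: "alg_iso K (G.mat_alg {..<n} l) (SGC K A m) \<theta>"
    using Suc.IH by blast
  define u where "u = (\<lambda>p. if p < n then l p else Suc (l (p - n)))"
  let ?End = "End_algebra K (SGC K A m) (direct_sum (regular_module (SGC K A m)) (dual_module K (SGC K A m)))"
  note step = P.End_algebra_regular_plus_dual[OF S \<theta> l, folded u_def]
  obtain \<Lambda> where \<Lambda>: "alg_iso K (G.mat_alg {..<n + n} u) ?End \<Lambda>"
    using step(2) by blast
  have End: "fd_algebra K ?End"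
    by (rule fd_algebra_transport[OF G.fd_algebra_mat_alg[OF finite_lessThan] \<Lambda>])
  \<comment> \<open>The recursion defining \<open>SGC\<close> replaces each endomorphism algebra by
    its coordinate copy, so one more isomorphism has to be appended.\<close>
  note copy = alg_iso_coordinate_copy[OF End, folded SGC.simps(2)]
  show ?case
    using step(1) fd_algebra_transport[OF End copy] alg_iso_trans[OF \<Lambda> copy] by blast
qed

end

theorem theorem1p2:
  fixes K :: "('k, 'z) ring_scheme" and A :: "('k, 'a, 'e) module_scheme" and m :: nat
  assumes "field K"
    and "fd_algebra K A"
    and "carrier (module_hom K A (dual_module K A) (regular_module A))
           = {\<lambda>\<phi>\<in>carrier (dual_module K A). \<zero>\<^bsub>A\<^esub>}"
    and "m \<ge> 1"
  shows "Morita_equivalent K (SGC K A m) (replicated_algebra K A m)"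
proof -
  interpret field_fd_algebra K A
    by (intro field_fd_algebra.intro assms)
  interpret graded_algebra K E "\<lambda>i j. entry_set K A (i, j)"
    by (rule graded_algebra_E)
  show ?thesis
    using SGC_as_matrices[OF assms(3)] Morita_equivalent_mat_alg
    unfolding replicated_algebra_eq by (metis finite_lessThan)
qed

end
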